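(* Let $\omega_0\in C_c^\infty(\Omega^c)$ be nonnegative, let $\alpha\in\mathbb{R}$, let $m=\int_{\Omega^c}\omega_0\,dx$, and let $\omega(x,t)$ be the solution of the exterior vorticity problem (described in the context) with initial data $\omega_0$ and harmonic coefficient $\alpha$. Then there exists a constant $M>0$ such that $$\int_{\Omega^c}|T(x)|^2\bigl(\log|T(x)|\bigr)\,\omega(x,t)\,dx\le M(1+t)\qquad\text{for all }t\ge 0.$$ Moreover, if either $\alpha\le 0$ or $\alpha>m$, then there is a constant $M>0$ such that $$\int_{\Omega^c}|T(x)|^2\bigl(\log^2|T(x)|\bigr)\,\omega(x,t)\,dx\le M(1+t)\qquad\text{for all }t\ge 0.$$
   Context: Let $\Gamma\subset\mathbb{R}^2$ be a smooth Jordan curve, $\Omega$ the bounded and $\Omega^c$ the unbounded connected component of $\mathbb{R}^2\setminus\Gamma$ (both open). Identify $\mathbb{R}^2$ with $\mathbb{C}$. There is a conformal (biholomorphic) map $T:\Omega^c\to\{|z|>1\}$, extending continuously to the boundary and mapping $\Gamma$ to the unit circle, with $T(z)=\beta z+h(z)$, $\beta>0$, $h$ bounded holomorphic on $\Omega^c$; it satisfies $|h'(z)|\le C/|z|^2$, $|h''(z)|\le C/|z|^3$, and $DT$, $DT^{-1}$ are bounded. Fix this $T$. Write $z^*=z/|z|^2$, $(a,b)^\perp=(-b,a)$, $\nabla^\perp=(-\partial_2,\partial_1)$. The Green's function of the Laplacian in $\Omega^c$ is $$G_{\Omega^c}(x,y)=\frac1{2\pi}\log\frac{|T(x)-T(y)|}{|T(x)-T(y)^*|\,|T(y)|},$$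 and the normalized harmonic vector field is $H_{\Omega^c}(x)=\frac1{2\pi}\nabla^\perp\log|T(x)|$. The exterior vorticity problem (vorticity form of the incompressible 2D Euler equations in $\Omega^c$) with initial vorticity $\omega_0$ and harmonic coefficient $\alpha\in\mathbb{R}$ (a constant in time) is $$\omega_t+u\cdot\nabla\omega=0 \text{ in }\Omega^c\times(0,\infty),\quad u=\nabla^\perp\psi+\alpha H_{\Omega^c},\quad \psi(x,t)=\int_{\Omega^c}G_{\Omega^c}(x,y)\omega(y,t)\,dy,\quad \omega(\cdot,0)=\omega_0.$$ For $\omega_0\in C_c^\infty(\Omega^c)$ it has a global smooth solution, with $\omega(\cdot,t)$ compactly supported for each $t$, and $L^p$ norms of $\omega(\cdot,t)$ are conserved. Constants may depend on $\Omega$, $\omega_0$, $\alpha$ but not on $t$. *)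

theory Defs
  imports "HOL-Analysis.Analysis"
begin

(* For open S the derivatives below are the ordinary ones. The definition is also used for
   S = U \<times> {0..} with U open in the plane; there derivatives within S are still unique and
   those in time direction are one-sided at time 0. *)
fun Ck_on :: "nat \<Rightarrow> 'a::euclidean_space set \<Rightarrow> ('a \<Rightarrow> 'b::real_normed_vector) \<Rightarrow> bool" where
  "Ck_on 0 S f \<longleftrightarrow> continuous_on S f"
| "Ck_on (Suc k) S f \<longleftrightarrow>
     f differentiable_on S \<and> (\<forall>v. Ck_on k S (\<lambda>x. frechet_derivative f (at x within S) v))"

definition smooth_on :: "'a::euclidean_space set \<Rightarrow> ('a \<Rightarrow> 'b::real_normed_vector) \<Rightarrow> bool" where
  "smooth_on S f \<longleftrightarrow> (\<forall>k. Ck_on k S f)"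

(* The support in U is contained in a compact subset of U; values outside U are irrelevant. *)
definition compactly_supported_in :: "'a::topological_space set \<Rightarrow> ('a \<Rightarrow> real) \<Rightarrow> bool" where
  "compactly_supported_in U f \<longleftrightarrow> (\<exists>K. compact K \<and> K \<subseteq> U \<and> (\<forall>x\<in>U - K. f x = 0))"

(* A simple closed curve with a 1-periodic, regular, infinitely differentiable parametrization. *)
definition smooth_Jordan_curve :: "complex set \<Rightarrow> bool" where
  "smooth_Jordan_curve \<Gamma> \<longleftrightarrow>
     (\<exists>\<gamma>::real \<Rightarrow> complex.
        smooth_on UNIV \<gamma> \<and> (\<forall>t. \<gamma> (t + 1) = \<gamma> t) \<and>
        (\<forall>t. vector_derivative \<gamma> (at t) \<noteq> 0) \<and> simple_path \<gamma> \<and> path_image \<gamma> = \<Gamma>)"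

(* The bounded and unbounded components of the complement of \<Gamma> are inside \<Gamma> and outside \<Gamma>.
   On \<Gamma> itself, T denotes the continuous extension of the conformal map.
   The decay bounds on h are multiplied out because 0 may lie in outside \<Gamma>, where division
   by 0 would turn them into the false requirement that the derivative vanishes there.
   The Jacobian matrices of T and of its inverse are bounded iff the complex derivatives are. *)
definition exterior_conformal_map :: "complex set \<Rightarrow> (complex \<Rightarrow> complex) \<Rightarrow> bool" where
  "exterior_conformal_map \<Gamma> T \<longleftrightarrow>
     T holomorphic_on outside \<Gamma> \<and>
     bij_betw T (outside \<Gamma>) {z. norm z > 1} \<and>
     inv_into (outside \<Gamma>) T holomorphic_on {z. norm z > 1} \<and>
     continuous_on (outside \<Gamma> \<union> \<Gamma>) T \<and> T ` \<Gamma> = sphere 0 1 \<and>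
     (\<exists>\<beta> h C. \<beta> > 0 \<and> h holomorphic_on outside \<Gamma> \<and> bounded (h ` outside \<Gamma>) \<and>
        (\<forall>z\<in>outside \<Gamma>.
           T z = complex_of_real \<beta> * z + h z \<and>
           norm z ^ 2 * norm (deriv h z) \<le> C \<and>
           norm z ^ 3 * norm (deriv (deriv h) z) \<le> C)) \<and>
     bounded (deriv T ` outside \<Gamma>) \<and>
     bounded (deriv (inv_into (outside \<Gamma>) T) ` {z. norm z > 1})"

definition grad :: "(complex \<Rightarrow> real) \<Rightarrow> complex \<Rightarrow> complex" where
  "grad f x = Complex (frechet_derivative f (at x) 1) (frechet_derivative f (at x) \<i>)"

definition perp :: "complex \<Rightarrow> complex" where
  "perp z = Complex (- Im z) (Re z)"

definition star :: "complex \<Rightarrow> complex" where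
  "star z = z /\<^sub>R (norm z)\<^sup>2"

definition green :: "(complex \<Rightarrow> complex) \<Rightarrow> complex \<Rightarrow> complex \<Rightarrow> real" where
  "green T x y =
     1 / (2 * pi) * ln (norm (T x - T y) / (norm (T x - star (T y)) * norm (T y)))"

definition harmonic_field :: "(complex \<Rightarrow> complex) \<Rightarrow> complex \<Rightarrow> complex" where
  "harmonic_field T x = (1 / (2 * pi)) *\<^sub>R perp (grad (\<lambda>y. ln (norm (T y))) x)"

definition stream_function ::
    "complex set \<Rightarrow> (complex \<Rightarrow> complex) \<Rightarrow> (complex \<Rightarrow> real) \<Rightarrow> complex \<Rightarrow> real" where
  "stream_function U T w x = (LINT y:U|lborel. green T x y * w y)"

definition velocity ::
    "complex set \<Rightarrow> (complex \<Rightarrow> complex) \<Rightarrow> real \<Rightarrow> (complex \<Rightarrow> real) \<Rightarrow> complex \<Rightarrow> complex" where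
  "velocity U T \<alpha> w x = perp (grad (stream_function U T w) x) + \<alpha> *\<^sub>R harmonic_field T x"

(* Global smooth solution of the vorticity equation in U; the last two clauses are conservation
   of the L^p norms for finite p and for p = \<infinity>. *)
definition vorticity_solution ::
    "complex set \<Rightarrow> (complex \<Rightarrow> complex) \<Rightarrow> real \<Rightarrow> (complex \<Rightarrow> real) \<Rightarrow>
     (complex \<Rightarrow> real \<Rightarrow> real) \<Rightarrow> bool" where
  "vorticity_solution U T \<alpha> \<omega>\<^sub>0 \<omega> \<longleftrightarrow>
     smooth_on (U \<times> {0..}) (\<lambda>(x, t). \<omega> x t) \<and>
     (\<forall>t\<ge>0. compactly_supported_in U (\<lambda>x. \<omega> x t)) \<and>
     (\<forall>x\<in>U. \<forall>t>0.
        deriv (\<lambda>s. \<omega> x s) t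
          + velocity U T \<alpha> (\<lambda>y. \<omega> y t) x \<bullet> grad (\<lambda>y. \<omega> y t) x = 0) \<and>
     (\<forall>x\<in>U. \<omega> x 0 = \<omega>\<^sub>0 x) \<and>
     (\<forall>p\<ge>1. \<forall>t\<ge>0.
        (LINT x:U|lborel. \<bar>\<omega> x t\<bar> powr p) = (LINT x:U|lborel. \<bar>\<omega>\<^sub>0 x\<bar> powr p)) \<and>
     (\<forall>t\<ge>0. (SUP x\<in>U. \<bar>\<omega> x t\<bar>) = (SUP x\<in>U. \<bar>\<omega>\<^sub>0 x\<bar>))"

end

theory Submission
  imports Defs "HOL-Complex_Analysis.Complex_Analysis" "HOL-Real_Asymp.Real_Asymp"
begin

text \<open>
  Write \<open>X = T x\<close>, \<open>r = |X|\<close> and \<open>lam = |T'|\<^sup>2\<close>. The harmonic field is tangent to the level curves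
  of \<open>|T|\<close>, so it does not change moments \<open>\<integral> f(|T|) \<omega>\<close>. In the coordinates \<open>X, Y\<close> the Green's
  function depends only on \<open>|X|\<close>, \<open>|Y|\<close> and the angle between \<open>X\<close> and \<open>Y\<close>, so its derivatives in
  the angles of \<open>X\<close> and of \<open>Y\<close> are opposite. With \<open>p(r) = f'(r)/r\<close> symmetrization therefore gives

    \<open>d/dt \<integral> f(|T|) \<omega> = 1/(4\<pi>) \<integral>\<integral> (lam(x) p(|X|) - lam(y) p(|Y|)) K(X,Y) \<omega>(x) \<omega>(y) dx dy\<close>

  where the kernel \<open>K\<close> (the constant \<open>swirl\<close> below) satisfies \<open>|K| \<le> min(|X|,|Y|) / |X - Y|\<close>.
  Since \<open>lam\<close> differs from its limit at infinity by \<open>O(1/r\<^sup>2)\<close>, the choice \<open>f(r) = r\<^sup>2 log r\<close> makes the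
  integrand at most \<open>C (1 + 1/|X - Y|) |\<omega>(x)| |\<omega>(y)|\<close>, because \<open>p\<close> varies by at most
  \<open>C |X - Y| / min(|X|,|Y|)\<close> between the two points. The function \<open>1/|X - Y|\<close> is uniformly integrable
  against \<open>\<omega>\<close>, whose norms in \<open>L\<^sup>1\<close> and \<open>L\<^sup>\<infinity>\<close> are conserved. Hence the moment grows at most linearly.

  For \<open>f(r) = r\<^sup>2 log\<^sup>2 r\<close> the same estimate has the additional term \<open>log min(|X|,|Y|)\<close>
  (\<open>radial_kernel_bound\<close>), and its double integral is controlled by the conserved energy
  \<open>\<integral>\<integral> g(X,Y) \<omega>(x) \<omega>(y) + 2\<alpha> \<integral> log|X| \<omega>(x)\<close>, where \<open>g = log|X - Y| - log|1 - X cnj Y| \<le> 0\<close>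
  obeys \<open>log min(|X|,|Y|) - log 3 \<le> -g \<le> log|X| + log|Y| + 1/|X - Y|\<close>. For \<open>\<alpha> \<le> 0\<close> the energy bounds
  \<open>-\<integral>\<integral> g \<omega> \<omega>\<close> from above; for \<open>\<alpha> > m\<close> the upper estimate of \<open>-g\<close> shows that it bounds
  \<open>(\<alpha> - m) \<integral> log|X| \<omega>\<close> (\<open>min_log_pairing_bounded\<close>).

  The support of \<open>\<omega>\<close> is compact at each time, with no uniformity in time. Weak formulations are
  therefore tested with functions multiplied by cutoffs in \<open>|T|\<close>, and \<open>evolution_bound\<close> removes the
  cutoffs: the error at the boundary vanishes because the speed across the level curves of \<open>|T|\<close>
  tends to zero there, while the width of the cutoff layer compensates its steepness. The same lemma
  yields conservation of \<open>\<integral> \<omega>\<close>, hence \<open>\<omega> \<ge> 0\<close> almost everywhere by conservation of \<open>\<integral> |\<omega>|\<close>, and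
  conservation of energy: the increment of the energy between two times is the increment of
  \<open>\<integral> P \<omega>\<close> for the fixed average \<open>P\<close> of the two total stream functions, and it is of higher than
  first order in the time step because \<open>t \<mapsto> \<omega>(t)\<close> is continuous in \<open>L\<^sup>1\<close>.
\<close>

section \<open>A weakly singular kernel\<close>

text \<open>
  The exponent \<open>-3/2\<close> is more singular than the kernel \<open>1/d\<close> of the velocity but still integrable in
  the plane. The margin of \<open>1/2\<close> pays for the moduli of continuity and for the decay at the boundary.
\<close>
definition sing :: "real \<Rightarrow> real" where
  "sing d = 1 / (d * sqrt d)"

lemma sing_nonneg: "d \<ge> 0 \<Longrightarrow> sing d \<ge> 0"
  by (simp add: sing_def)

lemma sing_antimono: "0 < d \<Longrightarrow> d \<le> e \<Longrightarrow> sing e \<le> sing d"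
  unfolding sing_def by (intro divide_left_mono mult_mono mult_pos_pos) auto

lemma sing_mult: "sing (c * d) = sing c * sing d"
  by (simp add: sing_def real_sqrt_mult)

lemma sing_measurable [measurable]: "sing \<in> borel_measurable borel"
  unfolding sing_def[abs_def] by measurable

lemma inverse_le_sing: 
  assumes "d > 0" shows "1 / d \<le> 1 + sing d"
proof (cases "d \<ge> 1")
  case True
  then have "1 / d \<le> 1" by simp
  then show ?thesis using sing_nonneg[of d] assms by linarith
next
  case False
  then have "sqrt d \<le> 1" using assms by simp
  then have "d * sqrt d \<le> d" using assms by (simp add: mult_left_le)
  then have "1 / d \<le> sing d"
    unfolding sing_def using assms by (intro divide_left_mono) auto
  then show ?thesis by simp
qed

lemma sing_quarter_power: "sing ((1/4)^k) = 8 ^ k"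
proof (induction k)
  case (Suc k)
  have "sqrt (1/4::real) = 1/2" by (rule real_sqrt_unique) (auto simp: power2_eq_square)
  then have "sing (1/4) = 8" unfolding sing_def by (simp only:) simp
  then show ?case using Suc by (simp only: power_Suc sing_mult)
qed (simp add: sing_def)

text \<open>
  On the shell between the radii \<open>4^(-k-1)\<close> and \<open>4^(-k)\<close> the integrand is at most \<open>8^(k+1)\<close>, and the area
  is at most \<open>\<pi> 16^(-k)\<close>, so the shells contribute a geometric series.
\<close>
lemma nn_integral_sing_cball:
  fixes x :: complex
  shows "(\<integral>\<^sup>+y. indicator (cball x 1) y * ennreal (sing (norm (x - y))) \<partial>lborel) \<le> ennreal (16 * pi)"
proof -
  (* the ratio 1/4 of the radii makes sing rational on them *)
  define c :: "nat \<Rightarrow> complex \<Rightarrow> ennreal" where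
    "c k y = ennreal (8 ^ Suc k) * indicator (cball x ((1/4)^k)) y" for k y
  have cmeas [measurable]: "c k \<in> borel_measurable lborel" for k
    unfolding c_def by (intro borel_measurable_times_ennreal borel_measurable_indicator) auto
  have "indicator (cball x 1) y * ennreal (sing (norm (x - y))) \<le> (\<Sum>k. c k y)" for y
  proof (cases "y \<in> cball x 1 \<and> y \<noteq> x")
    case True
    define d where "d = norm (x - y)"
    have d: "0 < d" "d \<le> 1" using True by (auto simp: d_def dist_norm)
    obtain n where n: "(1/4::real) ^ n < d"
      using real_arch_pow_inv[of d "1/4"] d by auto
    define m where "m = (LEAST n. (1/4::real) ^ n < d)"
    have m: "(1/4::real) ^ m < d" unfolding m_def using LeastI[of "\<lambda>n. (1/4::real) ^ n < d" n] n by simp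
    have "m \<noteq> 0" using m d by (auto intro: gr0I)
    then obtain k where k: "m = Suc k" by (cases m) auto
    have "\<not> (1/4::real) ^ k < d"
      using not_less_Least[of k "\<lambda>n. (1/4::real) ^ n < d"] k unfolding m_def by auto
    then have dk: "d \<le> (1/4) ^ k" by simp
    have "sing d \<le> sing ((1/4) ^ Suc k)"
      using m k by (intro sing_antimono) auto
    also have "\<dots> = 8 ^ Suc k" by (rule sing_quarter_power)
    finally have "ennreal (sing d) \<le> c k y"
      using dk by (auto simp: c_def indicator_def d_def dist_norm intro!: ennreal_leI)
    also have "\<dots> \<le> (\<Sum>k. c k y)"
      using sum_le_suminf[of "\<lambda>k. c k y" "{k}"] by simp
    finally show ?thesis using True by (simp add: d_def)
  qed (auto simp: sing_def)
  then have "(\<integral>\<^sup>+y. indicator (cball x 1) y * ennreal (sing (norm (x - y))) \<partial>lborel) 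
    \<le> (\<integral>\<^sup>+y. (\<Sum>k. c k y) \<partial>lborel)"
    by (intro nn_integral_mono) auto
  also have "\<dots> = (\<Sum>k. \<integral>\<^sup>+y. c k y \<partial>lborel)"
    by (rule nn_integral_suminf) measurable
  also have "\<dots> = (\<Sum>k. ennreal (8 * pi * (1/2)^k))"
  proof (intro suminf_cong)
    fix k :: nat
    have "(\<integral>\<^sup>+y. c k y \<partial>lborel) = ennreal (8 ^ Suc k) * emeasure lborel (cball x ((1/4)^k))"
      unfolding c_def by (subst nn_integral_cmult_indicator) auto
    also have "\<dots> = ennreal (8 ^ Suc k) * ennreal (pi * ((1/4)^k)^2)"
      by (subst emeasure_cball) (auto simp: unit_ball_vol_2)
    also have "\<dots> = ennreal (8 ^ Suc k * (pi * ((1/4)^k)^2))"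
      by (subst ennreal_mult) auto
    also have "8 ^ Suc k * (pi * ((1/4)^k)^2) = 8 * pi * ((1/2::real)^k)"
    proof -
      have "((1/4::real)^k)^2 = ((1/4)^2)^k" by (metis power_mult mult.commute)
      then have "(8::real)^k * ((1/4)^k)^2 = (8 * (1/4)^2)^k" by (simp only: power_mult_distrib)
      also have "8 * (1/4)^2 = (1/2::real)" by (simp add: power2_eq_square)
      finally have "(8::real)^k * ((1/4)^k)^2 = (1/2)^k" .
      then show ?thesis by simp
    qed
    finally show "(\<integral>\<^sup>+y. c k y \<partial>lborel) = ennreal (8 * pi * (1/2)^k)" .
  qed
  also have "\<dots> = ennreal (16 * pi)"
  proof (rule suminf_ennreal_eq)
    have "(\<lambda>k. (1/2::real)^k) sums 2" using geometric_sums[of "1/2::real"] by simp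
    then show "(\<lambda>k. 8 * pi * (1/2)^k) sums (16 * pi)"
      using sums_mult[of _ 2 "8*pi"] by fastforce
  qed auto
  finally show ?thesis .
qed

text \<open>
  The remainder of first order is \<open>O(|h|^(3/2))\<close> with an integrable factor that also accounts for the
  logarithmic singularity at \<open>z + h = 0\<close>. This allows one to differentiate a logarithmic potential under
  the integral without excising a neighbourhood of the pole.
\<close>
lemma ln_norm_taylor:
  fixes z h :: complex
  assumes "z \<noteq> 0" "z + h \<noteq> 0"
  shows "\<bar>ln (norm (z + h)) - ln (norm z) - Re (h / z)\<bar>
    \<le> 9 * (norm h * sqrt (norm h)) * (sing (norm z) + sing (norm (z + h)))"
proof -
  define w where "w = h / z"
  define A where "A = norm h * sqrt (norm h)"
  have A0: "A \<ge> 0" by (simp add: A_def)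
  have zw: "z + h = z * (1 + w)" using assms by (simp add: w_def field_simps)
  have w1: "1 + w \<noteq> 0" using assms zw by auto
  have lneq: "ln (norm (z + h)) - ln (norm z) = ln (norm (1 + w))"
    using assms w1 by (simp add: zw norm_mult ln_mult)
  have nw: "norm w * sqrt (norm w) = A * sing (norm z)"
    by (simp add: w_def A_def sing_def norm_divide real_sqrt_divide)
  have S: "sing (norm z) \<ge> 0" "sing (norm (z + h)) \<ge> 0" by (auto intro: sing_nonneg)
  (* either h is small compared with z and the remainder is quadratic, or the three terms
     are estimated separately *)
  show ?thesis
  proof (cases "norm w \<le> 1/2")
    case True
    have "ln (norm (1 + w)) - Re w = Re (Ln (1 + w) - w)"
      using w1 by (simp add: Re_Ln)
    then have "\<bar>ln (norm (1 + w)) - Re w\<bar> \<le> norm (Ln (1 + w) - w)"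
      by (metis abs_Re_le_cmod)
    also have "\<dots> \<le> norm w ^ 2 / (1 - norm w)"
      using Ln_approx_linear[of w] True by auto
    also have "\<dots> \<le> norm w ^ 2 / (1/2)"
      using True by (intro divide_left_mono) auto
    also have "\<dots> = 2 * (norm w * norm w)" by (simp add: power2_eq_square)
    also have "\<dots> \<le> 2 * (norm w * sqrt (norm w))"
    proof -
      have "norm w \<le> sqrt (norm w)" using True
        by (intro real_le_rsqrt) (auto simp: power2_eq_square intro: mult_left_le_one_le)
      then show ?thesis by (intro mult_left_mono) auto
    qed
    also have "\<dots> = 2 * (A * sing (norm z))" by (simp add: nw)
    also have "\<dots> \<le> 9 * A * (sing (norm z) + sing (norm (z + h)))"
      using A0 S by (simp add: distrib_left mult_nonneg_nonneg add_increasing2)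
    finally show ?thesis unfolding lneq A_def w_def by simp
  next
    case False
    define a b u where "a = norm z" "b = norm (z + h)" "u = norm w"
    have pos: "a > 0" "b > 0" "u > 1/2" using assms False by (auto simp: a_b_u_def)
    have s2: "sqrt 2 \<le> 3/2" by (rule real_le_lsqrt) (auto simp: power2_eq_square)
    have u_le: "u \<le> sqrt 2 * (u * sqrt u)"
    proof -
      have "1 \<le> sqrt (2 * u)" using pos by simp
      then have "1 \<le> sqrt 2 * sqrt u" by (simp add: real_sqrt_mult)
      then have "u * 1 \<le> u * (sqrt 2 * sqrt u)" using pos by (intro mult_left_mono) auto
      then show ?thesis by (simp add: algebra_simps)
    qed
    have uA: "u * sqrt u = A * sing a" using nw by (simp add: a_b_u_def)
    have "sqrt 2 * (u * sqrt u) \<le> 3/2 * (u * sqrt u)"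
      using s2 pos by (intro mult_right_mono) auto
    then have u3: "u \<le> 3/2 * (A * sing a)"
      using u_le unfolding uA by linarith
    have one3: "1 \<le> 3 * (A * sing a)" using u3 pos by simp
    have b_w: "norm (1 + w) = b / a" using assms by (simp add: a_b_u_def zw norm_mult)
    have ab: "a / b \<le> 3 * (A * (sing a + sing b))"
    proof (cases "b \<le> a")
      case True
      have "a / b \<le> a / b * sqrt (a / b)" 
        using True pos mult_left_mono[of 1 "sqrt (a / b)" "a / b"] by simp
      also have "\<dots> = a * sqrt a * sing b" by (simp add: sing_def real_sqrt_divide)
      also have "\<dots> \<le> (3 * A) * sing b"
      proof (intro mult_right_mono)
        have sa: "sing a > 0" using pos by (simp add: sing_def)
        have "sing a * (a * sqrt a) = 1" using pos by (simp add: sing_def)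
        then have "a * sqrt a = (1 / sing a)" using sa by (simp add: field_simps)
        also have "\<dots> \<le> 3 * A" using one3 sa by (simp add: field_simps)
        finally show "a * sqrt a \<le> 3 * A" .
      qed (use S in \<open>auto simp: a_b_u_def\<close>)
      also have "\<dots> \<le> 3 * (A * (sing a + sing b))" using A0 S by (simp add: algebra_simps a_b_u_def)
      finally show ?thesis .
    next
      case False
      then have "a / b \<le> 1" using pos by simp
      also have "\<dots> \<le> 3 * (A * sing a)" by (rule one3)
      also have "\<dots> \<le> 3 * (A * (sing a + sing b))" using A0 S by (simp add: algebra_simps a_b_u_def)
      finally show ?thesis .
    qed
    have "\<bar>ln (b / a)\<bar> \<le> b / a + a / b"
    proof -
      have "ln (b / a) \<le> b / a" using ln_bound[of "b/a"] pos by simp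
      moreover have "ln (a / b) \<le> a / b" using ln_bound[of "a/b"] pos by simp
      moreover have "ln (a / b) = - ln (b / a)" using pos by (simp add: ln_div)
      moreover have "a / b > 0" "b / a > 0" using pos by auto
      ultimately show ?thesis by linarith
    qed
    moreover have "b / a \<le> 1 + u" using b_w norm_triangle_ineq[of 1 w] by (simp add: a_b_u_def)
    moreover have "\<bar>Re w\<bar> \<le> u" by (simp add: a_b_u_def abs_Re_le_cmod)
    ultimately have "\<bar>ln (norm (1 + w)) - Re w\<bar> \<le> 1 + 2 * u + a / b"
      unfolding b_w by linarith
    also have "\<dots> \<le> 3 * (A * sing a) + 3 * (A * sing a) + 3 * (A * (sing a + sing b))"
      using one3 u3 ab by linarith
    also have "\<dots> \<le> 9 * A * (sing a + sing b)" using A0 S by (simp add: algebra_simps a_b_u_def)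
    finally show ?thesis unfolding lneq A_def w_def a_b_u_def by simp
  qed
qed

text \<open>
  The same device for the gradient: it makes the velocity Hoelder continuous with exponent \<open>1/2\<close>.
\<close>
lemma inverse_hoelder:
  fixes z h :: complex
  assumes "z \<noteq> 0" "z + h \<noteq> 0"
  shows "norm (1 / (z + h) - 1 / z) \<le> 2 * sqrt (norm h) * (sing (norm z) + sing (norm (z + h)))"
proof -
  define a b where "a = sqrt (norm z)" "b = sqrt (norm (z + h))"
  have pos: "a > 0" "b > 0" using assms by (auto simp: a_b_def)
  have a2: "norm z = a * a" "norm (z + h) = b * b" by (auto simp: a_b_def)
  have sing: "sing (norm z) = 1 / a ^ 3" "sing (norm (z + h)) = 1 / b ^ 3"
    using pos by (auto simp: sing_def a2 power3_eq_cube real_sqrt_mult)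
  have "1 / (z + h) - 1 / z = - h / (z * (z + h))" using assms by (simp add: field_simps)
  then have "norm (1 / (z + h) - 1 / z) = sqrt (norm h) * (sqrt (norm h) / (a * a * (b * b)))"
    by (simp add: norm_mult norm_divide a2)
  also have "\<dots> \<le> sqrt (norm h) * (2 * (1 / a ^ 3 + 1 / b ^ 3))"
  proof (intro mult_left_mono)
  have "sqrt (norm h) / (a * a * (b * b)) \<le> (a + b) / (a * a * (b * b))"
  proof (intro divide_right_mono)
    have "norm h \<le> norm (z + h) + norm z" using norm_triangle_ineq4[of "z + h" z] by simp
    also have "\<dots> \<le> (a + b)^2" using pos unfolding a2 by (simp add: power2_eq_square algebra_simps)
    finally show "sqrt (norm h) \<le> a + b" using pos by (intro real_le_lsqrt) auto
  qed auto
  also have "(a + b) / (a * a * (b * b)) \<le> 2 * (1 / a ^ 3 + 1 / b ^ 3)"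
  proof -
    define x y where "x = 1 / a" "y = 1 / b"
    have xy: "x > 0" "y > 0" using pos by (auto simp: x_y_def)
    have "(a + b) / (a * a * (b * b)) = x * y^2 + x^2 * y"
      using pos by (simp add: x_y_def field_simps power2_eq_square)
    also have "\<dots> \<le> 2 * (x ^ 3 + y ^ 3)"
    proof -
      have "0 \<le> (x - y)^2 * (x + y)" using xy by auto
      moreover have "0 \<le> x^3 + y^3" using xy by (auto intro: add_nonneg_nonneg)
      ultimately show ?thesis by (simp add: power2_eq_square power3_eq_cube algebra_simps)
    qed
    finally show ?thesis by (simp add: x_y_def power_one_over)
  qed
  finally show "sqrt (norm h) / (a * a * (b * b)) \<le> 2 * (1 / a ^ 3 + 1 / b ^ 3)" .
  qed auto
  finally show ?thesis unfolding sing by (simp add: ac_simps)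
qed

section \<open>The Green's function of the exterior of the unit disc\<close>

text \<open>
  The Green's function of the exterior of the unit disc, multiplied by \<open>2\<pi>\<close>. The second term is the
  contribution of the image vortex at \<open>1 / cnj Y\<close>.
\<close>
definition green_log :: "complex \<Rightarrow> complex \<Rightarrow> real" where
  "green_log X Y = ln (norm (X - Y)) - ln (norm (1 - X * cnj Y))"

text \<open>
  The gradient of \<open>green_log\<close> in \<open>X\<close>, as a complex number.
\<close>
definition green_grad :: "complex \<Rightarrow> complex \<Rightarrow> complex" where
  "green_grad X Y = 1 / cnj (X - Y) - 1 / cnj (X - 1 / cnj Y)"

text \<open>
  The amount by which the squared distance to the image vortex, scaled by \<open>|Y|\<^sup>2\<close>, exceeds the squared
  distance to the vortex (\<open>norm_reflected_diff\<close>); it vanishes on the unit circle.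
\<close>
definition wall :: "complex \<Rightarrow> complex \<Rightarrow> real" where
  "wall X Y = ((norm X)\<^sup>2 - 1) * ((norm Y)\<^sup>2 - 1)"

text \<open>
  The product of \<open>|X|\<close> with the radial speed at \<open>X\<close> induced by a vortex of strength \<open>2\<pi>\<close> at \<open>Y\<close>
  (\<open>swirl_eq\<close>). It equals minus the derivative of \<open>green_log\<close> in the angle of \<open>X\<close>.
\<close>
definition swirl :: "complex \<Rightarrow> complex \<Rightarrow> real" where
  "swirl X Y = Im (cnj X * Y) * wall X Y / ((norm (X - Y))\<^sup>2 * ((norm (X - Y))\<^sup>2 + wall X Y))"

lemma inner_complex_Re: "inner x y = Re (x * cnj y)"
  by (simp add: inner_complex_def)

lemma wall_pos: "norm X > 1 \<Longrightarrow> norm Y > 1 \<Longrightarrow> wall X Y > 0"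
  by (simp add: wall_def)

lemma wall_commute: "wall X Y = wall Y X"
  by (simp add: wall_def mult.commute)

lemma norm_reflected_diff: "(norm (1 - X * cnj Y))\<^sup>2 = (norm (X - Y))\<^sup>2 + wall X Y"
proof -
  obtain a b c d where "X = Complex a b" "Y = Complex c d" by (metis complex.exhaust)
  then show ?thesis
    by (simp add: wall_def cmod_power2) (simp add: power2_eq_square algebra_simps)
qed

lemma reflected_nonzero:
  assumes "norm X > 1" "norm Y > 1"
  shows "1 - X * cnj Y \<noteq> 0" "X - 1 / cnj Y \<noteq> 0" "Y \<noteq> 0"
proof -
  show Y: "Y \<noteq> 0" using assms by auto
  have "norm (X * cnj Y) > 1" using assms by (simp add: norm_mult less_1_mult)
  then show 1: "1 - X * cnj Y \<noteq> 0" by auto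
  then show "X - 1 / cnj Y \<noteq> 0" using Y by (auto simp: field_simps)
qed

lemma norm_reflected:
  assumes "Y \<noteq> 0"
  shows "norm (1 - X * cnj Y) = norm (X - 1 / cnj Y) * norm Y"
proof -
  have "1 - X * cnj Y = - ((X - 1 / cnj Y) * cnj Y)" using assms by (simp add: field_simps)
  then show ?thesis by (simp only: norm_minus_cancel norm_mult complex_mod_cnj)
qed

text \<open>
  If \<open>|Y| \<le> 2\<close> then the image vortex is at least half as far from \<open>X\<close> as \<open>Y\<close>; otherwise it lies in the
  disc of radius \<open>1/2\<close> and \<open>X\<close> lies outside the unit disc.
\<close>
lemma reflected_dist:
  assumes "norm X > 1" "norm Y > 1" "X \<noteq> Y"
  defines "e \<equiv> norm (X - 1 / cnj Y)" and "d \<equiv> norm (X - Y)"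
  shows "1/2 \<le> e \<or> d / 2 \<le> e"
proof (cases "norm Y \<le> 2")
  case True
  have "d^2 \<le> (norm (1 - X * cnj Y))^2"
    unfolding norm_reflected_diff d_def using wall_pos[OF assms(1,2)] by simp
  then have "d \<le> norm (1 - X * cnj Y)" by (rule power2_le_imp_le) auto
  also have "\<dots> \<le> e * 2"
    unfolding e_def using assms reflected_nonzero[OF assms(1,2)] True
    by (subst norm_reflected) (auto intro: mult_left_mono)
  finally show ?thesis by auto
next
  case False
  have "norm X \<le> e + norm (1 / cnj Y)" unfolding e_def
    by (metis add.commute norm_triangle_sub)
  moreover have "norm (1 / cnj Y) \<le> 1/2" using False by (simp add: norm_divide divide_le_eq)
  ultimately show ?thesis using assms by linarith
qed

lemma inverse_reflected_le:
  assumes "norm X > 1" "norm Y > 1" "X \<noteq> Y"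
  shows "1 / norm (X - 1 / cnj Y) \<le> 2 + 2 / norm (X - Y)"
proof -
  define e d where "e = norm (X - 1 / cnj Y)" "d = norm (X - Y)"
  have pos: "e > 0" "d > 0" using assms reflected_nonzero[OF assms(1,2)] by (auto simp: e_d_def)
  have "1/2 \<le> e \<or> d / 2 \<le> e" using reflected_dist[OF assms] by (simp add: e_d_def)
  then have "1 / e \<le> 2 + 2 / d"
  proof
    assume "1/2 \<le> e"
    then have "1 / e \<le> 2" using pos by (simp add: field_simps)
    then show ?thesis using pos by (auto intro: add_increasing2)
  next
    assume "d/2 \<le> e"
    then have "1 / e \<le> 2 / d" using pos by (simp add: field_simps)
    then show ?thesis by simp
  qed
  then show ?thesis by (simp add: e_d_def)
qed

lemma sing_half_mult: "d \<ge> 0 \<Longrightarrow> sing (d / 2) \<le> 3 * sing d"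
proof -
  assume "d \<ge> 0"
  have "sqrt (1/2) \<ge> 2/3" by (rule real_le_rsqrt) (auto simp: power2_eq_square)
  then have "sing (1/2) \<le> 1 / (1/2 * (2/3))"
    unfolding sing_def by (intro divide_left_mono) auto
  then have "sing (1/2) \<le> 3" by simp
  then show ?thesis
    using sing_mult[of "1/2" d] sing_nonneg[OF \<open>d \<ge> 0\<close>] mult_right_mono[of "sing (1/2)" 3 "sing d"] by simp
qed

lemma sing_reflected_le:
  assumes "norm X > 1" "norm Y > 1" "X \<noteq> Y"
  shows "sing (norm (X - 1 / cnj Y)) \<le> 3 * (1 + sing (norm (X - Y)))"
proof -
  define e d where "e = norm (X - 1 / cnj Y)" "d = norm (X - Y)"
  have pos: "e > 0" "d > 0" using assms reflected_nonzero[OF assms(1,2)] by (auto simp: e_d_def)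
  have "1/2 \<le> e \<or> d / 2 \<le> e" using reflected_dist[OF assms] by (simp add: e_d_def)
  then have "sing e \<le> 3 * (1 + sing d)"
  proof
    assume "1/2 \<le> e"
    then have "sing e \<le> sing (1/2)" by (intro sing_antimono) auto
    also have "\<dots> \<le> 3" using sing_half_mult[of 1] by (simp add: sing_def)
    finally show ?thesis using sing_nonneg[of d] pos by simp
  next
    assume "d/2 \<le> e"
    then have "sing e \<le> sing (d/2)" using pos by (intro sing_antimono) auto
    also have "\<dots> \<le> 3 * sing d" using sing_half_mult[of d] pos by simp
    finally show ?thesis by simp
  qed
  then show ?thesis by (simp add: e_d_def)
qed

lemma green_log_taylor:
  assumes "norm X > 1" "norm (X + h) > 1" "norm Y > 1" "X \<noteq> Y" "X + h \<noteq> Y"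
  shows "\<bar>green_log (X + h) Y - green_log X Y - inner (green_grad X Y) h\<bar>
    \<le> 63 * (norm h * sqrt (norm h)) * ((1 + sing (norm (X - Y))) + (1 + sing (norm (X + h - Y))))"
proof -
  define A where "A = norm h * sqrt (norm h)"
  define z where "z = X - Y"
  define z' where "z' = X - 1 / cnj Y"
  have A0: "A \<ge> 0" by (simp add: A_def)
  have nz: "z \<noteq> 0" "z + h \<noteq> 0" "z' \<noteq> 0" "z' + h \<noteq> 0" "Y \<noteq> 0"
    using assms reflected_nonzero[of X Y] reflected_nonzero[of "X + h" Y]
    by (auto simp: z_def z'_def algebra_simps)
  have log: "ln (norm (1 - X * cnj Y)) = ln (norm z') + ln (norm Y)"
    "ln (norm (1 - (X + h) * cnj Y)) = ln (norm (z' + h)) + ln (norm Y)"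
    using nz norm_reflected[of Y X] norm_reflected[of Y "X + h"]
    by (auto simp: z'_def ln_mult algebra_simps)
  have inner: "inner (green_grad X Y) h = Re (h / z) - Re (h / z')"
  proof -
    have Re: "Re (1 / cnj u * cnj h) = Re (h / u)" for u
      by (metis complex_cnj_divide cnj.sel(1) mult.left_neutral times_divide_eq_left)
    show ?thesis
      unfolding inner_complex_Re green_grad_def z_def[symmetric] z'_def[symmetric] left_diff_distrib minus_complex.sel(1) Re ..
  qed
  have 1: "\<bar>ln (norm (z + h)) - ln (norm z) - Re (h / z)\<bar>
      \<le> 9 * A * (sing (norm z) + sing (norm (z + h)))"
    unfolding A_def by (rule ln_norm_taylor) (use nz in auto)
  have 2: "\<bar>ln (norm (z' + h)) - ln (norm z') - Re (h / z')\<bar>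
      \<le> 9 * A * (sing (norm z') + sing (norm (z' + h)))"
    unfolding A_def by (rule ln_norm_taylor) (use nz in auto)
  have 3: "sing (norm z') \<le> 3 * (1 + sing (norm z))"
    using sing_reflected_le[of X Y] assms by (simp add: z'_def z_def)
  have 4: "sing (norm (z' + h)) \<le> 3 * (1 + sing (norm (z + h)))"
    using sing_reflected_le[of "X + h" Y] assms by (simp add: z'_def z_def algebra_simps)
  have S: "sing (norm z) \<ge> 0" "sing (norm (z+h)) \<ge> 0" by (auto intro: sing_nonneg)
  have zh: "X + h - Y = z + h" by (simp add: z_def)
  have "\<bar>green_log (X + h) Y - green_log X Y - inner (green_grad X Y) h\<bar>
    \<le> 9 * A * (sing (norm z) + sing (norm (z + h))) + 9 * A * (sing (norm z') + sing (norm (z' + h)))"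
    using 1 2 unfolding inner green_log_def log zh z_def[symmetric] by linarith
  also have "\<dots> = 9 * A * (sing (norm z) + sing (norm (z + h)) + sing (norm z') + sing (norm (z' + h)))"
    by (simp add: algebra_simps)
  also have "\<dots> \<le> 9 * A * (7 * ((1 + sing (norm z)) + (1 + sing (norm (z + h)))))"
    using 3 4 A0 S by (intro mult_left_mono) auto
  finally show ?thesis unfolding zh A_def z_def[symmetric] by (simp add: algebra_simps)
qed

lemma green_grad_hoelder:
  assumes "norm X > 1" "norm (X + h) > 1" "norm Y > 1" "X \<noteq> Y" "X + h \<noteq> Y"
  shows "norm (green_grad (X + h) Y - green_grad X Y)
    \<le> 14 * sqrt (norm h) * ((1 + sing (norm (X - Y))) + (1 + sing (norm (X + h - Y))))"
proof -
  define A where "A = sqrt (norm h)"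
  define z where "z = X - Y"
  define z' where "z' = X - 1 / cnj Y"
  have A0: "A \<ge> 0" by (simp add: A_def)
  have nz: "z \<noteq> 0" "z + h \<noteq> 0" "z' \<noteq> 0" "z' + h \<noteq> 0" "Y \<noteq> 0"
    using assms reflected_nonzero[of X Y] reflected_nonzero[of "X + h" Y]
    by (auto simp: z_def z'_def algebra_simps)
  have 1: "norm (1 / (z + h) - 1 / z) \<le> 2 * A * (sing (norm z) + sing (norm (z + h)))"
    unfolding A_def by (rule inverse_hoelder) (use nz in auto)
  have 2: "norm (1 / (z' + h) - 1 / z') \<le> 2 * A * (sing (norm z') + sing (norm (z' + h)))"
    unfolding A_def by (rule inverse_hoelder) (use nz in auto)
  have 3: "sing (norm z') \<le> 3 * (1 + sing (norm z))"
    using sing_reflected_le[of X Y] assms by (simp add: z'_def z_def)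
  have 4: "sing (norm (z' + h)) \<le> 3 * (1 + sing (norm (z + h)))"
    using sing_reflected_le[of "X + h" Y] assms by (simp add: z'_def z_def algebra_simps)
  have S: "sing (norm z) \<ge> 0" "sing (norm (z+h)) \<ge> 0" by (auto intro: sing_nonneg)
  have zh: "X + h - Y = z + h" "X + h - 1 / cnj Y = z' + h" by (auto simp: z_def z'_def)
  have "green_grad (X + h) Y - green_grad X Y
      = cnj ((1 / (z + h) - 1 / z) - (1 / (z' + h) - 1 / z'))"
    unfolding green_grad_def zh z_def[symmetric] z'_def[symmetric] by simp
  then have "norm (green_grad (X + h) Y - green_grad X Y)
      = norm ((1 / (z + h) - 1 / z) - (1 / (z' + h) - 1 / z'))" by (simp only: complex_mod_cnj)
  also have "\<dots> \<le> 2 * A * (sing (norm z) + sing (norm (z + h))) + 2 * A * (sing (norm z') + sing (norm (z' + h)))"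
    using 1 2 norm_triangle_ineq4[of "1 / (z + h) - 1 / z" "1 / (z' + h) - 1 / z'"] by linarith
  also have "\<dots> = 2 * A * (sing (norm z) + sing (norm (z + h)) + sing (norm z') + sing (norm (z' + h)))"
    by (simp add: algebra_simps)
  also have "\<dots> \<le> 2 * A * (7 * ((1 + sing (norm z)) + (1 + sing (norm (z + h)))))"
    using 3 4 A0 S by (intro mult_left_mono) auto
  finally show ?thesis unfolding zh A_def z_def[symmetric] by (simp add: algebra_simps)
qed

lemma green_grad_bound:
  assumes "norm X > 1" "norm Y > 1" "X \<noteq> Y"
  shows "norm (green_grad X Y) \<le> 5 * (1 + sing (norm (X - Y)))"
proof -
  have "norm (green_grad X Y) \<le> 1 / norm (X - Y) + 1 / norm (X - 1 / cnj Y)"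
    unfolding green_grad_def
    by (rule order_trans[OF norm_triangle_ineq4])
       (simp add: norm_divide complex_cnj_diff[symmetric] del: complex_cnj_diff complex_cnj_divide)
  also have "\<dots> \<le> 2 + 3 * (1 / norm (X - Y))" using inverse_reflected_le[OF assms] by simp
  also have "\<dots> \<le> 5 * (1 + sing (norm (X - Y)))"
    using inverse_le_sing[of "norm (X - Y)"] sing_nonneg[of "norm (X - Y)"] assms by simp
  finally show ?thesis .
qed

lemma swirl_eq:
  assumes "norm X > 1" "norm Y > 1" "X \<noteq> Y"
  shows "inner (\<i> * green_grad X Y) X = swirl X Y"
proof -
  define d where "d = norm (X - Y)"
  define e where "e = norm (1 - X * cnj Y)"
  have e2: "e^2 = d^2 + wall X Y" unfolding e_def d_def by (rule norm_reflected_diff)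
  have pos: "d^2 > 0" "e^2 > 0" 
    using assms wall_pos[OF assms(1,2)] by (auto simp: d_def e2 intro: add_nonneg_pos)
  have nz: "X - Y \<noteq> 0" "1 - X * cnj Y \<noteq> 0" "Y \<noteq> 0" using assms reflected_nonzero[OF assms(1,2)] by auto
  have "green_grad X Y = (X - Y) / of_real (d^2) + Y * (1 - X * cnj Y) / of_real (e^2)"
  proof -
    have "1 / cnj (X - Y) = (X - Y) / of_real (d^2)"
    proof -
      have "of_real (d^2) = (X - Y) * cnj (X - Y)"
        unfolding d_def by (rule complex_norm_square)
      then show ?thesis using nz(1) by (metis nonzero_divide_mult_cancel_left)
    qed
    moreover have "1 / cnj (X - 1 / cnj Y) = - (Y * (1 - X * cnj Y) / of_real (e^2))"
    proof -
      have "cnj (X - 1 / cnj Y) = - (cnj (1 - X * cnj Y) / Y)" using nz by (simp add: field_simps)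
      moreover have "of_real (e^2) = (1 - X * cnj Y) * cnj (1 - X * cnj Y)"
        unfolding e_def by (rule complex_norm_square)
      moreover have "cnj (1 - X * cnj Y) \<noteq> 0" using nz(2) by (metis complex_cnj_zero_iff)
      ultimately show ?thesis using nz by (simp del: complex_cnj_diff)
    qed
    ultimately show ?thesis unfolding green_grad_def by simp
  qed
  then have "inner (\<i> * green_grad X Y) X
     = inner (\<i> * (X - Y)) X / d^2 + inner (\<i> * Y * (1 - X * cnj Y)) X / e^2"
    by (simp add: inner_complex_Re distrib_left distrib_right Re_divide_of_real mult.assoc
        del: of_real_power)
  also have "inner (\<i> * (X - Y)) X = Im (cnj X * Y)"
    by (simp add: inner_complex_def algebra_simps)
  also have "inner (\<i> * Y * (1 - X * cnj Y)) X = - Im (cnj X * Y)"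
    by (simp add: inner_complex_def algebra_simps)
  also have "Im (cnj X * Y) / d^2 + - Im (cnj X * Y) / e^2 = Im (cnj X * Y) * wall X Y / (d^2 * e^2)"
    using pos by (simp add: field_simps e2)
  finally show ?thesis unfolding swirl_def e2 d_def .
qed

lemma swirl_antisym: "swirl Y X = - swirl X Y"
proof -
  have "Im (cnj Y * X) = - Im (cnj X * Y)" by simp
  then show ?thesis
    unfolding swirl_def wall_commute[of Y X] norm_minus_commute[of Y X] by (simp only: mult_minus_left minus_divide_left)
qed

lemma Im_cnj_mult_le: "\<bar>Im (cnj X * Y)\<bar> \<le> norm X * norm (X - Y)"
proof -
  have "Im (cnj X * Y) = Im (cnj X * (Y - X))" by (simp add: algebra_simps)
  then have "\<bar>Im (cnj X * Y)\<bar> \<le> norm (cnj X * (Y - X))" by (metis abs_Im_le_cmod)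
  then show ?thesis by (simp add: norm_mult norm_minus_commute)
qed

lemma swirl_abs_le:
  assumes "norm X > 1" "norm Y > 1" "X \<noteq> Y"
  shows "\<bar>swirl X Y\<bar> \<le> norm X * (wall X Y / (norm (X - Y) * ((norm (X - Y))\<^sup>2 + wall X Y)))"
proof -
  define d w where "d = norm (X - Y)" "w = wall X Y"
  have pos: "d > 0" "w > 0" using assms wall_pos by (auto simp: d_w_def)
  have "w / (d^2 * (d^2 + w)) > 0" using pos by (intro divide_pos_pos mult_pos_pos add_pos_pos) auto
  moreover have "swirl X Y = Im (cnj X * Y) * (w / (d^2 * (d^2 + w)))" by (simp add: swirl_def d_w_def)
  ultimately have "\<bar>swirl X Y\<bar> = \<bar>Im (cnj X * Y)\<bar> * (w / (d^2 * (d^2 + w)))"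
    by (simp only: abs_mult abs_of_pos)
  also have "\<dots> \<le> (norm X * d) * (w / (d^2 * (d^2 + w)))"
    using Im_cnj_mult_le[of X Y] pos
    by (intro mult_right_mono) (auto simp: d_w_def intro!: divide_nonneg_nonneg mult_nonneg_nonneg add_nonneg_nonneg)
  also have "\<dots> = norm X * (w / (d * (d^2 + w)))"
    using pos by (simp add: power2_eq_square)
  finally show ?thesis by (simp add: d_w_def)
qed

lemma swirl_le:
  assumes "norm X > 1" "norm Y > 1" "X \<noteq> Y"
  shows "\<bar>swirl X Y\<bar> \<le> norm X / norm (X - Y)"
proof -
  define d w where "d = norm (X - Y)" "w = wall X Y"
  have pos: "d > 0" "w > 0" using assms wall_pos by (auto simp: d_w_def)
  have "0 < d^2 + w" using pos by (intro add_pos_pos) auto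
  then have "w / (d * (d^2 + w)) \<le> 1 / d" using pos by (simp add: divide_simps)
  then have "norm X * (w / (d * (d^2 + w))) \<le> norm X * (1 / d)" by (intro mult_left_mono) auto
  then show ?thesis using swirl_abs_le[OF assms] by (simp add: d_w_def)
qed

lemma swirl_le':
  assumes "norm X > 1" "norm Y > 1" "X \<noteq> Y"
  shows "\<bar>swirl X Y\<bar> \<le> norm Y / norm (X - Y)"
  using swirl_le[of Y X] assms swirl_antisym[of Y X] by (simp add: norm_minus_commute)

text \<open>
  The radial speed vanishes on the unit circle. Interpolation between \<open>|swirl| \<le> |X| / d\<close> and the factor
  \<open>wall X Y\<close> gives a decay of order \<open>1/4\<close> at the price of the singularity \<open>d^(-3/2)\<close>.
\<close>
lemma swirl_near_circle:
  assumes "norm X > 1" "norm Y > 1" "X \<noteq> Y" "norm X \<le> 2"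
  shows "\<bar>swirl X Y\<bar> \<le> 54 * sqrt (sqrt ((norm X)\<^sup>2 - 1)) * (1 + sing (norm (X - Y)))"
proof -
  define d w where "d = norm (X - Y)" "w = wall X Y"
  define b where "b = (norm X)\<^sup>2 - 1"
  define e where "e = sqrt (sqrt b)"
  have pos: "d > 0" "w > 0" using assms wall_pos by (auto simp: d_w_def)
  have b: "0 < b" "b \<le> 3" using assms power_mono[of "norm X" 2 2] by (auto simp: b_def)
  have e0: "e > 0" using b by (simp add: e_def)
  have e4: "e ^ 4 = b"
  proof -
    have "e ^ 4 = (e * e) * (e * e)" by (simp add: power4_eq_xxxx)
    then show ?thesis using b by (simp add: e_def)
  qed
  have e3: "e ^ 3 \<le> 3"
  proof (cases "e \<le> 1")
    case True
    then have "e ^ 3 \<le> 1" using e0 by (intro power_le_one) auto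
    then show ?thesis by simp
  next
    case False
    then have "e ^ 3 \<le> e ^ 4" by (intro power_increasing) auto
    then show ?thesis using e4 b by simp
  qed
  have sd: "sing d \<ge> 0" using pos by (intro sing_nonneg) auto
  have "norm Y \<le> d + 2"
    using norm_triangle_sub[of Y X] assms by (simp add: d_w_def norm_minus_commute)
  then have "(norm Y)^2 \<le> (d + 2)^2" by (intro power_mono) auto
  then have "(norm Y)^2 - 1 \<le> (d + 2)^2" by simp
  then have w: "w \<le> b * (d + 2)^2"
    unfolding d_w_def wall_def b_def using b by (intro mult_left_mono) (auto simp: b_def d_w_def)
  (* for d < 1 the elementary inequality v^4 / (1 + v^4) \<le> v is applied with v^4 = 9 b / d^2 *)
  have main: "w / (d * (d^2 + w)) \<le> 27 * e * (1 + sing d)"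
  proof (cases "d \<ge> 1")
    case True
    have "w \<le> b * (3 * d)^2" using True b by (intro order_trans[OF w] mult_left_mono power_mono) auto
    then have w9: "w \<le> 9 * b * d^2" by (simp add: power_mult_distrib)
    have "w / (d * (d^2 + w)) \<le> w / (d * d^2)"
      using pos by (intro divide_left_mono mult_left_mono mult_pos_pos add_pos_pos) auto
    also have "\<dots> \<le> (9 * b * d^2) / (d * d^2)" using w9 pos by (intro divide_right_mono) auto
    also have "\<dots> = 9 * b / d" using pos by simp
    also have "\<dots> \<le> 9 * b" using True b by (simp add: divide_le_eq mult_left_mono)
    also have "\<dots> = 9 * e * e ^ 3" by (simp add: e4[symmetric] power4_eq_xxxx power3_eq_cube)
    also have "\<dots> \<le> 9 * e * 3" using e3 e0 by (intro mult_left_mono) auto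
    also have "\<dots> \<le> 27 * e * (1 + sing d)" using e0 sd by (simp add: algebra_simps)
    finally show ?thesis .
  next
    case False
    have "w \<le> b * 3^2" using False b pos by (intro order_trans[OF w] mult_left_mono power_mono) auto
    then have w9: "w \<le> 9 * b" by simp
    define v where "v = sqrt 3 * e / sqrt d"
    have v0: "v > 0" using e0 pos by (simp add: v_def)
    have v4: "v ^ 4 = 9 * b / d^2"
    proof -
      have "sqrt x ^ 4 = x^2" if "x \<ge> 0" for x :: real
        using that by (metis power2_eq_square power4_eq_xxxx real_sqrt_pow2 mult.assoc)
      then show ?thesis using pos by (simp add: v_def power_divide power_mult_distrib e4)
    qed
    have "w / (d^2 + w) \<le> 9 * b / (d^2 + 9 * b)"
    proof -
      have "0 < d^2 + w" "0 < d^2 + 9 * b" using pos b by (auto intro: add_pos_pos)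
      moreover have "w * (d^2 + 9 * b) \<le> 9 * b * (d^2 + w)"
        using mult_right_mono[OF w9, of "d\<^sup>2"] by (simp add: algebra_simps)
      ultimately show ?thesis by (simp add: divide_le_eq le_divide_eq mult.commute)
    qed
    also have "\<dots> = v ^ 4 / (1 + v ^ 4)"
      unfolding v4 using pos b by (simp add: divide_simps)
    also have "\<dots> \<le> v"
    proof -
      have "v ^ 3 \<le> 1 + v ^ 4"
      proof (cases "v \<le> 1")
        case True
        then have "v^3 \<le> 1" using v0 by (intro power_le_one) auto
        moreover have "v ^ 4 \<ge> 0" by simp
        ultimately show ?thesis by linarith
      next
        case False
        then have "v ^ 3 \<le> v ^ 4" by (intro power_increasing) auto
        then show ?thesis by simp
      qed
      then have "v * v ^ 3 \<le> v * (1 + v ^ 4)" using v0 by (intro mult_left_mono) auto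
      then show ?thesis using v0 by (simp add: divide_le_eq add_pos_pos power4_eq_xxxx power3_eq_cube mult.assoc)
    qed
    also have "v \<le> 2 * e / sqrt d"
    proof -
      have "sqrt 3 \<le> (2::real)" by (rule real_le_lsqrt) auto
      then show ?thesis unfolding v_def using e0 pos by (intro divide_right_mono mult_right_mono) auto
    qed
    finally have "w / (d^2 + w) / d \<le> 2 * e / sqrt d / d" using pos by (intro divide_right_mono) auto
    then have "w / (d * (d^2 + w)) \<le> 2 * e * sing d" by (simp add: sing_def mult.commute)
    also have "\<dots> \<le> 27 * e * (1 + sing d)" using e0 sd by (intro mult_mono) auto
    finally show ?thesis .
  qed
  have "norm X * (w / (d * (d\<^sup>2 + w))) \<le> 2 * (27 * e * (1 + sing d))"
    using main assms pos e0 sd by (intro mult_mono) auto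
  then show ?thesis using swirl_abs_le[OF assms(1-3)] by (simp add: d_w_def e_def b_def)
qed

lemma green_log_commute: "green_log X Y = green_log Y X"
proof -
  have "norm (1 - X * cnj Y) = norm (cnj (1 - X * cnj Y))" by (simp only: complex_mod_cnj)
  also have "cnj (1 - X * cnj Y) = 1 - Y * cnj X" by simp
  finally show ?thesis by (simp add: green_log_def norm_minus_commute)
qed

lemma green_log_nonpos:
  assumes "norm X > 1" "norm Y > 1" "X \<noteq> Y"
  shows "green_log X Y \<le> 0"
proof -
  have "(norm (X - Y))^2 \<le> (norm (1 - X * cnj Y))^2"
    unfolding norm_reflected_diff using wall_pos[OF assms(1,2)] by simp
  then have "norm (X - Y) \<le> norm (1 - X * cnj Y)" by (rule power2_le_imp_le) auto
  then show ?thesis using assms by (auto simp: green_log_def intro: ln_mono)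
qed

text \<open>
  From \<open>|1 - X cnj Y|\<^sup>2 = d\<^sup>2 + wall X Y \<le> (|X| |Y| (1 + d))\<^sup>2\<close>.
\<close>
lemma green_log_lower:
  assumes "norm X > 1" "norm Y > 1" "X \<noteq> Y"
  shows "- green_log X Y \<le> ln (norm X) + ln (norm Y) + 1 / norm (X - Y)"
proof -
  define d r s where "d = norm (X - Y)" "r = norm X" "s = norm Y"
  have d: "d > 0" "r > 1" "s > 1" using assms by (auto simp: d_r_s_def)
  have r2: "r^2 > 1" "s^2 > 1" using d by auto
  have "(norm (1 - X * cnj Y))^2 \<le> (r * s * (d + 1))^2"
  proof -
    have "d^2 + (r^2 - 1) * (s^2 - 1) \<le> r^2 * s^2 * d^2 + r^2 * s^2"
    proof (intro add_mono)
      have "1 * 1 \<le> r^2 * s^2" using r2 by (intro mult_mono) auto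
      then show "d^2 \<le> r^2 * s^2 * d^2" using mult_right_mono[of 1 "r\<^sup>2 * s\<^sup>2" "d\<^sup>2"] by simp
      show "(r^2 - 1) * (s^2 - 1) \<le> r^2 * s^2" using r2 by (intro mult_mono) auto
    qed
    also have "\<dots> \<le> r^2 * s^2 * (d + 1)^2"
      using d by (simp add: power2_eq_square algebra_simps)
    finally show ?thesis unfolding norm_reflected_diff wall_def by (simp add: d_r_s_def power_mult_distrib)
  qed
  then have "norm (1 - X * cnj Y) \<le> r * s * (d + 1)"
    by (rule power2_le_imp_le) (use d in auto)
  also have "\<dots> = r * s * (1 + 1 / d) * d" using d by (simp add: field_simps)
  finally have "ln (norm (1 - X * cnj Y)) \<le> ln (r * s * (1 + 1 / d) * d)"
    using reflected_nonzero[OF assms(1,2)] by (intro ln_mono) auto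
  also have "\<dots> = ln r + ln s + ln (1 + 1 / d) + ln d"
  proof -
    have "1 + 1 / d > 0" using d by (intro add_pos_pos) auto
    then show ?thesis using d by (simp add: ln_mult)
  qed
  also have "ln (1 + 1 / d) \<le> 1 / d" using d by (intro ln_add_one_self_le_self) auto
  finally show ?thesis by (simp add: green_log_def d_r_s_def)
qed

text \<open>
  For \<open>|Y| \<le> |X|\<close> the distance \<open>d\<close> is at most \<open>2|X|\<close>, while \<open>|1 - X cnj Y|\<close> is comparable to
  \<open>|X| |Y|\<close> unless \<open>|Y| \<le> 3\<close>; in both cases \<open>|Y| d \<le> 3 |1 - X cnj Y|\<close>.
\<close>
lemma green_log_upper:
  assumes "norm X > 1" "norm Y > 1" "X \<noteq> Y"
  shows "min (ln (norm X)) (ln (norm Y)) \<le> ln 3 - green_log X Y"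
proof -
  have main: "ln (norm Y) \<le> ln 3 - green_log X Y" 
    if a: "norm X > 1" "norm Y > 1" "X \<noteq> Y" "norm Y \<le> norm X" for X Y
  proof -
    define d r s where "d = norm (X - Y)" "r = norm X" "s = norm Y"
    have d: "d > 0" "r > 1" "s > 1" "s \<le> r" using a by (auto simp: d_r_s_def)
    have r2: "r^2 > 1" "s^2 > 1" using d by auto
    have "(s * d)^2 \<le> (3 * norm (1 - X * cnj Y))^2"
    proof (cases "s^2 \<le> 9")
      case True
      have "s^2 * d^2 \<le> 9 * d^2" using True by (intro mult_right_mono) auto
      also have "\<dots> \<le> 9 * (d^2 + (r^2 - 1) * (s^2 - 1))" using r2 by auto
      finally show ?thesis unfolding power_mult_distrib norm_reflected_diff wall_def by (simp add: d_r_s_def)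
    next
      case False
      have "s^2 \<le> r^2" using d by (intro power_mono) auto
      then have big: "8/9 * r^2 \<le> r^2 - 1" "8/9 * s^2 \<le> s^2 - 1" using False by linarith+
      have "d \<le> r + s" unfolding d_r_s_def by (rule norm_triangle_ineq4)
      then have "d \<le> 2 * r" using d by simp
      then have "d^2 \<le> (2 * r)^2" using d by (intro power_mono) auto
      then have "s^2 * d^2 \<le> s^2 * (4 * r^2)" by (intro mult_left_mono) (auto simp: power_mult_distrib)
      also have "\<dots> \<le> 9 * ((8/9 * r^2) * (8/9 * s^2))" by simp
      also have "\<dots> \<le> 9 * ((r^2 - 1) * (s^2 - 1))" using big r2 by (intro mult_left_mono mult_mono) auto
      also have "\<dots> \<le> 9 * (d^2 + (r^2 - 1) * (s^2 - 1))" by simp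
      finally show ?thesis unfolding power_mult_distrib norm_reflected_diff wall_def by (simp add: d_r_s_def)
    qed
    then have "s * d \<le> 3 * norm (1 - X * cnj Y)" by (rule power2_le_imp_le) auto
    then have "ln (s * d) \<le> ln (3 * norm (1 - X * cnj Y))" using d by (intro ln_mono) auto
    then show ?thesis using d reflected_nonzero[OF a(1,2)]
      by (simp add: ln_mult green_log_def d_r_s_def)
  qed
  show ?thesis
  proof (cases "norm Y \<le> norm X")
    case True
    then show ?thesis using main[OF assms] by linarith
  next
    case False
    then show ?thesis using main[of Y X] assms green_log_commute[of X Y] by auto
  qed
qed

section \<open>Geometry of the exterior conformal map\<close>

lemma norm_cis_diff_le: "norm (cis a - cis b) \<le> \<bar>a - b\<bar>"
proof -
  have "cis a - cis b = cis b * (exp (\<i> * of_real (a - b)) - 1)"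
    by (simp add: cis_conv_exp algebra_simps exp_add[symmetric])
  then have "norm (cis a - cis b) = 2 * \<bar>sin ((a - b) / 2)\<bar>"
    by (simp only: norm_mult dist_exp_i_1) simp
  also have "\<dots> \<le> 2 * \<bar>(a - b) / 2\<bar>" by (intro mult_left_mono abs_sin_x_le_abs_x) auto
  finally show ?thesis by simp
qed

lemma affine_solve:
  fixes X s h :: complex
  assumes "\<beta> > 0" "X = of_real \<beta> * s + h"
  shows "s - X / of_real \<beta> = - h / of_real \<beta>"
  using assms by (simp add: add_divide_distrib)

locale exterior_domain =
  fixes \<Gamma> :: "complex set" and T :: "complex \<Rightarrow> complex"
  assumes closed_curve: "closed \<Gamma>"
    and conformal: "exterior_conformal_map \<Gamma> T"
begin

definition U :: "complex set" where "U = outside \<Gamma>"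
definition S :: "complex \<Rightarrow> complex" where "S = inv_into U T"
text \<open>
  The Jacobian determinant of \<open>T\<close>.
\<close>
definition lam :: "complex \<Rightarrow> real" where "lam x = (norm (deriv T x))\<^sup>2"

lemma open_U: "open U"
  unfolding U_def by (rule open_outside[OF closed_curve])

lemma T_holo: "T holomorphic_on U" and S_holo: "S holomorphic_on {z. norm z > 1}"
  and T_bij: "bij_betw T U {z. norm z > 1}"
  using conformal unfolding exterior_conformal_map_def U_def S_def by auto

lemma norm_T: "x \<in> U \<Longrightarrow> norm (T x) > 1"
  using T_bij by (auto simp: bij_betw_def)

lemma S_T: "x \<in> U \<Longrightarrow> S (T x) = x"
  unfolding S_def by (rule bij_betw_inv_into_left[OF T_bij])

lemma T_S: "norm X > 1 \<Longrightarrow> T (S X) = X"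
  unfolding S_def by (rule bij_betw_inv_into_right[OF T_bij]) auto

lemma S_mem: "norm X > 1 \<Longrightarrow> S X \<in> U"
  using bij_betw_inv_into[OF T_bij] unfolding S_def bij_betw_def by auto

lemma T_eq_iff: "x \<in> U \<Longrightarrow> y \<in> U \<Longrightarrow> T x = T y \<longleftrightarrow> x = y"
  by (metis S_T)

lemma open_D: "open {z::complex. norm z > 1}"
  by (intro open_Collect_less continuous_intros)

lemma T_deriv: "x \<in> U \<Longrightarrow> (T has_field_derivative deriv T x) (at x)"
  using T_holo open_U by (rule holomorphic_derivI)

lemma S_deriv: "norm X > 1 \<Longrightarrow> (S has_field_derivative deriv S X) (at X)"
  using S_holo open_D by (rule holomorphic_derivI) auto

lemma T_cont: "continuous_on U T"
  by (rule holomorphic_on_imp_continuous_on[OF T_holo])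

lemma S_cont: "continuous_on {z. norm z > 1} S"
  by (rule holomorphic_on_imp_continuous_on[OF S_holo])

lemma deriv_T_cont: "continuous_on U (deriv T)"
  by (intro holomorphic_on_imp_continuous_on holomorphic_deriv T_holo open_U)

lemma deriv_T_bounded: "\<exists>C\<ge>1. \<forall>x\<in>U. norm (deriv T x) \<le> C"
proof -
  have "bounded (deriv T ` U)" using conformal unfolding exterior_conformal_map_def U_def by auto
  then obtain C where "\<forall>x\<in>U. norm (deriv T x) \<le> C" by (auto simp: bounded_iff)
  then show ?thesis by (intro exI[of _ "max 1 C"]) (auto simp: max_def intro: order_trans)
qed

lemma deriv_S_T: "norm X > 1 \<Longrightarrow> deriv S X * deriv T (S X) = 1"
proof -
  assume X: "norm X > 1"
  have "((\<lambda>X. T (S X)) has_field_derivative deriv T (S X) * deriv S X) (at X)"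
    by (rule DERIV_chain2[OF T_deriv[OF S_mem[OF X]] S_deriv[OF X]])
  moreover have "((\<lambda>X. X) has_field_derivative 1) (at X)" by (rule DERIV_ident)
  then have "((\<lambda>X. T (S X)) has_field_derivative 1) (at X)"
    by (rule has_field_derivative_transform_within_open[OF _ open_D]) (use X T_S in auto)
  ultimately show ?thesis by (metis DERIV_unique mult.commute)
qed

text \<open>
  Near infinity \<open>|T x|\<close> is comparable to \<open>|x|\<close>, so that the decay of \<open>h'\<close> can be expressed in terms of
  \<open>|T x|\<close>, which stays away from \<open>0\<close> even if the origin belongs to the domain or to the curve.
\<close>
lemma expansion_at_infinity:
  "\<exists>\<beta> h B C. \<beta> > 0 \<and> B \<ge> 0 \<and> C \<ge> 0 \<and> (\<forall>x\<in>U. T x = of_real \<beta> * x + h x \<and> norm (h x) \<le> B \<and>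
      norm (deriv T x - of_real \<beta>) \<le> C / (norm (T x))\<^sup>2)"
proof -
  obtain \<beta> h C where \<beta>: "\<beta> > 0" and h: "h holomorphic_on U" "bounded (h ` U)"
    and T: "\<And>z. z \<in> U \<Longrightarrow> T z = of_real \<beta> * z + h z"
    and C: "\<And>z. z \<in> U \<Longrightarrow> norm z ^ 2 * norm (deriv h z) \<le> C"
    using conformal unfolding exterior_conformal_map_def U_def[symmetric] by blast
  obtain B where B: "\<And>z. z \<in> U \<Longrightarrow> norm (h z) \<le> B" using h(2) by (auto simp: bounded_iff)
  obtain C' where C': "C' \<ge> 1" "\<And>x. x \<in> U \<Longrightarrow> norm (deriv T x) \<le> C'"
    using deriv_T_bounded by auto
  define E where "E = (max C 0 + C' + \<beta>) * (\<beta> + max B 0)^2"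
  have E: "norm (deriv T x - of_real \<beta>) \<le> E / (norm (T x))\<^sup>2" if x: "x \<in> U" for x
  proof -
    have "((\<lambda>z. of_real \<beta> * z + h z) has_field_derivative of_real \<beta> + deriv h x) (at x)"
      using holomorphic_derivI[OF h(1) open_U x] by (auto intro!: derivative_eq_intros)
    then have "(T has_field_derivative of_real \<beta> + deriv h x) (at x)"
      by (rule has_field_derivative_transform_within_open[OF _ open_U]) (use x T in auto)
    then have dT: "deriv T x = of_real \<beta> + deriv h x" by (rule DERIV_imp_deriv)
    have T1: "norm (T x) > 1" by (rule norm_T[OF x])
    have nT: "norm (T x) \<le> \<beta> * norm x + max B 0"
      using norm_triangle_ineq[of "of_real \<beta> * x" "h x"] B[OF x] \<beta>
      by (simp add: T[OF x] norm_mult)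
    (* the decay of the derivative of h says nothing near the origin, where boundedness suffices *)
    have "norm (deriv h x) * (norm (T x))^2 \<le> E"
    proof (cases "norm x \<ge> 1")
      case True
      have "max B 0 * 1 \<le> max B 0 * norm x" using True by (intro mult_left_mono) auto
      then have "norm (T x) \<le> (\<beta> + max B 0) * norm x" using nT by (simp add: distrib_right)
      then have "(norm (T x))^2 \<le> ((\<beta> + max B 0) * norm x)^2" by (intro power_mono) auto
      then have "norm (deriv h x) * (norm (T x))^2 \<le> norm (deriv h x) * ((\<beta> + max B 0) * norm x)^2"
        by (intro mult_left_mono) auto
      also have "\<dots> = norm x ^ 2 * norm (deriv h x) * (\<beta> + max B 0)^2"
        by (simp add: power_mult_distrib)
      also have "\<dots> \<le> (max C 0 + C' + \<beta>) * (\<beta> + max B 0)^2"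
        using C[OF x] C' \<beta> by (intro mult_right_mono) auto
      finally show ?thesis by (simp add: E_def)
    next
      case False
      have "\<beta> * norm x \<le> \<beta>" using False \<beta> by simp
      then have "norm (T x) \<le> \<beta> + max B 0" using nT by simp
      then have *: "(norm (T x))^2 \<le> (\<beta> + max B 0)^2" by (intro power_mono) auto
      have "norm (deriv h x) \<le> C' + \<beta>"
        using norm_triangle_ineq4[of "deriv T x" "of_real \<beta>"] C'(2)[OF x] \<beta> by (simp add: dT)
      then show ?thesis unfolding E_def using * C' \<beta> by (intro mult_mono) auto
    qed
    then show ?thesis using T1 by (auto simp: dT le_divide_eq)
  qed
  have "E \<ge> 0" using C' \<beta> by (simp add: E_def)
  moreover have "T x = of_real \<beta> * x + h x \<and> norm (h x) \<le> max B 0 \<and>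
      norm (deriv T x - of_real \<beta>) \<le> E / (norm (T x))\<^sup>2" if "x \<in> U" for x
    using T[OF that] B[OF that] E[OF that] max.coboundedI1 by metis
  moreover have "max B 0 \<ge> 0" by simp
  ultimately show ?thesis using \<beta> by metis
qed

lemma lam_oscillation: 
  "\<exists>C\<ge>0. \<forall>x\<in>U. \<forall>y\<in>U. norm (T y) \<le> norm (T x) \<longrightarrow> \<bar>lam x - lam y\<bar> \<le> C / (norm (T y))\<^sup>2"
proof -
  obtain \<beta> h B C where \<beta>: "\<beta> > 0" "C \<ge> 0"
    and C: "\<And>x. x \<in> U \<Longrightarrow> norm (deriv T x - of_real \<beta>) \<le> C / (norm (T x))\<^sup>2"
    using expansion_at_infinity by metis
  obtain C' where C': "C' \<ge> 1" "\<And>x. x \<in> U \<Longrightarrow> norm (deriv T x) \<le> C'"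
    using deriv_T_bounded by auto
  have *: "\<bar>lam x - \<beta>^2\<bar> \<le> (C' + \<beta>) * C / (norm (T x))\<^sup>2" if x: "x \<in> U" for x
  proof -
    have "lam x - \<beta>^2 = (norm (deriv T x) + \<beta>) * (norm (deriv T x) - \<beta>)"
      by (simp add: lam_def power2_eq_square algebra_simps)
    then have "\<bar>lam x - \<beta>^2\<bar> = (norm (deriv T x) + \<beta>) * \<bar>norm (deriv T x) - \<beta>\<bar>"
      using \<beta> by (simp add: abs_mult)
    also have "\<dots> \<le> (C' + \<beta>) * (C / (norm (T x))\<^sup>2)"
    proof (intro mult_mono)
      have "\<bar>norm (deriv T x) - norm (of_real \<beta> :: complex)\<bar> \<le> norm (deriv T x - of_real \<beta>)"
        by (rule norm_triangle_ineq3)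
      then show "\<bar>norm (deriv T x) - \<beta>\<bar> \<le> C / (norm (T x))\<^sup>2" using C[OF x] \<beta> by simp
    qed (use C'(2)[OF x] C' \<beta> in auto)
    finally show ?thesis by simp
  qed
  define E where "E = (C' + \<beta>) * C"
  have E0: "E \<ge> 0" using C' \<beta> by (simp add: E_def)
  have "\<bar>lam x - lam y\<bar> \<le> (2 * E) / (norm (T y))\<^sup>2"
    if xy: "x \<in> U" "y \<in> U" "norm (T y) \<le> norm (T x)" for x y
  proof -
    have "(norm (T y))\<^sup>2 \<le> (norm (T x))\<^sup>2" using xy by (intro power_mono) auto
    moreover have "(norm (T y))\<^sup>2 > 0" using norm_T[OF xy(2)] by (intro zero_less_power) linarith
    ultimately have "E / (norm (T x))\<^sup>2 \<le> E / (norm (T y))\<^sup>2" using E0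
      by (intro divide_left_mono mult_pos_pos) auto
    then show ?thesis using *[OF xy(1)] *[OF xy(2)] unfolding E_def[symmetric] by (simp add: abs_if split: if_splits)
  qed
  then show ?thesis using E0 by (intro exI[of _ "2 * E"]) auto
qed

text \<open>
  The derivative of the inverse map is bounded, but the exterior of the disc is not convex. After
  subtracting the linear part, \<open>q(X) = S X - X/\<beta>\<close> is bounded with \<open>q' = O(1/|X|\<^sup>2)\<close>, and the inversion
  \<open>X \<mapsto> 1/X\<close> turns it into a function with bounded derivative on the punctured disc.
\<close>
lemma S_lipschitz: "\<exists>L\<ge>1. \<forall>x\<in>U. \<forall>y\<in>U. norm (x - y) \<le> L * norm (T x - T y)"
proof -
  obtain \<beta> h B C where \<beta>: "\<beta> > 0" "B \<ge> 0" "C \<ge> 0"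
    and Th: "\<And>x. x \<in> U \<Longrightarrow> T x = of_real \<beta> * x + h x" "\<And>x. x \<in> U \<Longrightarrow> norm (h x) \<le> B"
    and C: "\<And>x. x \<in> U \<Longrightarrow> norm (deriv T x - of_real \<beta>) \<le> C / (norm (T x))\<^sup>2"
    using expansion_at_infinity by metis
  obtain CS where CS: "CS \<ge> 0" "\<And>X. norm X > 1 \<Longrightarrow> norm (deriv S X) \<le> CS"
  proof -
    have "bounded (deriv S ` {z. norm z > 1})"
      using conformal unfolding exterior_conformal_map_def U_def S_def by auto
    then obtain c where "\<forall>X\<in>{z. norm z > 1}. norm (deriv S X) \<le> c" by (auto simp: bounded_iff)
    then show ?thesis by (intro that[of "max c 0"]) (auto intro: max.coboundedI1)
  qed
  define q where "q X = S X - X / of_real \<beta>" for X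
  have q_bound: "norm (q X) \<le> B / \<beta>" if X: "norm X > 1" for X
  proof -
    have "X = of_real \<beta> * S X + h (S X)" using Th(1)[OF S_mem[OF X]] T_S[OF X] by simp
    then have "q X = - h (S X) / of_real \<beta>"
      using \<beta>(1) unfolding q_def by (intro affine_solve)
    then have "norm (q X) = norm (h (S X)) / \<beta>" using \<beta> by (simp add: norm_divide)
    then show ?thesis using Th(2)[OF S_mem[OF X]] \<beta> by (simp add: divide_right_mono)
  qed
  define C2 where "C2 = C * CS / \<beta>"
  have C20: "C2 \<ge> 0" using \<beta> CS by (simp add: C2_def)
  have q_deriv: "(q has_field_derivative (deriv S X - 1 / of_real \<beta>)) (at X)" if "norm X > 1" for X
    unfolding q_def using S_deriv[OF that] \<beta>(1) by (auto intro!: derivative_eq_intros)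
  have q_deriv_bound: "norm (deriv S X - 1 / of_real \<beta>) \<le> C2 / (norm X)\<^sup>2" if X: "norm X > 1" for X
  proof -
    have "deriv S X - 1 / of_real \<beta> = (of_real \<beta> * deriv S X - deriv S X * deriv T (S X)) / of_real \<beta>"
      using \<beta> by (simp add: deriv_S_T[OF X] diff_divide_distrib)
    also have "of_real \<beta> * deriv S X - deriv S X * deriv T (S X) = - (deriv T (S X) - of_real \<beta>) * deriv S X"
      by (simp add: algebra_simps)
    finally have "norm (deriv S X - 1 / of_real \<beta>) = norm (deriv T (S X) - of_real \<beta>) * norm (deriv S X) / \<beta>"
      using \<beta> by (simp add: norm_divide norm_mult norm_minus_commute)
    also have "\<dots> \<le> (C / (norm X)\<^sup>2) * CS / \<beta>"
      using C[OF S_mem[OF X]] CS X \<beta> by (intro divide_right_mono mult_mono) (auto simp: T_S)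
    finally show ?thesis by (simp add: C2_def mult.commute)
  qed
  define Q where "Q z = q (1 / z)" for z
  have inv_norm: "norm (1 / z) > 1" if "z \<noteq> 0" "norm z < 1" for z :: complex
  proof -
    have "norm z > 0" using that by simp
    then have "1 < 1 / norm z" using that(2) by (simp only: less_divide_eq_1_pos)
    then show ?thesis by (simp add: norm_divide)
  qed
  define L where "L = 1 + 1 / \<beta> + C2 + 2 * B / \<beta>"
  have q_lip: "norm (q X - q Y) \<le> (C2 + 2 * B / \<beta>) * norm (X - Y)" if X: "norm X > 1" and Y: "norm Y > 1" for X Y
  proof (cases "0 \<in> closed_segment (1 / X) (1 / Y)")
    case False
    have nz: "X \<noteq> 0" "Y \<noteq> 0" using X Y by auto
    have seg: "z \<noteq> 0 \<and> norm z < 1" if "z \<in> closed_segment (1 / X) (1 / Y)" for z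
    proof -
      have "closed_segment (1 / X) (1 / Y) \<subseteq> ball 0 1"
        using X Y by (intro closed_segment_subset) (auto simp: norm_divide divide_less_eq)
      then have "z \<in> ball 0 1" using that by blast
      moreover have "z \<noteq> 0" using that False by metis
      ultimately show ?thesis by simp
    qed
    have "norm (Q (1 / X) - Q (1 / Y)) \<le> C2 * norm (1 / X - 1 / Y)"
    proof (rule field_differentiable_bound)
      fix z assume z: "z \<in> closed_segment (1 / X) (1 / Y)"
      note zz = conjunct1[OF seg[OF z]] conjunct2[OF seg[OF z]]
      have "((\<lambda>z. 1 / z) has_field_derivative (- 1 / z^2)) (at z)"
        using zz by (auto intro!: derivative_eq_intros simp: power2_eq_square)
      from DERIV_chain2[OF q_deriv[OF inv_norm[OF zz]] this]
      show "(Q has_field_derivative (deriv S (1 / z) - 1 / of_real \<beta>) * (- 1 / z^2)) (at z within closed_segment (1 / X) (1 / Y))"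
        unfolding Q_def by (rule DERIV_subset) auto
      have "norm ((deriv S (1 / z) - 1 / of_real \<beta>) * (- 1 / z^2)) \<le> C2 / (norm (1 / z))\<^sup>2 * (1 / (norm z)^2)"
        unfolding norm_mult using q_deriv_bound[OF inv_norm[OF zz]]
        using C20 by (intro mult_mono) (auto simp: norm_divide norm_power)
      also have "\<dots> = C2" using zz by (simp add: norm_divide power_divide)
      finally show "norm ((deriv S (1 / z) - 1 / of_real \<beta>) * (- 1 / z^2)) \<le> C2" .
    qed auto
    also have "\<dots> \<le> C2 * norm (X - Y)"
    proof -
      have "1 / X - 1 / Y = (Y - X) / (X * Y)" using nz by (simp add: field_simps)
      then have "norm (1 / X - 1 / Y) = norm (X - Y) / (norm X * norm Y)"
        by (simp add: norm_divide norm_mult norm_minus_commute)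
      moreover have "norm X * norm Y \<ge> 1" using X Y mult_mono[of 1 "norm X" 1 "norm Y"] by simp
      moreover have "norm (X - Y) / (norm X * norm Y) \<le> norm (X - Y) / 1"
        using calculation by (intro divide_left_mono) auto
      ultimately have "norm (1 / X - 1 / Y) \<le> norm (X - Y)" by simp
      then show ?thesis using C20 by (intro mult_left_mono) auto
    qed
    finally have "norm (q X - q Y) \<le> C2 * norm (X - Y)"
      unfolding Q_def by simp
    also have "\<dots> \<le> (C2 + 2 * B / \<beta>) * norm (X - Y)" using \<beta> by (intro mult_right_mono) auto
    finally show ?thesis .
  next
    case True
    (* now X and Y lie in opposite directions, so their distance is at least 1 and the bound of q
       itself suffices *)
    have nz: "X \<noteq> 0" "Y \<noteq> 0" using X Y by auto
    from True obtain u where u: "0 \<le> u" "u \<le> 1" "0 = (1 - u) *\<^sub>R (1 / X) + u *\<^sub>R (1 / Y)"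
      by (auto simp: in_segment)
    have "0 = X * Y * ((1 - u) *\<^sub>R (1 / X) + u *\<^sub>R (1 / Y))" unfolding u(3)[symmetric] by simp
    also have "\<dots> = (1 - u) *\<^sub>R Y + u *\<^sub>R X"
      using nz by (simp add: scaleR_conv_of_real distrib_left)
    finally have "0 \<in> closed_segment Y X" unfolding in_segment using u(1,2) by blast
    then have "dist Y X = norm Y + norm X"
      using between[of Y X 0] unfolding between_mem_segment by simp
    then have "1 \<le> norm (X - Y)" using X Y by (simp add: dist_norm norm_minus_commute)
    have "norm (q X - q Y) \<le> B / \<beta> + B / \<beta>"
      using q_bound[OF X] q_bound[OF Y] norm_triangle_ineq4[of "q X" "q Y"] by linarith
    also have "\<dots> = 2 * B / \<beta> * 1" by simp
    also have "\<dots> \<le> (C2 + 2 * B / \<beta>) * norm (X - Y)"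
      using \<open>1 \<le> norm (X - Y)\<close> \<beta> C20 by (intro mult_mono) auto
    finally show ?thesis .
  qed
  have "norm (x - y) \<le> L * norm (T x - T y)" if xy: "x \<in> U" "y \<in> U" for x y
  proof -
    have "x - y = (T x - T y) / of_real \<beta> + (q (T x) - q (T y))"
      using xy by (simp add: q_def S_T diff_divide_distrib)
    then have "norm (x - y) \<le> norm ((T x - T y) / of_real \<beta>) + norm (q (T x) - q (T y))"
      by (metis norm_triangle_ineq)
    also have "\<dots> \<le> norm (T x - T y) / \<beta> + (C2 + 2 * B / \<beta>) * norm (T x - T y)"
      using q_lip[OF norm_T[OF xy(1)] norm_T[OF xy(2)]] \<beta> by (simp add: norm_divide)
    also have "\<dots> \<le> L * norm (T x - T y)" by (simp add: L_def algebra_simps)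
    finally show ?thesis .
  qed
  moreover have "L \<ge> 1" using \<beta> C20 by (simp add: L_def)
  ultimately show ?thesis by blast
qed

lemma layer_sets: "{x\<in>U. norm (T x) \<le> a} \<in> sets borel"
proof -
  have "open {x\<in>U. a < norm (T x)}"
    using continuous_open_preimage[OF continuous_on_norm[OF T_cont] open_U, of "{a<..}"]
    by (auto simp: Int_def vimage_def)
  then have "U - {x\<in>U. a < norm (T x)} \<in> sets borel" using open_U by auto
  also have "U - {x\<in>U. a < norm (T x)} = {x\<in>U. norm (T x) \<le> a}" by auto
  finally show ?thesis .
qed

text \<open>
  The layer is covered by the images under the Lipschitz map \<open>S\<close> of about \<open>1/e\<close> discs of radius
  comparable to \<open>e\<close>, centred at equally spaced points of a circle.
\<close>
lemma area_boundary_layer: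
  "\<exists>C\<ge>0. \<forall>e. 0 < e \<and> e \<le> 1 \<longrightarrow> emeasure lborel {x\<in>U. norm (T x) \<le> 1 + e} \<le> ennreal (C * e)"
proof -
  obtain L where L: "L \<ge> 1" "\<And>x y. x \<in> U \<Longrightarrow> y \<in> U \<Longrightarrow> norm (x - y) \<le> L * norm (T x - T y)"
    using S_lipschitz by auto
  have "emeasure lborel {x\<in>U. norm (T x) \<le> 1 + e} \<le> ennreal (2 * pi * (17 * L)^2 * e)"
    if e: "0 < e" "e \<le> 1" for e
  proof -
    (* the centres lie on the outer circle of the layer, inside the domain of S *)
    define N where "N = nat \<lceil>1 / e\<rceil>"
    have "1 \<le> 1 / e" using e by simp
    then have N: "real N \<ge> 1 / e" "real N \<le> 1 / e + 1" "N > 0"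
      unfolding N_def by linarith+
    define p where "p k = of_real (1 + e) * cis (2 * pi * real k / real N)" for k
    have np: "norm (p k) > 1" for k unfolding p_def norm_mult norm_of_real norm_cis using e by simp
    define A where "A k = cball (S (p k)) (17 * L * e)" for k
    have "{x\<in>U. norm (T x) \<le> 1 + e} \<subseteq> (\<Union>k<N. A k)"
    proof
      fix x assume "x \<in> {x\<in>U. norm (T x) \<le> 1 + e}"
      then have x: "x \<in> U" "norm (T x) \<le> 1 + e" by auto
      define t r where "t = Arg2pi (T x)" "r = norm (T x)"
      have Tx: "T x = of_real r * cis t" unfolding t_r_def by (simp add: Arg2pi_eq cis_conv_exp)
      have t: "0 \<le> t" "t < 2 * pi" using Arg2pi[of "T x"] by (auto simp: t_r_def)
      have r: "1 < r" "r \<le> 1 + e" using x norm_T[OF x(1)] by (auto simp: t_r_def)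
      define k where "k = nat \<lfloor>real N * t / (2 * pi)\<rfloor>"
      have v0: "0 \<le> real N * t / (2 * pi)" using t by simp
      have vN: "real N * t / (2 * pi) < real N" using t N by (simp add: divide_less_eq)
      have k: "real k \<le> real N * t / (2 * pi)" "real N * t / (2 * pi) < real k + 1"
        using v0 unfolding k_def by linarith+
      have kN: "k < N" using k vN by linarith
      have "\<bar>t - 2 * pi * real k / real N\<bar> \<le> 2 * pi / real N"
      proof -
        have "t - 2 * pi * real k / real N = (real N * t / (2 * pi) - real k) * (2 * pi / real N)"
          using N by (simp add: field_simps)
        moreover have "\<bar>real N * t / (2 * pi) - real k\<bar> \<le> 1" using k by simp
        moreover have "0 \<le> 2 * pi / real N" by simp
        ultimately show ?thesis using mult_right_mono[of "\<bar>real N * t / (2 * pi) - real k\<bar>" 1 "2 * pi / real N"]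
          by (simp only: abs_mult abs_of_nonneg mult_1)
      qed
      also have "2 * pi / real N \<le> 2 * pi * e"
      proof -
        have "1 / real N \<le> e" using N e by (simp add: divide_le_eq mult.commute)
        then have "2 * pi * (1 / real N) \<le> 2 * pi * e" by (intro mult_left_mono) auto
        then show ?thesis by simp
      qed
      finally have t1: "norm (cis t - cis (2 * pi * real k / real N)) \<le> 2 * pi * e"
        using norm_cis_diff_le order_trans by blast
      have "T x - p k = of_real (r - (1 + e)) * cis t + of_real (1 + e) * (cis t - cis (2 * pi * real k / real N))"
        by (simp add: Tx p_def algebra_simps)
      then have "norm (T x - p k) \<le> \<bar>r - (1 + e)\<bar> + (1 + e) * norm (cis t - cis (2 * pi * real k / real N))"
        using norm_triangle_ineq[of "of_real (r - (1 + e)) * cis t" "of_real (1 + e) * (cis t - cis (2 * pi * real k / real N))"] e(1)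
        unfolding norm_mult norm_of_real norm_cis by (simp only: abs_of_pos add_pos_pos zero_less_one mult_1_right)
      also have "\<dots> \<le> e + 2 * (2 * pi * e)" using r e t1 by (intro add_mono mult_mono) auto
      also have "\<dots> \<le> 17 * e" using mult_right_mono[of pi 4 e] pi_less_4 e by (simp add: algebra_simps)
      finally have "L * norm (T x - p k) \<le> L * (17 * e)" using L by (intro mult_left_mono) auto
      moreover have "norm (x - S (p k)) \<le> L * norm (T x - p k)"
        using L(2)[OF x(1) S_mem[OF np[of k]]] by (simp add: T_S[OF np])
      ultimately have "x \<in> A k" by (simp add: A_def dist_norm norm_minus_commute)
      then show "x \<in> (\<Union>k<N. A k)" using kN by auto
    qed
    then have "emeasure lborel {x\<in>U. norm (T x) \<le> 1 + e} \<le> emeasure lborel (\<Union>k<N. A k)"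
      by (intro emeasure_mono) (auto simp: A_def)
    also have "\<dots> \<le> (\<Sum>k<N. emeasure lborel (A k))"
      by (intro emeasure_subadditive_finite) (auto simp: A_def)
    also have "\<dots> = (\<Sum>k<N. ennreal (pi * (17 * L * e)^2))"
      using L e by (intro sum.cong refl) (simp add: A_def emeasure_cball unit_ball_vol_2)
    also have "\<dots> = ennreal (real N * (pi * (17 * L * e)^2))"
      by (subst sum_ennreal) auto
    also have "\<dots> \<le> ennreal (2 * pi * (17 * L)^2 * e)"
    proof (intro ennreal_leI)
      have "real N * e \<le> 2" using N(2) e mult_right_mono[OF N(2), of e] by (simp add: distrib_right)
      then have "real N * e * (pi * (17 * L)^2 * e) \<le> 2 * (pi * (17 * L)^2 * e)"
        using e by (intro mult_right_mono) auto
      then show "real N * (pi * (17 * L * e)^2) \<le> 2 * pi * (17 * L)^2 * e"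
        by (simp add: power2_eq_square algebra_simps)
    qed
    finally show ?thesis .
  qed
  then show ?thesis by (intro exI[of _ "2 * pi * (17 * L)^2"]) auto
qed

lemma compact_annulus:
  assumes "a > 1"
  shows "compact {x\<in>U. a \<le> norm (T x) \<and> norm (T x) \<le> b}"
proof -
  have "compact {X::complex. a \<le> norm X \<and> norm X \<le> b}"
  proof -
    have "{X::complex. a \<le> norm X \<and> norm X \<le> b} = {X. a \<le> norm X} \<inter> cball 0 b" by auto
    moreover have "closed {X::complex. a \<le> norm X}" by (intro closed_Collect_le continuous_intros)
    ultimately show ?thesis by (simp add: closed_Int_compact)
  qed
  moreover have "continuous_on {X. a \<le> norm X \<and> norm X \<le> b} S"
    by (rule continuous_on_subset[OF S_cont]) (use assms in auto)
  ultimately have "compact (S ` {X. a \<le> norm X \<and> norm X \<le> b})" by (rule compact_continuous_image[rotated])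
  also have "S ` {X. a \<le> norm X \<and> norm X \<le> b} = {x\<in>U. a \<le> norm (T x) \<and> norm (T x) \<le> b}"
  proof (intro equalityI subsetI)
    fix x assume "x \<in> {x\<in>U. a \<le> norm (T x) \<and> norm (T x) \<le> b}"
    then show "x \<in> S ` {X. a \<le> norm X \<and> norm X \<le> b}"
      by (intro image_eqI[of _ _ "T x"]) (auto simp: S_T)
  qed (use assms in \<open>auto simp: S_mem T_S\<close>)
  finally show ?thesis .
qed

end

section \<open>The gradient of the stream function\<close>

lemma norm_integral_le_integral:
  fixes f :: "'a \<Rightarrow> 'b::{banach, second_countable_topology}"
  assumes "integrable M f" "integrable M g" "AE x in M. norm (f x) \<le> g x"
  shows "norm (integral\<^sup>L M f) \<le> integral\<^sup>L M g"
  by (rule order_trans[OF Bochner_Integration.integral_norm_bound integral_mono_AE]) (use assms in auto)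

lemma integrable_transform:
  fixes f g :: "'a \<Rightarrow> 'b::{banach, second_countable_topology}"
  assumes "integrable M f" "\<And>x. x \<in> space M \<Longrightarrow> f x = g x"
  shows "integrable M g"
  using assms Bochner_Integration.integrable_cong[of M M f g] by blast

lemma perp_eq: "perp z = \<i> * z"
  by (simp add: perp_def complex_eq_iff)

lemma grad_eq: "GDERIV f x :> D \<Longrightarrow> grad f x = D"
proof -
  assume "GDERIV f x :> D"
  then have "frechet_derivative f (at x) = (\<lambda>h. inner h D)"
    unfolding gderiv_def by (rule frechet_derivative_at[symmetric])
  then show ?thesis by (simp add: grad_def complex_eq_iff inner_complex_def)
qed

lemma GDERIV_transform:
  assumes "GDERIV f x :> D" "open A" "x \<in> A" "\<And>y. y \<in> A \<Longrightarrow> f y = g y"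
  shows "GDERIV g x :> D"
  using assms unfolding gderiv_def by (metis has_derivative_transform_within_open)

context exterior_domain
begin

definition mu :: "complex measure" where "mu = restrict_space lborel U"

lemma U_sets: "U \<in> sets borel"
  using open_U by auto

lemma space_mu [simp]: "space mu = U"
  by (simp add: mu_def space_restrict_space)

lemma integral_mu: "(LINT x:U|lborel. f x) = integral\<^sup>L mu (f :: complex \<Rightarrow> real)"
  unfolding mu_def set_lebesgue_integral_def using U_sets by (subst integral_restrict_space) auto

lemma sigma_finite_mu: "sigma_finite_measure mu"
  unfolding mu_def
  by (rule sigma_finite_measure_restrict_space[OF sigma_finite_lborel]) (use U_sets in auto)

sublocale mu: sigma_finite_measure mu by (rule sigma_finite_mu)
sublocale mu2: pair_sigma_finite mu mu ..

lemma measurable_mu_continuous: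
  "continuous_on U (f :: complex \<Rightarrow> 'b::topological_space) \<Longrightarrow> f \<in> borel_measurable mu"
proof -
  assume "continuous_on U f"
  then have "f \<in> borel_measurable (restrict_space borel U)" by (rule borel_measurable_continuous_on_restrict)
  moreover have "sets mu = sets (restrict_space borel U)" by (simp add: mu_def sets_restrict_space)
  ultimately show ?thesis using measurable_cong_sets[of mu "restrict_space borel U" borel borel] by simp
qed

lemma T_measurable [measurable]: "T \<in> borel_measurable mu"
  by (rule measurable_mu_continuous[OF T_cont])

lemma cnj_measurable [measurable]: "cnj \<in> borel_measurable borel"
  by (intro borel_measurable_continuous_onI continuous_intros)

lemma AE_mu_neq: "AE y in mu. y \<noteq> x"
proof -
  have "AE y in lborel. y \<noteq> x" by (rule AE_lborel_singleton)
  then show ?thesis unfolding mu_def using U_sets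
    by (subst AE_restrict_space_iff) (auto elim: eventually_mono)
qed

lemma AE_mu_in: "AE y in mu. y \<in> U"
  by (rule AE_I2) simp

text \<open>
  All integral operators below are dominated by this kernel; it is bounded below by \<open>1\<close>, so that it also
  dominates the nonsingular parts.
\<close>
definition near :: "complex \<Rightarrow> complex \<Rightarrow> real" where
  "near x y = 1 + sing (norm (T x - T y))"

lemma near_ge_1: "near x y \<ge> 1"
  by (simp add: near_def sing_nonneg)

lemma near_measurable [measurable]: "near x \<in> borel_measurable mu"
  unfolding near_def by measurable

definition admissible :: "real \<Rightarrow> real \<Rightarrow> (complex \<Rightarrow> real) \<Rightarrow> bool" where
  "admissible M m w \<longleftrightarrow> M \<ge> 0 \<and> (\<forall>y\<in>U. \<bar>w y\<bar> \<le> M) \<and> integrable mu w \<and> (\<integral>y. \<bar>w y\<bar> \<partial>mu) \<le> m"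

lemma admissible_m_nonneg: "admissible M m w \<Longrightarrow> m \<ge> 0"
  unfolding admissible_def by (meson Bochner_Integration.integral_nonneg abs_ge_zero order_trans)

text \<open>
  Since \<open>S\<close> is Lipschitz, \<open>sing |T x - T y|\<close> is bounded by a multiple of \<open>sing |x - y|\<close>. The bound of \<open>w\<close>
  is used on the unit disc around \<open>x\<close>, its integral outside.
\<close>
lemma near_integral:
  "\<exists>C\<ge>1. \<forall>M m w x. admissible M m w \<longrightarrow> x \<in> U \<longrightarrow>
     integrable mu (\<lambda>y. near x y * \<bar>w y\<bar>) \<and> (\<integral>y. near x y * \<bar>w y\<bar> \<partial>mu) \<le> C * (M + m)"
proof -
  obtain L where L: "L \<ge> 1" "\<And>x y. x \<in> U \<Longrightarrow> y \<in> U \<Longrightarrow> norm (x - y) \<le> L * norm (T x - T y)"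
    using S_lipschitz by auto
  define c where "c = sing (1 / L)"
  have c0: "c \<ge> 0" using L by (simp add: c_def sing_nonneg)
  have near_le: "near x y \<le> 1 + c * sing (norm (x - y))" if "x \<in> U" "y \<in> U" for x y
  proof (cases "x = y")
    case False
    have "sing (norm (T x - T y)) \<le> sing (1 / L * norm (x - y))"
      using L(2)[OF that] L(1) False by (intro sing_antimono) (auto simp: field_simps)
    also have "\<dots> = c * sing (norm (x - y))" unfolding c_def by (rule sing_mult)
    finally show ?thesis by (simp add: near_def)
  qed (use c0 in \<open>auto simp: near_def sing_def\<close>)
  define C where "C = 1 + c + c * (16 * pi)"
  have "integrable mu (\<lambda>y. near x y * \<bar>w y\<bar>) \<and> (\<integral>y. near x y * \<bar>w y\<bar> \<partial>mu) \<le> C * (M + m)"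
    if w: "admissible M m w" and x: "x \<in> U" for M m w x
  proof -
    have [measurable]: "w \<in> borel_measurable mu" using w by (auto simp: admissible_def)
    have int: "integrable mu (\<lambda>y. \<bar>w y\<bar>)" using w by (auto simp: admissible_def)
    have M: "M \<ge> 0" and m: "m \<ge> 0" using w admissible_m_nonneg[OF w] by (auto simp: admissible_def)
    define g where "g y = ennreal (indicator (cball x 1) y * sing (norm (x - y)))" for y
    have "(\<lambda>y. sing (norm (x - y))) \<in> borel_measurable borel"
      by (intro measurable_compose[OF _ sing_measurable] borel_measurable_continuous_onI continuous_intros)
    moreover have "(indicator (cball x 1) :: complex \<Rightarrow> real) \<in> borel_measurable borel"
      by (intro borel_measurable_indicator) auto
    ultimately have gm: "g \<in> borel_measurable lborel"
      unfolding g_def by simp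
    have [measurable]: "g \<in> borel_measurable mu" unfolding mu_def 
      by (rule measurable_restrict_space1[OF gm])
    have pw: "ennreal (near x y * \<bar>w y\<bar>) \<le> ennreal (1 + c) * ennreal \<bar>w y\<bar> + ennreal (c * M) * g y"
      if y: "y \<in> U" for y
    proof -
      define s where "s = sing (norm (x - y))"
      have s0: "s \<ge> 0" by (simp add: s_def sing_nonneg)
      have wM: "\<bar>w y\<bar> \<le> M" using w y by (auto simp: admissible_def)
      have "near x y * \<bar>w y\<bar> \<le> (1 + c * s) * \<bar>w y\<bar>"
        using near_le[OF x y] by (intro mult_right_mono) (auto simp: s_def)
      also have "\<dots> \<le> (1 + c) * \<bar>w y\<bar> + c * M * (indicator (cball x 1) y * s)"
      proof (cases "y \<in> cball x 1")
        case True
        have "c * s * \<bar>w y\<bar> \<le> c * s * M" using wM c0 s0 by (intro mult_left_mono) auto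
        moreover have "0 \<le> c * \<bar>w y\<bar>" using c0 by simp
        ultimately show ?thesis using True by (simp add: algebra_simps)
      next
        case False
        then have "norm (x - y) > 1" by (simp add: dist_norm)
        then have "s \<le> sing 1" unfolding s_def by (intro sing_antimono) auto
        then have "s \<le> 1" by (simp add: sing_def)
        then have "(1 + c * s) * \<bar>w y\<bar> \<le> (1 + c) * \<bar>w y\<bar>" using c0 mult_left_mono[of s 1 c]
          by (intro mult_right_mono) auto
        then show ?thesis using False by simp
      qed
      finally have "ennreal (near x y * \<bar>w y\<bar>) \<le> ennreal ((1 + c) * \<bar>w y\<bar> + c * M * (indicator (cball x 1) y * s))"
        by (rule ennreal_leI)
      also have "\<dots> = ennreal (1 + c) * ennreal \<bar>w y\<bar> + ennreal (c * M) * g y"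
        using c0 M s0 by (simp add: g_def s_def ennreal_plus ennreal_mult)
      finally show ?thesis .
    qed
    have "(\<integral>\<^sup>+y. ennreal (near x y * \<bar>w y\<bar>) \<partial>mu)
        \<le> (\<integral>\<^sup>+y. ennreal (1 + c) * ennreal \<bar>w y\<bar> + ennreal (c * M) * g y \<partial>mu)"
      by (intro nn_integral_mono) (use pw in auto)
    also have "\<dots> = ennreal (1 + c) * (\<integral>\<^sup>+y. ennreal \<bar>w y\<bar> \<partial>mu) + ennreal (c * M) * (\<integral>\<^sup>+y. g y \<partial>mu)"
      by (simp add: nn_integral_add nn_integral_cmult)
    also have "(\<integral>\<^sup>+y. ennreal \<bar>w y\<bar> \<partial>mu) = ennreal (\<integral>y. \<bar>w y\<bar> \<partial>mu)"
      by (rule nn_integral_eq_integral[OF int]) auto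
    also have "(\<integral>\<^sup>+y. g y \<partial>mu) \<le> ennreal (16 * pi)"
    proof -
      have "(\<integral>\<^sup>+y. g y \<partial>mu) = (\<integral>\<^sup>+y. g y * indicator U y \<partial>lborel)"
        unfolding mu_def using U_sets by (subst nn_integral_restrict_space) auto
      also have "\<dots> \<le> (\<integral>\<^sup>+y. indicator (cball x 1) y * ennreal (sing (norm (x - y))) \<partial>lborel)"
        by (intro nn_integral_mono) (auto simp: g_def indicator_def)
      also have "\<dots> \<le> ennreal (16 * pi)" by (rule nn_integral_sing_cball)
      finally show ?thesis .
    qed
    also have "ennreal (1 + c) * ennreal (\<integral>y. \<bar>w y\<bar> \<partial>mu) + ennreal (c * M) * ennreal (16 * pi)
      = ennreal ((1 + c) * (\<integral>y. \<bar>w y\<bar> \<partial>mu) + c * M * (16 * pi))"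
      using c0 M by (subst ennreal_plus) (auto simp: ennreal_mult)
    also have "\<dots> \<le> ennreal (C * (M + m))"
    proof (intro ennreal_leI)
      have "(1 + c) * (\<integral>y. \<bar>w y\<bar> \<partial>mu) \<le> (1 + c) * m"
        using w c0 by (intro mult_left_mono) (auto simp: admissible_def)
      moreover have "C * (M + m) = (1 + c) * m + c * M * (16 * pi) + ((1 + c) * M + c * (16 * pi) * m)"
        by (simp add: C_def algebra_simps)
      moreover have "(1 + c) * M + c * (16 * pi) * m \<ge> 0" using c0 M m by simp
      ultimately show "(1 + c) * (\<integral>y. \<bar>w y\<bar> \<partial>mu) + c * M * (16 * pi) \<le> C * (M + m)" by linarith
    qed
    finally have fin: "(\<integral>\<^sup>+y. ennreal (near x y * \<bar>w y\<bar>) \<partial>mu) \<le> ennreal (C * (M + m))"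
      by (simp add: add_left_mono mult_left_mono)
    have nn: "near x y * \<bar>w y\<bar> \<ge> 0" for y using near_ge_1[of x y] by simp
    have "integrable mu (\<lambda>y. near x y * \<bar>w y\<bar>)"
      by (rule integrableI_nonneg) (use nn fin in \<open>auto simp: less_top[symmetric] top_unique\<close>)
    moreover have "(\<integral>y. near x y * \<bar>w y\<bar> \<partial>mu) \<le> C * (M + m)"
    proof (rule integral_real_bounded)
      show "0 \<le> C * (M + m)" using c0 M m by (simp add: C_def)
    qed (rule fin)
    ultimately show ?thesis by simp
  qed
  moreover have "C \<ge> 1" using c0 by (simp add: C_def)
  ultimately show ?thesis by blast
qed

text \<open>
  Chosen once, so that all later bounds share the same constant.
\<close>
definition near_const :: real where
  "near_const = (SOME C. C \<ge> 1 \<and> (\<forall>M m w x. admissible M m w \<longrightarrow> x \<in> U \<longrightarrow>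
     integrable mu (\<lambda>y. near x y * \<bar>w y\<bar>) \<and> (\<integral>y. near x y * \<bar>w y\<bar> \<partial>mu) \<le> C * (M + m)))"

lemma near_const: "near_const \<ge> 1"
    "admissible M m w \<Longrightarrow> x \<in> U \<Longrightarrow> integrable mu (\<lambda>y. near x y * \<bar>w y\<bar>)"
    "admissible M m w \<Longrightarrow> x \<in> U \<Longrightarrow> (\<integral>y. near x y * \<bar>w y\<bar> \<partial>mu) \<le> near_const * (M + m)"
  using someI_ex[OF near_integral] unfolding near_const_def[symmetric] by blast+

lemma integrable_near_dominated:
  fixes f :: "complex \<Rightarrow> 'b::{banach,second_countable_topology}"
  assumes "admissible M m w" "x \<in> U" "f \<in> borel_measurable mu"
    and "\<And>y. y \<in> U \<Longrightarrow> y \<noteq> x \<Longrightarrow> norm (f y) \<le> c * (near x y * \<bar>w y\<bar>)"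
  shows "integrable mu f" "c \<ge> 0 \<Longrightarrow> norm (integral\<^sup>L mu f) \<le> c * (near_const * (M + m))"
proof -
  have AE: "AE y in mu. norm (f y) \<le> c * (near x y * \<bar>w y\<bar>)"
    using AE_mu_neq[of x] AE_mu_in by eventually_elim (use assms in auto)
  have int: "integrable mu (\<lambda>y. c * (near x y * \<bar>w y\<bar>))"
    using near_const(2)[OF assms(1,2)] by (rule integrable_mult_right)
  show f: "integrable mu f"
    by (rule Bochner_Integration.integrable_bound[OF int assms(3)]) (use AE in \<open>auto elim!: eventually_mono\<close>)
  assume c: "c \<ge> 0"
  have "norm (integral\<^sup>L mu f) \<le> (\<integral>y. c * (near x y * \<bar>w y\<bar>) \<partial>mu)"
    by (rule norm_integral_le_integral[OF f int AE])
  also have "\<dots> \<le> c * (near_const * (M + m))"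
    using near_const(3)[OF assms(1,2)] c by (simp add: mult_left_mono)
  finally show "norm (integral\<^sup>L mu f) \<le> c * (near_const * (M + m))" .
qed

text \<open>
  The candidate for the gradient of the stream function, obtained by differentiating the Green's function
  under the integral and applying the chain rule for \<open>T\<close>.
\<close>
definition stream_grad :: "(complex \<Rightarrow> real) \<Rightarrow> complex \<Rightarrow> complex" where
  "stream_grad w x = cnj (deriv T x) / (2 * pi) * (\<integral>y. w y *\<^sub>R green_grad (T x) (T y) \<partial>mu)"

lemma green_grad_measurable [measurable]:
  "(\<lambda>y. green_grad X (T y)) \<in> borel_measurable mu"
  unfolding green_grad_def by measurable

lemma green_log_measurable [measurable]:
  "(\<lambda>y. green_log X (T y)) \<in> borel_measurable mu"
  unfolding green_log_def by measurable

lemma green_grad_integrable: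
  assumes w: "admissible M m w" and x: "x \<in> U"
  shows "integrable mu (\<lambda>y. w y *\<^sub>R green_grad (T x) (T y))"
    and "norm (\<integral>y. w y *\<^sub>R green_grad (T x) (T y) \<partial>mu) \<le> 5 * (near_const * (M + m))"
proof -
  have [measurable]: "w \<in> borel_measurable mu" using w by (auto simp: admissible_def)
  have b: "norm (w y *\<^sub>R green_grad (T x) (T y)) \<le> 5 * (near x y * \<bar>w y\<bar>)" if "y \<in> U" "y \<noteq> x" for y
  proof -
    have "norm (green_grad (T x) (T y)) \<le> 5 * near x y"
      unfolding near_def using that x T_eq_iff by (intro green_grad_bound norm_T) auto
    then show ?thesis using mult_left_mono[of _ _ "\<bar>w y\<bar>"] by (fastforce simp: mult_ac)
  qed
  show "integrable mu (\<lambda>y. w y *\<^sub>R green_grad (T x) (T y))"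
    by (rule integrable_near_dominated(1)[OF w x _ b]) auto
  show "norm (\<integral>y. w y *\<^sub>R green_grad (T x) (T y) \<partial>mu) \<le> 5 * (near_const * (M + m))"
    by (rule integrable_near_dominated(2)[OF w x _ b]) auto
qed

lemma green_log_integrable:
  assumes w: "admissible M m w" and x: "x \<in> U"
    and ln: "integrable mu (\<lambda>y. ln (norm (T y)) * w y)"
  shows "integrable mu (\<lambda>y. green_log (T x) (T y) * w y)"
    and "\<bar>\<integral>y. green_log (T x) (T y) * w y \<partial>mu\<bar>
       \<le> ln (norm (T x)) * m + (\<integral>y. ln (norm (T y)) * \<bar>w y\<bar> \<partial>mu) + near_const * (M + m)"
proof -
  have [measurable]: "w \<in> borel_measurable mu" using w by (auto simp: admissible_def)
  have int1: "integrable mu (\<lambda>y. \<bar>w y\<bar>)" using w by (auto simp: admissible_def)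
  have "integrable mu (\<lambda>y. \<bar>ln (norm (T y)) * w y\<bar>)" using ln by simp
  then have int2: "integrable mu (\<lambda>y. ln (norm (T y)) * \<bar>w y\<bar>)"
    by (rule integrable_transform) (use norm_T in \<open>auto simp: abs_mult less_imp_le\<close>)
  note int3 = near_const(2)[OF w x]
  define g where "g y = ln (norm (T x)) * \<bar>w y\<bar> + ln (norm (T y)) * \<bar>w y\<bar> + near x y * \<bar>w y\<bar>" for y
  have intg: "integrable mu g" unfolding g_def using int1 int2 int3 by auto
  have AE: "AE y in mu. norm (green_log (T x) (T y) * w y) \<le> g y"
    using AE_mu_neq[of x] AE_mu_in
  proof eventually_elim
    case (elim y)
    have XY: "norm (T x) > 1" "norm (T y) > 1" "T x \<noteq> T y" using elim x norm_T T_eq_iff by auto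
    have "\<bar>green_log (T x) (T y)\<bar> \<le> ln (norm (T x)) + ln (norm (T y)) + near x y"
      using green_log_nonpos[OF XY] green_log_lower[OF XY] inverse_le_sing[of "norm (T x - T y)"] XY
      by (simp add: near_def)
    then have "\<bar>green_log (T x) (T y)\<bar> * \<bar>w y\<bar> \<le> (ln (norm (T x)) + ln (norm (T y)) + near x y) * \<bar>w y\<bar>"
      by (intro mult_right_mono) auto
    then show ?case by (simp add: abs_mult g_def distrib_right)
  qed
  show int: "integrable mu (\<lambda>y. green_log (T x) (T y) * w y)"
    by (rule Bochner_Integration.integrable_bound[OF intg]) (use AE in \<open>auto elim!: eventually_mono\<close>)
  have "\<bar>\<integral>y. green_log (T x) (T y) * w y \<partial>mu\<bar> \<le> integral\<^sup>L mu g"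
    using norm_integral_le_integral[OF int intg AE] by simp
  also have "\<dots> = ln (norm (T x)) * (\<integral>y. \<bar>w y\<bar> \<partial>mu) + (\<integral>y. ln (norm (T y)) * \<bar>w y\<bar> \<partial>mu)
      + (\<integral>y. near x y * \<bar>w y\<bar> \<partial>mu)"
    unfolding g_def using int1 int2 int3 by simp
  also have "\<dots> \<le> ln (norm (T x)) * m + (\<integral>y. ln (norm (T y)) * \<bar>w y\<bar> \<partial>mu) + near_const * (M + m)"
    using w near_const(3)[OF w x] norm_T[OF x]
    by (intro add_mono mult_left_mono) (auto simp: admissible_def)
  finally show "\<bar>\<integral>y. green_log (T x) (T y) * w y \<partial>mu\<bar>
       \<le> ln (norm (T x)) * m + (\<integral>y. ln (norm (T y)) * \<bar>w y\<bar> \<partial>mu) + near_const * (M + m)" .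
qed

lemma stream_function_eq:
  assumes w: "w \<in> borel_measurable mu" and x: "x \<in> U"
  shows "stream_function U T w x = 1 / (2 * pi) * (\<integral>y. green_log (T x) (T y) * w y \<partial>mu)"
proof -
  have green: "green T x y = 1 / (2 * pi) * green_log (T x) (T y)" if "y \<in> U" "y \<noteq> x" for y
  proof -
    have nz: "T x - T y \<noteq> 0" using that x T_eq_iff by auto
    have Y: "T y \<noteq> 0" using norm_T[OF that(1)] by auto
    have star: "star (T y) = 1 / cnj (T y)"
    proof -
      have "of_real ((norm (T y))^2) = T y * cnj (T y)" by (rule complex_norm_square)
      then have "star (T y) = T y / (T y * cnj (T y))"
        unfolding star_def scaleR_conv_of_real of_real_inverse by (simp add: field_simps)
      then show ?thesis using Y by simp
    qed
    have "norm (T x - star (T y)) * norm (T y) = norm (1 - T x * cnj (T y))"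
      unfolding star using norm_reflected[OF Y] by simp
    moreover have "norm (1 - T x * cnj (T y)) > 0"
      using reflected_nonzero(1)[OF norm_T[OF x] norm_T[OF that(1)]] by simp
    ultimately show ?thesis using nz unfolding green_def green_log_def by (simp add: ln_div)
  qed
  have "stream_function U T w x = (\<integral>y. green T x y * w y \<partial>mu)"
    unfolding stream_function_def by (rule integral_mu)
  also have "\<dots> = (\<integral>y. 1 / (2 * pi) * (green_log (T x) (T y) * w y) \<partial>mu)"
  proof (rule integral_cong_AE)
    have [measurable]: "w \<in> borel_measurable mu" by (rule w)
    show "(\<lambda>y. green T x y * w y) \<in> borel_measurable mu"
      unfolding green_def star_def by measurable
    show "(\<lambda>y. 1 / (2 * pi) * (green_log (T x) (T y) * w y)) \<in> borel_measurable mu" by measurable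
    show "AE y in mu. green T x y * w y = 1 / (2 * pi) * (green_log (T x) (T y) * w y)"
      using AE_mu_neq[of x] AE_mu_in by eventually_elim (simp add: green)
  qed
  finally show ?thesis by simp
qed

lemma sqrt_vanishes: "((\<lambda>Y. c * sqrt (norm (Y - X))) \<longlongrightarrow> 0) (at (X::complex) within A)"
proof -
  have "((\<lambda>Y. c * sqrt (norm (Y - X))) \<longlongrightarrow> c * sqrt (norm (X - X))) (at X within A)"
    by (intro tendsto_intros)
  then show ?thesis by simp
qed

text \<open>
  The pointwise expansion \<open>green_log_taylor\<close> is integrated against \<open>w\<close>; the total remainder is
  \<open>O(|h|^(3/2))\<close> by the uniform bound of \<open>near_const\<close>.
\<close>
lemma potential_has_derivative:
  assumes w: "admissible M m w" and ln: "integrable mu (\<lambda>y. ln (norm (T y)) * w y)"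
    and X: "norm X > 1"
  shows "((\<lambda>X. \<integral>y. green_log X (T y) * w y \<partial>mu) has_derivative
     (\<lambda>h. inner h (\<integral>y. w y *\<^sub>R green_grad X (T y) \<partial>mu))) (at X)"
proof -
  define K where "K = near_const * (M + m)"
  have [measurable]: "w \<in> borel_measurable mu" using w by (auto simp: admissible_def)
  define G where "G = (\<integral>y. w y *\<^sub>R green_grad X (T y) \<partial>mu)"
  define P where "P X = (\<integral>y. green_log X (T y) * w y \<partial>mu)" for X
  have X_eq: "X = T (S X)" and x: "S X \<in> U" using X by (auto simp: T_S S_mem)
  obtain e where e: "e > 0" "ball X e \<subseteq> {z. norm z > 1}"
    using open_contains_ball open_D X by blast
  have "(P has_derivative (\<lambda>h. inner h G)) (at X)"
  proof (rule has_derivativeI_sandwich[OF e(1), where H = "\<lambda>Y. (63 * (2 * K)) * sqrt (norm (Y - X))"])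
    show "bounded_linear (\<lambda>h. inner h G)" by (rule bounded_linear_inner_left)
    show "((\<lambda>Y. (63 * (2 * K)) * sqrt (norm (Y - X))) \<longlongrightarrow> 0) (at X)" by (rule sqrt_vanishes)
    fix Y assume Y: "Y \<noteq> X" "dist Y X < e"
    define h where "h = Y - X"
    have Yh: "Y = X + h" by (simp add: h_def)
    have Y1: "norm Y > 1" using Y e by (auto simp: subset_eq dist_commute)
    have Y_eq: "Y = T (S Y)" and y: "S Y \<in> U" using Y1 by (auto simp: T_S S_mem)
    note iX = green_log_integrable(1)[OF w x ln, folded X_eq] green_grad_integrable(1)[OF w x, folded X_eq]
    note iY = green_log_integrable(1)[OF w y ln, folded Y_eq]
    note nX = near_const(2,3)[OF w x] and nY = near_const(2,3)[OF w y]
    have eq: "P Y - P X - inner h G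
      = (\<integral>y. (green_log Y (T y) - green_log X (T y) - inner (green_grad X (T y)) h) * w y \<partial>mu)"
    proof -
      have "inner h G = (\<integral>y. inner h (w y *\<^sub>R green_grad X (T y)) \<partial>mu)"
        unfolding G_def by (rule integral_inner_right[symmetric]) (use iX(2) in auto)
      moreover have "integrable mu (\<lambda>y. inner h (w y *\<^sub>R green_grad X (T y)))"
        by (rule integrable_inner_right) (use iX(2) in auto)
      ultimately have "P Y - P X - inner h G 
         = (\<integral>y. green_log Y (T y) * w y - green_log X (T y) * w y - inner h (w y *\<^sub>R green_grad X (T y)) \<partial>mu)"
        unfolding P_def using iX(1) iY by simp
      also have "\<dots> = (\<integral>y. (green_log Y (T y) - green_log X (T y) - inner (green_grad X (T y)) h) * w y \<partial>mu)"
        by (intro Bochner_Integration.integral_cong) (auto simp: algebra_simps inner_commute)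
      finally show ?thesis .
    qed
    define c where "c = 63 * (norm h * sqrt (norm h))"
    have c0: "c \<ge> 0" by (simp add: c_def)
    have "norm (\<integral>y. (green_log Y (T y) - green_log X (T y) - inner (green_grad X (T y)) h) * w y \<partial>mu)
       \<le> (\<integral>y. c * (near (S X) y * \<bar>w y\<bar> + near (S Y) y * \<bar>w y\<bar>) \<partial>mu)"
    proof (rule norm_integral_le_integral)
      have "integrable mu (\<lambda>y. green_log Y (T y) * w y - green_log X (T y) * w y - inner h (w y *\<^sub>R green_grad X (T y)))"
        by (intro Bochner_Integration.integrable_diff iX iY integrable_inner_right)
      then show "integrable mu (\<lambda>y. (green_log Y (T y) - green_log X (T y) - inner (green_grad X (T y)) h) * w y)"
        by (rule integrable_transform) (auto simp: algebra_simps inner_commute)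
      show "integrable mu (\<lambda>y. c * (near (S X) y * \<bar>w y\<bar> + near (S Y) y * \<bar>w y\<bar>))"
        using nX(1) nY(1) by auto
      show "AE y in mu. norm ((green_log Y (T y) - green_log X (T y) - inner (green_grad X (T y)) h) * w y)
           \<le> c * (near (S X) y * \<bar>w y\<bar> + near (S Y) y * \<bar>w y\<bar>)"
        using AE_mu_neq[of "S X"] AE_mu_neq[of "S Y"] AE_mu_in
      proof eventually_elim
        case (elim y)
        have "X \<noteq> T y" "Y \<noteq> T y" "norm (T y) > 1" using elim S_T norm_T by auto
        then have "\<bar>green_log Y (T y) - green_log X (T y) - inner (green_grad X (T y)) h\<bar>
          \<le> c * (near (S X) y + near (S Y) y)"
          using green_log_taylor[of X h "T y"] X Y1
          unfolding c_def near_def X_eq[symmetric] Y_eq[symmetric] Yh[symmetric] by blast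
        then have "\<bar>green_log Y (T y) - green_log X (T y) - inner (green_grad X (T y)) h\<bar> * \<bar>w y\<bar>
          \<le> c * (near (S X) y + near (S Y) y) * \<bar>w y\<bar>" by (intro mult_right_mono) auto
        then show ?case unfolding real_norm_def abs_mult by (simp only: distrib_left distrib_right mult.assoc)
      qed
    qed
    also have "\<dots> = c * ((\<integral>y. near (S X) y * \<bar>w y\<bar> \<partial>mu) + (\<integral>y. near (S Y) y * \<bar>w y\<bar> \<partial>mu))"
      using nX(1) nY(1) by simp
    also have "\<dots> \<le> c * (2 * K)" using nX(2) nY(2) c0 by (intro mult_left_mono) (auto simp: K_def)
    finally have "norm (P Y - P X - inner h G) \<le> (63 * (2 * K)) * sqrt (norm h) * norm h"
      unfolding eq c_def by (simp add: mult_ac)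
    moreover have "norm h > 0" using Y by (simp add: h_def)
    ultimately show "norm (P Y - P X - inner (Y - X) G) / norm (Y - X) \<le> (63 * (2 * K)) * sqrt (norm (Y - X))"
      by (simp add: divide_le_eq h_def)
  qed
  then show ?thesis by (simp add: P_def[abs_def] G_def)
qed

lemma inner_mult_cnj: "inner (a * v) G = inner v (cnj a * G)"
  by (simp add: inner_complex_Re mult_ac)

lemma GDERIV_compose_T:
  assumes "x \<in> U" "GDERIV F (T x) :> G"
  shows "GDERIV (\<lambda>x. F (T x)) x :> cnj (deriv T x) * G"
proof -
  have "(T has_derivative (*) (deriv T x)) (at x)"
    using T_deriv[OF assms(1)] by (simp add: has_field_derivative_def)
  from has_derivative_compose[OF this, of F "\<lambda>h. inner h G"] assms(2)
  show ?thesis unfolding gderiv_def by (simp add: inner_mult_cnj)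
qed

lemma stream_GDERIV:
  assumes w: "admissible M m w" and ln: "integrable mu (\<lambda>y. ln (norm (T y)) * w y)" and x: "x \<in> U"
  shows "GDERIV (stream_function U T w) x :> stream_grad w x"
proof -
  have wm: "w \<in> borel_measurable mu" using w by (auto simp: admissible_def)
  have "GDERIV (\<lambda>X. \<integral>y. green_log X (T y) * w y \<partial>mu) (T x) :> (\<integral>y. w y *\<^sub>R green_grad (T x) (T y) \<partial>mu)"
    unfolding gderiv_def by (rule potential_has_derivative[OF w ln norm_T[OF x]])
  from GDERIV_compose_T[OF x this]
  have "GDERIV (\<lambda>x. 1 / (2 * pi) * (\<integral>y. green_log (T x) (T y) * w y \<partial>mu)) x :> 
      (1 / (2 * pi)) *\<^sub>R (cnj (deriv T x) * (\<integral>y. w y *\<^sub>R green_grad (T x) (T y) \<partial>mu))"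
    unfolding gderiv_def by (auto intro!: derivative_eq_intros)
  then have "GDERIV (\<lambda>x. 1 / (2 * pi) * (\<integral>y. green_log (T x) (T y) * w y \<partial>mu)) x :> stream_grad w x"
    by (rule GDERIV_subst) (simp add: stream_grad_def scaleR_conv_of_real)
  then show ?thesis
    by (rule GDERIV_transform[OF _ open_U x]) (simp add: stream_function_eq[OF wm])
qed

lemma stream_grad_continuous:
  assumes w: "admissible M m w"
  shows "continuous_on U (stream_grad w)"
proof -
  define K where "K = near_const * (M + m)"
  have [measurable]: "w \<in> borel_measurable mu" using w by (auto simp: admissible_def)
  define G where "G X = (\<integral>y. w y *\<^sub>R green_grad X (T y) \<partial>mu)" for X
  have "continuous (at X within {z. norm z > 1}) G" if X: "norm X > 1" for X
  proof -
    have bound: "norm (G Y - G X) \<le> (14 * (2 * K)) * sqrt (norm (Y - X))" if Y1: "norm Y > 1" for Y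
    proof -
      define h where "h = Y - X"
      have Yh: "Y = X + h" by (simp add: h_def)
      have X_eq: "X = T (S X)" and x: "S X \<in> U" using X by (auto simp: T_S S_mem)
      have Y_eq: "Y = T (S Y)" and y: "S Y \<in> U" using Y1 by (auto simp: T_S S_mem)
      note iX = green_grad_integrable(1)[OF w x, folded X_eq]
      note iY = green_grad_integrable(1)[OF w y, folded Y_eq]
      note nX = near_const(2,3)[OF w x] and nY = near_const(2,3)[OF w y]
      define c where "c = 14 * sqrt (norm h)"
      have c0: "c \<ge> 0" by (simp add: c_def)
      have "norm (G Y - G X) = norm (\<integral>y. w y *\<^sub>R green_grad Y (T y) - w y *\<^sub>R green_grad X (T y) \<partial>mu)"
        unfolding G_def using iX iY by simp
      also have "\<dots> \<le> (\<integral>y. c * (near (S X) y * \<bar>w y\<bar> + near (S Y) y * \<bar>w y\<bar>) \<partial>mu)"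
      proof (rule norm_integral_le_integral)
        show "integrable mu (\<lambda>y. c * (near (S X) y * \<bar>w y\<bar> + near (S Y) y * \<bar>w y\<bar>))"
          using nX(1) nY(1) by auto
        show "AE y in mu. norm (w y *\<^sub>R green_grad Y (T y) - w y *\<^sub>R green_grad X (T y))
             \<le> c * (near (S X) y * \<bar>w y\<bar> + near (S Y) y * \<bar>w y\<bar>)"
          using AE_mu_neq[of "S X"] AE_mu_neq[of "S Y"] AE_mu_in
        proof eventually_elim
          case (elim y)
          have "X \<noteq> T y" "Y \<noteq> T y" "norm (T y) > 1" using elim S_T norm_T by auto
          then have "norm (green_grad Y (T y) - green_grad X (T y)) \<le> c * (near (S X) y + near (S Y) y)"
            using green_grad_hoelder[of X h "T y"] X Y1
            unfolding c_def near_def X_eq[symmetric] Y_eq[symmetric] Yh[symmetric] by blast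
          then have "\<bar>w y\<bar> * norm (green_grad Y (T y) - green_grad X (T y)) \<le> \<bar>w y\<bar> * (c * (near (S X) y + near (S Y) y))"
            by (intro mult_left_mono) auto
          then show ?case by (simp add: algebra_simps flip: scaleR_diff_right)
        qed
      qed (use iX iY in auto)
      also have "\<dots> = c * ((\<integral>y. near (S X) y * \<bar>w y\<bar> \<partial>mu) + (\<integral>y. near (S Y) y * \<bar>w y\<bar> \<partial>mu))"
        using nX(1) nY(1) by simp
      also have "\<dots> \<le> c * (2 * K)" using nX(2) nY(2) c0 by (intro mult_left_mono) (auto simp: K_def)
      finally show ?thesis by (simp add: c_def h_def mult_ac)
    qed
    have "(G \<longlongrightarrow> G X) (at X within {z. norm z > 1})"
    proof (rule Lim_transform_bound[where g = "\<lambda>Y. (14 * (2 * K)) * sqrt (norm (Y - X))", 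
          THEN LIM_zero_cancel])
      show "\<forall>\<^sub>F Y in at X within {z. norm z > 1}. norm (G Y - G X) \<le> norm ((14 * (2 * K)) * sqrt (norm (Y - X)))"
        unfolding eventually_at_filter using bound by (auto intro!: always_eventually order_trans[OF bound])
    qed (rule sqrt_vanishes)
    then show ?thesis by (simp add: continuous_within)
  qed
  then have G: "continuous_on {z. norm z > 1} G" by (simp add: continuous_on_eq_continuous_within)
  have "continuous_on U (\<lambda>x. cnj (deriv T x) / (2 * pi) * G (T x))"
    by (intro continuous_intros deriv_T_cont continuous_on_compose2[OF G T_cont]) (auto simp: norm_T)
  then show ?thesis unfolding stream_grad_def[abs_def] G_def .
qed

end

section \<open>Integration by parts and differentiation under the integral\<close>

lemma integrable_compact_support:
  fixes f :: "complex \<Rightarrow> real"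
  assumes "compact K" "continuous_on K f" "\<And>x. x \<notin> K \<Longrightarrow> f x = 0"
  shows "integrable lborel f"
proof -
  have "integrable lborel (\<lambda>x. indicator K x *\<^sub>R f x)"
    by (rule borel_integrable_compact[OF assms(1,2)])
  moreover have "(\<lambda>x. indicator K x *\<^sub>R f x) = f"
    using assms(3) by (auto simp: indicator_def fun_eq_iff)
  ultimately show ?thesis by simp
qed

lemma integral_lborel_translate:
  fixes f :: "complex \<Rightarrow> real"
  assumes "integrable lborel f"
  shows "integrable lborel (\<lambda>x. f (x + v))" "(\<integral>x. f (x + v) \<partial>lborel) = (\<integral>x. f x \<partial>lborel)"
proof -
  have d: "distr lborel borel ((+) v) = (lborel :: complex measure)" by (rule lborel_distr_plus)
  have f: "f \<in> borel_measurable borel" using borel_measurable_integrable[OF assms] by simp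
  have p: "(+) v \<in> measurable lborel borel" by simp
  show "integrable lborel (\<lambda>x. f (x + v))"
    using integrable_distr_eq[OF p f] assms unfolding d by (simp add: add.commute)
  show "(\<integral>x. f (x + v) \<partial>lborel) = (\<integral>x. f x \<partial>lborel)"
    using integral_distr[OF p f] unfolding d by (simp add: add.commute)
qed

lemma GDERIV_mvt_bound:
  fixes g :: "complex \<Rightarrow> real"
  assumes "\<And>z. z \<in> closed_segment x y \<Longrightarrow> GDERIV g z :> D z"
    and "\<And>z. z \<in> closed_segment x y \<Longrightarrow> norm (D z) \<le> M"
  shows "\<bar>g y - g x\<bar> \<le> M * norm (y - x)"
proof -
  have "norm (g y - g x) \<le> M * norm (y - x)"
  proof (rule differentiable_bound[where f' = "\<lambda>z h. inner h (D z)"])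
    show "(g has_derivative (\<lambda>h. inner h (D z))) (at z within closed_segment x y)"
      if "z \<in> closed_segment x y" for z
      using assms(1)[OF that] unfolding gderiv_def by (rule has_derivative_at_withinI)
    show "onorm (\<lambda>h. inner h (D z)) \<le> M" if "z \<in> closed_segment x y" for z
    proof (rule onorm_bound)
      show "0 \<le> M" using assms(2)[OF that] norm_ge_zero order_trans by blast
      show "norm (inner h (D z)) \<le> M * norm h" for h
        using Cauchy_Schwarz_ineq2[of h "D z"] assms(2)[OF that] mult_left_mono[of "norm (D z)" M "norm h"]
        by (simp add: mult.commute)
    qed
  qed auto
  then show ?thesis by simp
qed

lemma GDERIV_difference_quotient:
  fixes g :: "complex \<Rightarrow> real"
  assumes "GDERIV g x :> D" "h \<longlonglongrightarrow> 0" "\<And>n. h n \<noteq> (0::real)"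
  shows "(\<lambda>n. (g (x + h n *\<^sub>R e) - g x) / h n) \<longlonglongrightarrow> inner e D"
proof -
  have "((\<lambda>s. x + s *\<^sub>R e) has_derivative (\<lambda>s. s *\<^sub>R e)) (at 0)"
    by (auto intro!: derivative_eq_intros)
  moreover have "(g has_derivative (\<lambda>h. inner h D)) (at (x + 0 *\<^sub>R e))"
    using assms(1) by (simp add: gderiv_def)
  ultimately have "((\<lambda>s. g (x + s *\<^sub>R e)) has_derivative (\<lambda>s. inner (s *\<^sub>R e) D)) (at 0)"
    by (rule has_derivative_compose)
  then have "((\<lambda>s. g (x + s *\<^sub>R e)) has_real_derivative inner e D) (at 0)"
    unfolding has_field_derivative_def by (rule has_derivative_eq_rhs) (simp add: fun_eq_iff)
  then have "((\<lambda>s. (g (x + s *\<^sub>R e) - g (x + 0 *\<^sub>R e)) / (s - 0)) \<longlongrightarrow> inner e D) (at 0)"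
    by (simp add: has_field_derivative_iff)
  then have "(\<lambda>n. (g (x + h n *\<^sub>R e) - g (x + 0 *\<^sub>R e)) / (h n - 0)) \<longlonglongrightarrow> inner e D"
    using assms(2,3) by (auto simp: tendsto_at_iff_sequentially comp_def)
  then show ?thesis by simp
qed

text \<open>
  By translation invariance the integral of each difference quotient vanishes; dominated convergence
  gives the claim for the derivative.
\<close>
lemma integral_gradient_component_zero:
  fixes g :: "complex \<Rightarrow> real"
  assumes D: "\<And>x. GDERIV g x :> D x" and M: "\<And>x. norm (D x) \<le> M"
    and K: "compact K" "\<And>x. x \<notin> K \<Longrightarrow> g x = 0"
  shows "(\<integral>x. inner e (D x) \<partial>lborel) = 0"
proof -
  define h where "h n = 1 / real (Suc n)" for n
  have h: "h \<longlonglongrightarrow> 0" "\<And>n. h n \<noteq> 0" "\<And>n. 0 < h n" "\<And>n. h n \<le> 1"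
    using LIMSEQ_inverse_real_of_nat by (auto simp: h_def[abs_def] inverse_eq_divide)
  have cont: "continuous_on A g" for A
    using D unfolding gderiv_def
    by (intro continuous_at_imp_continuous_on ballI has_derivative_continuous)
  have M0: "M \<ge> 0" using M norm_ge_zero order_trans by blast
  have int: "integrable lborel g" by (rule integrable_compact_support[OF K(1) cont K(2)])
  have [measurable]: "g \<in> borel_measurable borel" by (rule borel_measurable_continuous_onI[OF cont])
  define q where "q n x = (g (x + h n *\<^sub>R e) - g x) / h n" for n x
  obtain R where R: "K \<subseteq> cball 0 R" using bounded_subset_ballD[OF compact_imp_bounded[OF K(1)], of 0] ball_subset_cball by (metis subset_trans)
  define B where "B = cball (0::complex) (R + norm e)"
  have q0: "integral\<^sup>L lborel (q n) = 0" for n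
  proof -
    have "(\<integral>x. g (x + h n *\<^sub>R e) - g x \<partial>lborel) = (\<integral>x. g (x + h n *\<^sub>R e) \<partial>lborel) - integral\<^sup>L lborel g"
      by (rule Bochner_Integration.integral_diff[OF integral_lborel_translate(1)[OF int, of "h n *\<^sub>R e"] int])
    also have "\<dots> = 0" using integral_lborel_translate(2)[OF int, of "h n *\<^sub>R e"] by linarith
    finally show ?thesis unfolding q_def by simp
  qed
  have qb: "norm (q n x) \<le> indicator B x *\<^sub>R (M * norm e)" for n x
  proof (cases "x \<in> B")
    case True
    have "\<bar>g (x + h n *\<^sub>R e) - g x\<bar> \<le> M * norm ((x + h n *\<^sub>R e) - x)"
      by (rule GDERIV_mvt_bound[OF D M])
    then show ?thesis using True h(3)[of n] by (simp add: q_def divide_le_eq mult_ac)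
  next
    case False
    have "x \<notin> K"
    proof
      assume "x \<in> K"
      then have "norm x \<le> R" using R by auto
      then have "norm x \<le> R + norm e" by (rule add_increasing2[OF norm_ge_zero])
      then show False using False by (simp add: B_def)
    qed
    moreover have "x + h n *\<^sub>R e \<notin> K"
    proof
      assume "x + h n *\<^sub>R e \<in> K"
      then have "norm (x + h n *\<^sub>R e) \<le> R" using R by auto
      moreover have "norm (h n *\<^sub>R e) \<le> norm e" using h(3,4)[of n] by (simp add: mult_left_le_one_le)
      moreover have "norm x \<le> norm (x + h n *\<^sub>R e) + norm (h n *\<^sub>R e)"
        using norm_triangle_ineq4[of "x + h n *\<^sub>R e" "h n *\<^sub>R e"] by simp
      ultimately show False using False by (simp add: B_def)
    qed
    ultimately show ?thesis using K(2) M0 by (simp add: q_def)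
  qed
  have [measurable]: "q n \<in> borel_measurable borel" for n
    unfolding q_def by measurable
  have lim: "(\<lambda>n. q n x) \<longlonglongrightarrow> inner e (D x)" for x
    unfolding q_def by (rule GDERIV_difference_quotient[OF D h(1,2)])
  have "(\<lambda>n. integral\<^sup>L lborel (q n)) \<longlonglongrightarrow> (\<integral>x. inner e (D x) \<partial>lborel)"
  proof (rule integral_dominated_convergence)
    show "(\<lambda>x. inner e (D x)) \<in> borel_measurable lborel"
      by (rule borel_measurable_LIMSEQ_real[OF lim]) auto
    show "integrable lborel (\<lambda>x. indicator B x *\<^sub>R (M * norm e))"
      by (rule borel_integrable_compact) (auto simp: B_def)
  qed (use lim qb in auto)
  then show ?thesis using q0 by (simp add: LIMSEQ_const_iff)
qed

text \<open>
  Formally, integration by parts moves one derivative from \<open>A\<close> to the derivative of \<open>B\<close> in the other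
  direction, and the mixed second derivatives of \<open>B\<close> cancel. As \<open>A\<close> and \<open>B\<close> are only once
  differentiable, one of the two derivatives of \<open>B\<close> is replaced by a difference quotient, which a
  translation moves to \<open>A\<close>.
\<close>
lemma integral_bracket_zero:
  fixes A B :: "complex \<Rightarrow> real"
  assumes U: "open U"
    and A: "\<And>x. x \<in> U \<Longrightarrow> GDERIV A x :> a x" "continuous_on U a"
    and B: "\<And>x. x \<in> U \<Longrightarrow> GDERIV B x :> b x" "continuous_on U b"
    and K: "compact K" "K \<subseteq> U" "\<And>x. x \<in> U - K \<Longrightarrow> B x = 0"
  shows "(\<integral>x. indicator U x * inner (\<i> * a x) (b x) \<partial>lborel) = 0"
proof -
  define A0 where "A0 x = (if x \<in> U then A x else 0)" for x
  define a0 where "a0 x = (if x \<in> U then a x else 0)" for x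
  define B0 where "B0 x = (if x \<in> U then B x else 0)" for x
  define b0 where "b0 x = (if x \<in> U then b x else 0)" for x
  have oK: "open (- K)" using K(1) by (simp add: compact_imp_closed open_Compl)
  have B0_K: "B0 x = 0" if "x \<notin> K" for x using K(3) that by (auto simp: B0_def)
  have GA: "GDERIV A0 x :> a0 x" if "x \<in> U" for x
    using GDERIV_transform[OF A(1)[OF that] U that, of A0] that by (simp add: A0_def a0_def)
  have GB_U: "GDERIV B0 x :> b0 x" if "x \<in> U" for x
    using GDERIV_transform[OF B(1)[OF that] U that, of B0] that by (simp add: B0_def b0_def)
  have GB_0: "GDERIV B0 x :> 0" if "x \<notin> K" for x
    by (rule GDERIV_transform[OF GDERIV_const[of 0] oK]) (use that B0_K in auto)
  have b0_K: "b0 x = 0" if "x \<notin> K" for x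
  proof (cases "x \<in> U")
    case True
    have "(\<lambda>h. inner h (b0 x)) = (\<lambda>h. inner h 0)"
      using has_derivative_unique GB_U[OF True] GB_0[OF that] unfolding gderiv_def by blast
    then have "inner (b0 x) (b0 x) = 0" by (metis inner_zero_right)
    then show ?thesis by simp
  qed (simp add: b0_def)
  have GB: "GDERIV B0 x :> b0 x" for x
    using GB_U[of x] GB_0[of x] b0_K[of x] K(2) by (cases "x \<in> K") auto
  have cA0: "continuous_on U A0"
    using GA unfolding gderiv_def by (intro continuous_at_imp_continuous_on ballI has_derivative_continuous)
  have ca0: "continuous_on U a0"
    using A(2) by (rule continuous_on_eq) (simp add: a0_def)
  have cB0: "continuous_on X B0" for X
    using GB unfolding gderiv_def by (intro continuous_at_imp_continuous_on ballI has_derivative_continuous)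
  have cb0: "continuous_on X b0" for X
  proof -
    have "continuous_on (U \<union> - K) b0"
    proof (rule continuous_on_open_Un[OF U oK])
      show "continuous_on U b0" using B(2) by (rule continuous_on_eq) (simp add: b0_def)
      show "continuous_on (- K) b0"
        by (rule continuous_on_eq[OF continuous_on_const[of _ 0]]) (simp add: b0_K)
    qed
    moreover have "U \<union> - K = UNIV" using K(2) by auto
    ultimately show ?thesis using continuous_on_subset[of UNIV b0 X] by simp
  qed
  obtain \<epsilon> where \<epsilon>: "\<epsilon> > 0" "(\<Union>x\<in>K. cball x \<epsilon>) \<subseteq> U"
    using compact_subset_open_imp_cball_epsilon_subset[OF K(1) U K(2)] by auto
  define K2 where "K2 = (\<Union>x\<in>K. cball x \<epsilon>)"
  have K2: "compact K2" "K2 \<subseteq> U" "K \<subseteq> K2"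
  proof -
    have "K2 = {x + y |x y. x \<in> K \<and> y \<in> cball 0 \<epsilon>}"
      unfolding K2_def
    proof (intro equalityI subsetI)
      fix z assume "z \<in> (\<Union>x\<in>K. cball x \<epsilon>)"
      then obtain x where "x \<in> K" "dist x z \<le> \<epsilon>" by auto
      then show "z \<in> {x + y |x y. x \<in> K \<and> y \<in> cball 0 \<epsilon>}"
        by (intro CollectI exI[of _ x] exI[of _ "z - x"]) (auto simp: dist_norm norm_minus_commute)
    next
      fix z assume "z \<in> {x + y |x y. x \<in> K \<and> y \<in> cball 0 \<epsilon>}"
      then obtain x y where "z = x + y" "x \<in> K" "norm y \<le> \<epsilon>" by auto
      then show "z \<in> (\<Union>x\<in>K. cball x \<epsilon>)" by (auto simp: dist_norm intro!: bexI[of _ x])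
    qed
    then show "compact K2" using compact_sums[OF K(1) compact_cball, of 0 \<epsilon>] by simp
    show "K2 \<subseteq> U" "K \<subseteq> K2" using \<epsilon> by (auto simp: K2_def)
  qed
  have oK2: "open (- K2)" using K2(1) by (simp add: compact_imp_closed open_Compl)
  have shift: "x \<in> K2" if "x + v \<in> K" "norm v \<le> \<epsilon>" for x v
    unfolding K2_def using that by (auto simp: dist_norm intro!: bexI[of _ "x + v"])
  have bounded_K2: "\<exists>M. \<forall>x\<in>K2. norm (f x) \<le> M" if "continuous_on K2 f" for f :: "complex \<Rightarrow> complex"
    using compact_imp_bounded[OF compact_continuous_image[OF that K2(1)]] by (auto simp: bounded_iff)
  obtain Ma where Ma: "\<And>x. x \<in> K2 \<Longrightarrow> norm (a0 x) \<le> Ma"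
    using bounded_K2[OF continuous_on_subset[OF ca0 K2(2)]] by auto
  obtain Mb' where Mb': "\<And>x. x \<in> K2 \<Longrightarrow> norm (b0 x) \<le> Mb'"
    using bounded_K2[OF cb0] by auto
  define Mb where "Mb = max Mb' 0"
  have Mb: "norm (b0 x) \<le> Mb" for x
  proof (cases "x \<in> K2")
    case True
    then show ?thesis using Mb'[of x] by (simp add: Mb_def)
  next
    case False
    then have "b0 x = 0" using b0_K K2(3) by blast
    then show ?thesis by (simp add: Mb_def)
  qed
  (* the identity for the difference quotient of B in the direction i, before division *)
  have shifted: "(\<integral>x. (B0 (x + v) - B0 x) * Re (a0 x) \<partial>lborel) = (\<integral>x. Re (b0 x) * (A0 x - A0 (x - v)) \<partial>lborel)"
    if v: "norm v \<le> \<epsilon>" for v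
  proof -
    define D where "D x = (B0 (x + v) - B0 x) *\<^sub>R a0 x + A0 x *\<^sub>R (b0 (x + v) - b0 x)" for x
    have out: "B0 x = 0" "B0 (x + v) = 0" "b0 x = 0" "b0 (x + v) = 0" if "x \<notin> K2" for x
      using that K2(3) shift[OF _ v, of x] B0_K b0_K by auto
    have cB: "continuous_on X (\<lambda>x. B0 (x + v))" and cb: "continuous_on X (\<lambda>x. b0 (x + v))" for X
      by (intro continuous_on_compose2[OF cB0[of UNIV]] continuous_on_compose2[OF cb0[of UNIV]] continuous_intros; simp)+
    have cAK: "continuous_on K2 A0" and caK: "continuous_on K2 a0"
      using continuous_on_subset[OF cA0 K2(2)] continuous_on_subset[OF ca0 K2(2)] by auto
    have GD: "GDERIV (\<lambda>x. A0 x * (B0 (x + v) - B0 x)) x :> D x" for x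
    proof (cases "x \<in> U")
      case True
      have "((\<lambda>x. x + v) has_derivative (\<lambda>h. h)) (at x)" by (auto intro!: derivative_eq_intros)
      from has_derivative_compose[OF this, of B0 "\<lambda>h. inner h (b0 (x + v))"] GB[of "x + v"]
      have "GDERIV (\<lambda>x. B0 (x + v)) x :> b0 (x + v)" unfolding gderiv_def by simp
      from GDERIV_mult[OF GA[OF True] GDERIV_diff[OF this GB]]
      show ?thesis by (simp add: D_def add.commute)
    next
      case False
      then have x: "x \<notin> K2" using K2(2) by auto
      have "GDERIV (\<lambda>x. A0 x * (B0 (x + v) - B0 x)) x :> 0"
        by (rule GDERIV_transform[OF GDERIV_const[of 0] oK2]) (use x out in auto)
      then show ?thesis using out[OF x] by (simp add: D_def)
    qed
    have cD: "continuous_on K2 D" unfolding D_def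
      by (intro continuous_intros cB cb cB0 cb0 cAK caK)
    obtain MD where MD: "\<And>x. x \<in> K2 \<Longrightarrow> norm (D x) \<le> MD" using bounded_K2[OF cD] by auto
    have MD': "norm (D x) \<le> max MD 0" for x
      proof (cases "x \<in> K2")
      case False
      then have "D x = 0" using out by (simp add: D_def)
      then show ?thesis by simp
    qed (use MD in \<open>auto intro: max.coboundedI1\<close>)
    have zero: "(\<integral>x. inner 1 (D x) \<partial>lborel) = 0"
      by (rule integral_gradient_component_zero[OF GD MD' K2(1)]) (use out in auto)
    have i1: "integrable lborel (\<lambda>x. (B0 (x + v) - B0 x) * Re (a0 x))"
      by (rule integrable_compact_support[OF K2(1)])
         (use out in \<open>auto intro!: continuous_intros cB cB0 caK\<close>)
    have i2: "integrable lborel (\<lambda>x. A0 x * Re (b0 (x + v)))"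
      by (rule integrable_compact_support[OF K2(1)])
         (use out in \<open>auto intro!: continuous_intros cb cAK\<close>)
    have i3: "integrable lborel (\<lambda>x. A0 x * Re (b0 x))"
      by (rule integrable_compact_support[OF K2(1)])
         (use out in \<open>auto intro!: continuous_intros cb0 cAK\<close>)
    have "(\<lambda>x. inner 1 (D x)) = (\<lambda>x. (B0 (x + v) - B0 x) * Re (a0 x) + (A0 x * Re (b0 (x + v)) - A0 x * Re (b0 x)))"
      by (auto simp: D_def inner_complex_def algebra_simps)
    then have "(\<integral>x. (B0 (x + v) - B0 x) * Re (a0 x) \<partial>lborel)
       = (\<integral>x. A0 x * Re (b0 x) \<partial>lborel) - (\<integral>x. A0 x * Re (b0 (x + v)) \<partial>lborel)"
      using zero i1 i2 i3 by simp
    also have "(\<integral>x. A0 x * Re (b0 (x + v)) \<partial>lborel) = (\<integral>x. A0 (x - v) * Re (b0 x) \<partial>lborel)"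
      using integral_lborel_translate(2)[OF i2, of "- v"] by simp
    also have "(\<integral>x. A0 x * Re (b0 x) \<partial>lborel) - \<dots> = (\<integral>x. Re (b0 x) * (A0 x - A0 (x - v)) \<partial>lborel)"
      using i3 integral_lborel_translate(1)[OF i2, of "- v"] by (simp add: algebra_simps)
    finally show ?thesis .
  qed
  define h where "h n = \<epsilon> / real (Suc n)" for n
  have "(\<lambda>n. \<epsilon> * (1 / real (Suc n))) \<longlonglongrightarrow> \<epsilon> * 0"
    using LIMSEQ_inverse_real_of_nat by (intro tendsto_intros) (simp add: inverse_eq_divide)
  then have h: "h \<longlonglongrightarrow> 0" "\<And>n. h n \<noteq> 0" "\<And>n. 0 < h n" "\<And>n. h n \<le> \<epsilon>"
    using \<epsilon> by (auto simp: h_def[abs_def] divide_le_eq)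
  have nv: "norm (h n *\<^sub>R \<i>) \<le> \<epsilon>" for n using h(3,4)[of n] by simp
  have mI: "(\<lambda>x. if x \<in> U then f x else 0) \<in> borel_measurable lborel" if "continuous_on U f" for f :: "complex \<Rightarrow> real"
    using borel_measurable_continuous_on_if[OF _ that continuous_on_const[of _ 0]] U by auto
  have [measurable]: "A0 \<in> borel_measurable borel"
    using mI[OF cA0] by (simp add: A0_def[abs_def] cong: if_cong)
  have [measurable]: "(\<lambda>x. Re (a0 x)) \<in> borel_measurable borel" "(\<lambda>x. Im (a0 x)) \<in> borel_measurable borel"
    using mI[of "\<lambda>x. Re (a0 x)"] mI[of "\<lambda>x. Im (a0 x)"] continuous_on_Re[OF ca0] continuous_on_Im[OF ca0]
    by (simp_all add: a0_def[abs_def] if_distrib[of Re] if_distrib[of Im] cong: if_cong)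
  have [measurable]: "B0 \<in> borel_measurable borel" "b0 \<in> borel_measurable borel"
    by (intro borel_measurable_continuous_onI cB0 cb0)+
  have L1: "(\<lambda>n. \<integral>x. (B0 (x + h n *\<^sub>R \<i>) - B0 x) / h n * Re (a0 x) \<partial>lborel) \<longlonglongrightarrow> (\<integral>x. Im (b0 x) * Re (a0 x) \<partial>lborel)"
  proof (rule integral_dominated_convergence)
    show "integrable lborel (\<lambda>x. indicator K2 x *\<^sub>R (Mb * Ma))"
      by (rule borel_integrable_compact[OF K2(1)]) auto
    have lim: "(\<lambda>n. (B0 (x + h n *\<^sub>R \<i>) - B0 x) / h n * Re (a0 x)) \<longlonglongrightarrow> Im (b0 x) * Re (a0 x)" for x
      using GDERIV_difference_quotient[OF GB[of x] h(1,2), of \<i>] by (intro tendsto_intros) (simp add: inner_complex_def)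
    then show "AE x in lborel. (\<lambda>n. (B0 (x + h n *\<^sub>R \<i>) - B0 x) / h n * Re (a0 x)) \<longlonglongrightarrow> Im (b0 x) * Re (a0 x)"
      by simp
    have "norm ((B0 (x + h n *\<^sub>R \<i>) - B0 x) / h n * Re (a0 x)) \<le> indicator K2 x *\<^sub>R (Mb * Ma)" for x n
    proof (cases "x \<in> K2")
      case True
      have "\<bar>B0 (x + h n *\<^sub>R \<i>) - B0 x\<bar> \<le> Mb * norm (x + h n *\<^sub>R \<i> - x)"
        by (rule GDERIV_mvt_bound[OF GB Mb])
      then have "\<bar>(B0 (x + h n *\<^sub>R \<i>) - B0 x) / h n\<bar> \<le> Mb" using h(3)[of n] by (simp add: divide_le_eq)
      moreover have "\<bar>Re (a0 x)\<bar> \<le> Ma" using Ma[OF True] abs_Re_le_cmod order_trans by blast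
      ultimately have "\<bar>(B0 (x + h n *\<^sub>R \<i>) - B0 x) / h n\<bar> * \<bar>Re (a0 x)\<bar> \<le> Mb * Ma"
        by (intro mult_mono) (auto simp: Mb_def)
      then show ?thesis using True by (simp add: abs_mult)
    next
      case False
      then have "B0 x = 0" "B0 (x + h n *\<^sub>R \<i>) = 0" using shift[OF _ nv, of x] B0_K K2(3) by auto
      then show ?thesis using False by simp
    qed
    then show "AE x in lborel. norm ((B0 (x + h n *\<^sub>R \<i>) - B0 x) / h n * Re (a0 x)) \<le> indicator K2 x *\<^sub>R (Mb * Ma)" for n
      by simp
  qed auto
  have L2: "(\<lambda>n. \<integral>x. Re (b0 x) * ((A0 x - A0 (x - h n *\<^sub>R \<i>)) / h n) \<partial>lborel) \<longlonglongrightarrow> (\<integral>x. Re (b0 x) * Im (a0 x) \<partial>lborel)"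
  proof (rule integral_dominated_convergence)
    show "integrable lborel (\<lambda>x. indicator K2 x *\<^sub>R (Mb * Ma))"
      by (rule borel_integrable_compact[OF K2(1)]) auto
    have lim: "(\<lambda>n. Re (b0 x) * ((A0 x - A0 (x - h n *\<^sub>R \<i>)) / h n)) \<longlonglongrightarrow> Re (b0 x) * Im (a0 x)" for x
    proof (cases "x \<in> K")
      case True
      then have "x \<in> U" using K by auto
      have "(\<lambda>n. - h n) \<longlonglongrightarrow> 0" using tendsto_minus[OF h(1)] by simp
      from GDERIV_difference_quotient[OF GA[OF \<open>x \<in> U\<close>] this, of \<i>] h(2)
      have "(\<lambda>n. (A0 (x + (- h n) *\<^sub>R \<i>) - A0 x) / (- h n)) \<longlonglongrightarrow> Im (a0 x)"
        by (simp add: inner_complex_def)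
      moreover have "(A0 (x + (- h n) *\<^sub>R \<i>) - A0 x) / (- h n) = (A0 x - A0 (x - h n *\<^sub>R \<i>)) / h n" for n
        using h(2)[of n] by (simp add: field_simps)
      ultimately show ?thesis by (intro tendsto_intros) simp
    qed (simp add: b0_K)
    then show "AE x in lborel. (\<lambda>n. Re (b0 x) * ((A0 x - A0 (x - h n *\<^sub>R \<i>)) / h n)) \<longlonglongrightarrow> Re (b0 x) * Im (a0 x)"
      by simp
    have "norm (Re (b0 x) * ((A0 x - A0 (x - h n *\<^sub>R \<i>)) / h n)) \<le> indicator K2 x *\<^sub>R (Mb * Ma)" for x n
    proof (cases "x \<in> K")
      case True
      have seg: "closed_segment (x - h n *\<^sub>R \<i>) x \<subseteq> K2"
      proof -
        have "closed_segment (x - h n *\<^sub>R \<i>) x \<subseteq> cball x \<epsilon>"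
          using nv[of n] \<epsilon> by (intro closed_segment_subset) (auto simp: dist_norm)
        then show ?thesis using True by (auto simp: K2_def)
      qed
      have "\<bar>A0 x - A0 (x - h n *\<^sub>R \<i>)\<bar> \<le> Ma * norm (x - (x - h n *\<^sub>R \<i>))"
        by (rule GDERIV_mvt_bound[of _ _ _ a0]) (use seg K2(2) GA Ma in auto)
      then have "\<bar>(A0 x - A0 (x - h n *\<^sub>R \<i>)) / h n\<bar> \<le> Ma" using h(3)[of n] by (simp add: divide_le_eq)
      moreover have "\<bar>Re (b0 x)\<bar> \<le> Mb" using Mb[of x] abs_Re_le_cmod order_trans by blast
      ultimately have "\<bar>Re (b0 x)\<bar> * \<bar>(A0 x - A0 (x - h n *\<^sub>R \<i>)) / h n\<bar> \<le> Mb * Ma"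
        by (intro mult_mono) (auto simp: Mb_def)
      then show ?thesis using True K2(3) by (auto simp: abs_mult indicator_def)
    next
      case False
      have "0 \<le> indicator K2 x *\<^sub>R (Mb * Ma)"
      proof (cases "x \<in> K2")
        case True
        then have "Ma \<ge> 0" using Ma[of x] norm_ge_zero order_trans by blast
        then show ?thesis by (simp add: Mb_def)
      qed simp
      then show ?thesis using False b0_K by simp
    qed
    then show "AE x in lborel. norm (Re (b0 x) * ((A0 x - A0 (x - h n *\<^sub>R \<i>)) / h n)) \<le> indicator K2 x *\<^sub>R (Mb * Ma)" for n
      by simp
  qed auto
  have "(\<integral>x. (B0 (x + h n *\<^sub>R \<i>) - B0 x) / h n * Re (a0 x) \<partial>lborel)
      = (\<integral>x. Re (b0 x) * ((A0 x - A0 (x - h n *\<^sub>R \<i>)) / h n) \<partial>lborel)" for n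
    using arg_cong[OF shifted[OF nv[of n]], of "\<lambda>I. I / h n"]
    by (simp flip: integral_divide_zero)
  then have eq: "(\<integral>x. Im (b0 x) * Re (a0 x) \<partial>lborel) = (\<integral>x. Re (b0 x) * Im (a0 x) \<partial>lborel)"
    using LIMSEQ_unique[OF L1] L2 by (simp only:)
  have caK: "continuous_on K2 a0" by (rule continuous_on_subset[OF ca0 K2(2)])
  have out: "b0 x = 0" if "x \<notin> K2" for x using that b0_K K2(3) by auto
  have i1: "integrable lborel (\<lambda>x. Im (b0 x) * Re (a0 x))"
    by (rule integrable_compact_support[OF K2(1)]) (use out in \<open>auto intro!: continuous_intros cb0 caK\<close>)
  have i2: "integrable lborel (\<lambda>x. Re (b0 x) * Im (a0 x))"
    by (rule integrable_compact_support[OF K2(1)]) (use out in \<open>auto intro!: continuous_intros cb0 caK\<close>)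
  have "(\<lambda>x. indicator U x * inner (\<i> * a x) (b x)) = (\<lambda>x. Im (b0 x) * Re (a0 x) - Re (b0 x) * Im (a0 x))"
    by (auto simp: fun_eq_iff a0_def b0_def inner_complex_def indicator_def)
  then show ?thesis using eq i1 i2 by simp
qed

lemma has_real_derivative_integral:
  fixes f f' :: "'a \<Rightarrow> real \<Rightarrow> real"
  assumes \<delta>: "\<delta> > 0"
    and int: "\<And>s. s \<in> ball t \<delta> \<Longrightarrow> integrable M (\<lambda>x. f x s)"
    and der: "\<And>x s. x \<in> space M \<Longrightarrow> s \<in> ball t \<delta> \<Longrightarrow> ((\<lambda>s. f x s) has_real_derivative f' x s) (at s)"
    and bnd: "\<And>x s. x \<in> space M \<Longrightarrow> s \<in> ball t \<delta> \<Longrightarrow> \<bar>f' x s\<bar> \<le> g x"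
    and g: "integrable M g"
  shows "((\<lambda>s. \<integral>x. f x s \<partial>M) has_real_derivative (\<integral>x. f' x t \<partial>M)) (at t)"
  unfolding has_field_derivative_iff tendsto_at_iff_sequentially comp_def
proof (intro allI impI)
  fix X assume X: "\<forall>i. X i \<in> UNIV - {t}" "X \<longlonglongrightarrow> t"
  have "eventually (\<lambda>n. X n \<in> ball t \<delta>) sequentially"
    using X(2) \<delta> by (intro topological_tendstoD) auto
  then obtain N where N: "\<And>n. n \<ge> N \<Longrightarrow> X n \<in> ball t \<delta>" by (auto simp: eventually_sequentially)
  define Y where "Y n = X (n + N)" for n
  have Y: "Y n \<in> ball t \<delta>" "Y n \<noteq> t" for n using N X(1) by (auto simp: Y_def)
  have Yt: "Y \<longlonglongrightarrow> t" unfolding Y_def using X(2) by (rule LIMSEQ_ignore_initial_segment)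
  have tb: "t \<in> ball t \<delta>" using \<delta> by simp
  have lim: "(\<lambda>n. (f x (Y n) - f x t) / (Y n - t)) \<longlonglongrightarrow> f' x t" if "x \<in> space M" for x
    using der[OF that tb] Y(2) Yt unfolding has_field_derivative_iff tendsto_at_iff_sequentially comp_def by auto
  have "(\<lambda>n. \<integral>x. (f x (Y n) - f x t) / (Y n - t) \<partial>M) \<longlonglongrightarrow> (\<integral>x. f' x t \<partial>M)"
  proof (rule integral_dominated_convergence[OF _ _ g])
    have m: "(\<lambda>x. (f x (Y n) - f x t) / (Y n - t)) \<in> borel_measurable M" for n
      using int[OF Y(1)[of n]] int[OF tb] by measurable
    then show "(\<lambda>x. (f x (Y n) - f x t) / (Y n - t)) \<in> borel_measurable M" for n .
    show "(\<lambda>x. f' x t) \<in> borel_measurable M"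
      by (rule borel_measurable_LIMSEQ_real[OF lim m])
    show "AE x in M. (\<lambda>n. (f x (Y n) - f x t) / (Y n - t)) \<longlonglongrightarrow> f' x t"
      using lim by (intro AE_I2)
    show "AE x in M. norm ((f x (Y n) - f x t) / (Y n - t)) \<le> g x" for n
    proof (rule AE_I2)
      fix x assume x: "x \<in> space M"
      have "norm (f x (Y n) - f x t) \<le> g x * norm (Y n - t)"
      proof (rule field_differentiable_bound[where S = "ball t \<delta>"])
        show "((\<lambda>s. f x s) has_real_derivative f' x s) (at s within ball t \<delta>)" if "s \<in> ball t \<delta>" for s
          using der[OF x that] by (rule has_field_derivative_at_within)
      qed (use bnd[OF x] Y tb in auto)
      then show "norm ((f x (Y n) - f x t) / (Y n - t)) \<le> g x"
        using Y(2)[of n] by (simp add: divide_le_eq)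
    qed
  qed
  moreover have "(\<integral>x. (f x (Y n) - f x t) / (Y n - t) \<partial>M) = ((\<integral>x. f x (Y n) \<partial>M) - (\<integral>x. f x t \<partial>M)) / (Y n - t)" for n
    using int[OF Y(1)[of n]] int[OF tb] by simp
  ultimately have "(\<lambda>n. ((\<integral>x. f x (Y n) \<partial>M) - (\<integral>x. f x t \<partial>M)) / (Y n - t)) \<longlonglongrightarrow> (\<integral>x. f' x t \<partial>M)"
    by (simp only:)
  then have "(\<lambda>n. ((\<integral>x. f x (X (n + N)) \<partial>M) - (\<integral>x. f x t \<partial>M)) / (X (n + N) - t)) \<longlonglongrightarrow> (\<integral>x. f' x t \<partial>M)"
    by (simp only: Y_def)
  then show "(\<lambda>n. ((\<integral>x. f x (X n) \<partial>M) - (\<integral>x. f x t \<partial>M)) / (X n - t)) \<longlonglongrightarrow> (\<integral>x. f' x t \<partial>M)"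
    by (rule LIMSEQ_offset)
qed

section \<open>The vorticity equation in weak form\<close>

locale euler_solution = exterior_domain \<Gamma> T for \<Gamma> T +
  fixes \<alpha> :: real and \<omega>\<^sub>0 :: "complex \<Rightarrow> real" and \<omega> :: "complex \<Rightarrow> real \<Rightarrow> real"
  assumes solution: "vorticity_solution (outside \<Gamma>) T \<alpha> \<omega>\<^sub>0 \<omega>"
    and initial_nonneg: "\<And>x. x \<in> outside \<Gamma> \<Longrightarrow> \<omega>\<^sub>0 x \<ge> 0"
begin

abbreviation w :: "real \<Rightarrow> complex \<Rightarrow> real" where "w t x \<equiv> \<omega> x t"

lemma
  solution_smooth: "smooth_on (U \<times> {0..}) (\<lambda>(x, t). \<omega> x t)"
  and solution_support: "\<forall>t\<ge>0. compactly_supported_in U (\<lambda>x. \<omega> x t)"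
  and solution_transport: "\<forall>x\<in>U. \<forall>t>0. deriv (\<lambda>s. \<omega> x s) t
          + velocity U T \<alpha> (\<lambda>y. \<omega> y t) x \<bullet> grad (\<lambda>y. \<omega> y t) x = 0"
  and solution_initial: "\<forall>x\<in>U. \<omega> x 0 = \<omega>\<^sub>0 x"
  and solution_Lp: "\<forall>p\<ge>1. \<forall>t\<ge>0. (LINT x:U|lborel. \<bar>\<omega> x t\<bar> powr p) = (LINT x:U|lborel. \<bar>\<omega>\<^sub>0 x\<bar> powr p)"
  and solution_sup: "\<forall>t\<ge>0. (SUP x\<in>U. \<bar>\<omega> x t\<bar>) = (SUP x\<in>U. \<bar>\<omega>\<^sub>0 x\<bar>)"
  using solution unfolding vorticity_solution_def U_def[symmetric] by - (elim conjE, assumption)+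

text \<open>
  The solution as a function on space-time, the form in which its smoothness is given.
\<close>
definition joint :: "complex \<times> real \<Rightarrow> real" where "joint = (\<lambda>(x, t). \<omega> x t)"

definition joint_D :: "complex \<times> real \<Rightarrow> complex \<times> real \<Rightarrow> real" where
  "joint_D p v = frechet_derivative joint (at p within U \<times> {0..}) v"

lemma joint_derivative:
  "p \<in> U \<times> {0..} \<Longrightarrow> (joint has_derivative joint_D p) (at p within U \<times> {0..})"
  and joint_D_continuous: "continuous_on (U \<times> {0..}) (\<lambda>p. joint_D p v)"
  and joint_continuous: "continuous_on (U \<times> {0..}) joint"
proof -
  have "smooth_on (U \<times> {0..}) joint"
    using solution_smooth unfolding joint_def .
  then have C: "Ck_on (Suc 0) (U \<times> {0..}) joint" unfolding smooth_on_def by blast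
  then have d: "joint differentiable_on U \<times> {0..}" by simp
  have "joint_D p = frechet_derivative joint (at p within U \<times> {0..})" by (simp add: joint_D_def fun_eq_iff)
  then show "(joint has_derivative joint_D p) (at p within U \<times> {0..})" if "p \<in> U \<times> {0..}"
    using d that unfolding differentiable_on_def by (metis frechet_derivative_works)
  show "continuous_on (U \<times> {0..}) (\<lambda>p. joint_D p v)" using C unfolding joint_D_def Ck_on.simps by blast
  show "continuous_on (U \<times> {0..}) joint" by (rule differentiable_imp_continuous_on[OF d])
qed

definition w_grad :: "real \<Rightarrow> complex \<Rightarrow> complex" where
  "w_grad t x = Complex (joint_D (x, t) (1, 0)) (joint_D (x, t) (\<i>, 0))"

definition w_dt :: "real \<Rightarrow> complex \<Rightarrow> real" where
  "w_dt t x = joint_D (x, t) (0, 1)"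

lemma w_GDERIV:
  assumes "x \<in> U" "t \<ge> 0"
  shows "GDERIV (w t) x :> w_grad t x"
proof -
  have p: "(x, t) \<in> U \<times> {0..}" using assms by auto
  have "((\<lambda>y. (y, t)) has_derivative (\<lambda>v. (v, 0))) (at x within U)"
    by (auto intro!: derivative_eq_intros)
  moreover have "(joint has_derivative joint_D (x, t)) (at (x, t) within (\<lambda>y. (y, t)) ` U)"
    by (rule has_derivative_subset[OF joint_derivative[OF p]]) (use assms in auto)
  ultimately have "((\<lambda>y. joint (y, t)) has_derivative (\<lambda>v. joint_D (x, t) (v, 0))) (at x within U)"
    by (rule has_derivative_in_compose)
  then have d: "((\<lambda>y. joint (y, t)) has_derivative (\<lambda>v. joint_D (x, t) (v, 0))) (at x)"
    using at_within_open[OF assms(1) open_U] by simp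
  have lin: "bounded_linear (\<lambda>v. joint_D (x, t) (v, 0))" by (rule has_derivative_bounded_linear[OF d])
  have "joint_D (x, t) (v, 0) = inner v (w_grad t x)" for v
  proof -
    have "v = Re v *\<^sub>R 1 + Im v *\<^sub>R \<i>" by (simp add: complex_eq_iff)
    then have "joint_D (x, t) (v, 0) = joint_D (x, t) (Re v *\<^sub>R 1 + Im v *\<^sub>R \<i>, 0)"
      by (rule arg_cong)
    also have "\<dots> = Re v * joint_D (x, t) (1, 0) + Im v * joint_D (x, t) (\<i>, 0)"
      using linear_add[OF bounded_linear.linear[OF lin], of "Re v *\<^sub>R 1" "Im v *\<^sub>R \<i>"]
        linear_scale[OF bounded_linear.linear[OF lin], of "Re v" 1] linear_scale[OF bounded_linear.linear[OF lin], of "Im v" \<i>] by simp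
    finally show ?thesis by (simp add: w_grad_def inner_complex_def)
  qed
  then show ?thesis using d by (simp add: gderiv_def joint_def)
qed

lemma slice_continuous:
  fixes f :: "complex \<times> real \<Rightarrow> 'a::topological_space"
  assumes "continuous_on (U \<times> {0..}) f" "t \<ge> 0"
  shows "continuous_on U (\<lambda>x. f (x, t))"
  by (rule continuous_on_compose2[OF assms(1)]) (use assms(2) in \<open>auto intro!: continuous_intros\<close>)

lemma w_grad_continuous: "t \<ge> 0 \<Longrightarrow> continuous_on U (w_grad t)"
  unfolding w_grad_def[abs_def] Complex_eq
  by (intro continuous_intros slice_continuous[OF joint_D_continuous])

lemma w_continuous: "t \<ge> 0 \<Longrightarrow> continuous_on U (w t)"
  using slice_continuous[OF joint_continuous] by (simp add: joint_def)

lemma w_time_continuous: "x \<in> U \<Longrightarrow> continuous_on {0..} (\<lambda>t. \<omega> x t)"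
proof -
  assume "x \<in> U"
  then have "continuous_on {0..} (\<lambda>t. joint (x, t))"
    by (intro continuous_on_compose2[OF joint_continuous]) (auto intro!: continuous_intros)
  then show ?thesis by (simp add: joint_def)
qed

lemma w_DERIV_time:
  assumes "x \<in> U" "t > 0"
  shows "((\<lambda>s. \<omega> x s) has_real_derivative w_dt t x) (at t)"
proof -
  have p: "(x, t) \<in> U \<times> {0..}" using assms by auto
  have "((\<lambda>s. (x, s)) has_derivative (\<lambda>v. (0, v))) (at t within {0..})"
    by (auto intro!: derivative_eq_intros)
  moreover have "(joint has_derivative joint_D (x, t)) (at (x, t) within (\<lambda>s. (x, s)) ` {0..})"
    by (rule has_derivative_subset[OF joint_derivative[OF p]]) (use assms in auto)
  ultimately have "((\<lambda>s. joint (x, s)) has_derivative (\<lambda>v. joint_D (x, t) (0, v))) (at t within {0..})"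
    by (rule has_derivative_in_compose)
  then have d: "((\<lambda>s. joint (x, s)) has_derivative (\<lambda>v. joint_D (x, t) (0, v))) (at t)"
    using assms at_within_interior[of t "{0..}"] by simp
  have lin: "bounded_linear (\<lambda>v. joint_D (x, t) (0, v))" by (rule has_derivative_bounded_linear[OF d])
  have "joint_D (x, t) (0, v) = w_dt t x * v" for v
    using linear_scale[OF bounded_linear.linear[OF lin], of v 1] by (simp add: w_dt_def)
  then show ?thesis using d by (simp add: has_field_derivative_def joint_def)
qed

lemma w_support:
  assumes "t \<ge> 0"
  obtains K where "compact K" "K \<subseteq> U" "\<And>x. x \<in> U - K \<Longrightarrow> w t x = 0"
  using solution_support[rule_format, OF assms] unfolding compactly_supported_in_def by metis

lemma w_initial: "x \<in> U \<Longrightarrow> \<omega>\<^sub>0 x = w 0 x"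
  using solution_initial by simp

lemma integrable_compact_support_mu:
  fixes f :: "complex \<Rightarrow> real"
  assumes "continuous_on U f" "compact K" "K \<subseteq> U" "\<And>x. x \<in> U - K \<Longrightarrow> f x = 0"
  shows "integrable mu f"
proof -
  have "integrable lborel (\<lambda>x. indicator K x *\<^sub>R f x)"
    by (rule borel_integrable_compact) (use assms continuous_on_subset in auto)
  then have "integrable lborel (\<lambda>x. indicator U x *\<^sub>R f x)"
    by (rule integrable_transform) (use assms in \<open>auto simp: indicator_def\<close>)
  then show ?thesis
    unfolding mu_def using U_sets by (subst integrable_restrict_space) auto
qed

lemma integrable_continuous_times_w:
  assumes "t \<ge> 0" "continuous_on U f"
  shows "integrable mu (\<lambda>x. f x * w t x)"
proof -
  obtain K where K: "compact K" "K \<subseteq> U" "\<And>x. x \<in> U - K \<Longrightarrow> w t x = 0"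
    using w_support[OF assms(1)] by blast
  show ?thesis
    by (rule integrable_compact_support_mu[OF _ K(1,2)])
       (use K(3) assms w_continuous in \<open>auto intro!: continuous_intros\<close>)
qed

lemma w_integrable: "t \<ge> 0 \<Longrightarrow> integrable mu (w t)"
  using integrable_continuous_times_w[of t "\<lambda>_. 1"] by simp

definition sup0 :: real where "sup0 = (SUP x\<in>U. \<bar>\<omega>\<^sub>0 x\<bar>)"
definition mass :: real where "mass = (\<integral>x. \<omega>\<^sub>0 x \<partial>mu)"

lemma L1_norm: "t \<ge> 0 \<Longrightarrow> (\<integral>x. \<bar>w t x\<bar> \<partial>mu) = mass"
proof -
  assume t: "t \<ge> 0"
  have "(LINT x:U|lborel. \<bar>\<omega> x t\<bar> powr 1) = (LINT x:U|lborel. \<bar>\<omega>\<^sub>0 x\<bar> powr 1)"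
    using solution_Lp[rule_format, of 1 t] t by simp
  then have "(\<integral>x. \<bar>w t x\<bar> \<partial>mu) = (\<integral>x. \<bar>\<omega>\<^sub>0 x\<bar> \<partial>mu)"
    by (simp add: integral_mu)
  also have "\<dots> = mass" unfolding mass_def
    by (intro Bochner_Integration.integral_cong) (use initial_nonneg in \<open>auto simp: U_def\<close>)
  finally show ?thesis .
qed

lemma U_nonempty: "U \<noteq> {}"
  using S_mem[of 2] by auto

lemma w_bounded:
  assumes "t \<ge> 0" "x \<in> U"
  shows "\<bar>w t x\<bar> \<le> sup0"
proof -
  obtain K where K: "compact K" "K \<subseteq> U" "\<And>x. x \<in> U - K \<Longrightarrow> w t x = 0"
    using w_support[OF assms(1)] by blast
  have "compact ((\<lambda>x. \<bar>w t x\<bar>) ` K)"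
    by (intro compact_continuous_image K(1) continuous_intros continuous_on_subset[OF w_continuous K(2)] assms)
  then have "bounded ((\<lambda>x. \<bar>w t x\<bar>) ` K)" by (rule compact_imp_bounded)
  then obtain B where B: "\<forall>x\<in>K. \<bar>w t x\<bar> \<le> B" by (auto simp: bounded_iff)
  have "\<bar>w t x\<bar> \<le> max B 0" if "x \<in> U" for x
    using B K(3)[of x] that by (cases "x \<in> K") (auto intro: max.coboundedI1)
  then have "bdd_above ((\<lambda>x. \<bar>w t x\<bar>) ` U)" by (intro bdd_aboveI2)
  then have "\<bar>w t x\<bar> \<le> (SUP x\<in>U. \<bar>w t x\<bar>)" using assms(2) by (rule cSUP_upper[rotated])
  also have "\<dots> = sup0"
    unfolding sup0_def by (rule solution_sup[rule_format, OF assms(1)])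
  finally show ?thesis .
qed

lemma sup0_nonneg: "sup0 \<ge> 0"
proof -
  obtain x where "x \<in> U" using U_nonempty by auto
  then show ?thesis using w_bounded[of 0 x] abs_ge_zero[of "w 0 x"] by linarith
qed

lemma w_admissible: "t \<ge> 0 \<Longrightarrow> admissible sup0 mass (w t)"
  unfolding admissible_def using w_bounded w_integrable L1_norm sup0_nonneg by auto

lemma mass_nonneg: "mass \<ge> 0"
  using admissible_m_nonneg[OF w_admissible[of 0]] by simp

lemma ln_T_continuous: "continuous_on U (\<lambda>x. ln (norm (T x)))"
  by (intro continuous_intros T_cont) (auto dest!: norm_T)

lemma ln_w_integrable: "t \<ge> 0 \<Longrightarrow> integrable mu (\<lambda>x. ln (norm (T x)) * w t x)"
  by (rule integrable_continuous_times_w[OF _ ln_T_continuous])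

lemma radial_GDERIV:
  assumes x: "x \<in> U" and f: "(f has_real_derivative f') (at (norm (T x)))"
  shows "GDERIV (\<lambda>x. f (norm (T x))) x :> cnj (deriv T x) * (of_real (f' / norm (T x)) * T x)"
proof -
  have nz: "T x \<noteq> 0" using norm_T[OF x] by auto
  have "GDERIV (\<lambda>X. f (norm X)) (T x) :> f' *\<^sub>R sgn (T x)"
    using GDERIV_DERIV_compose[OF GDERIV_norm[OF nz] f] .
  from GDERIV_compose_T[OF x this]
  show ?thesis by (rule GDERIV_subst) (simp add: sgn_div_norm scaleR_conv_of_real field_simps)
qed

text \<open>
  The total stream function: the part generated by the vorticity and the harmonic part.
\<close>
definition potential :: "real \<Rightarrow> complex \<Rightarrow> real" where
  "potential t x = stream_function U T (w t) x + \<alpha> / (2 * pi) * ln (norm (T x))"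

text \<open>
  The gradient of the total stream function; the velocity is \<open>\<i>\<close> times this field.
\<close>
definition flow :: "real \<Rightarrow> complex \<Rightarrow> complex" where
  "flow t x = stream_grad (w t) x + of_real (\<alpha> / (2 * pi)) * (cnj (deriv T x) * (of_real (1 / (norm (T x))\<^sup>2) * T x))"

lemma ln_T_GDERIV:
  assumes x: "x \<in> U"
  shows "GDERIV (\<lambda>x. ln (norm (T x))) x :> cnj (deriv T x) * (of_real (1 / (norm (T x))\<^sup>2) * T x)"
proof -
  have "norm (T x) > 0" using norm_T[OF x] by linarith
  then have "(ln has_real_derivative 1 / norm (T x)) (at (norm (T x)))"
    by (auto intro!: derivative_eq_intros)
  from radial_GDERIV[OF x this] show ?thesis by (simp add: power2_eq_square)
qed

lemma potential_GDERIV: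
  assumes "t \<ge> 0" "x \<in> U"
  shows "GDERIV (potential t) x :> flow t x"
proof -
  have 1: "GDERIV (stream_function U T (w t)) x :> stream_grad (w t) x"
    by (rule stream_GDERIV[OF w_admissible ln_w_integrable assms(2)]) (use assms in auto)
  have "GDERIV (\<lambda>x. \<alpha> / (2 * pi) * ln (norm (T x))) x :> (\<alpha> / (2 * pi)) *\<^sub>R (cnj (deriv T x) * (of_real (1 / (norm (T x))\<^sup>2) * T x))"
    using GDERIV_mult[OF GDERIV_const[of "\<alpha> / (2 * pi)"] ln_T_GDERIV[OF assms(2)]] by simp
  from GDERIV_add[OF 1 this] show ?thesis
    by (simp add: potential_def[abs_def] flow_def scaleR_conv_of_real)
qed

lemma flow_continuous:
  assumes "t \<ge> 0"
  shows "continuous_on U (flow t)"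
  unfolding flow_def[abs_def]
  by (intro continuous_intros stream_grad_continuous[OF w_admissible[OF assms]] deriv_T_cont T_cont)
     (auto dest!: norm_T)

lemma velocity_eq:
  assumes "t \<ge> 0" "x \<in> U"
  shows "velocity U T \<alpha> (w t) x = \<i> * flow t x"
proof -
  have 1: "GDERIV (stream_function U T (w t)) x :> stream_grad (w t) x"
    by (rule stream_GDERIV[OF w_admissible ln_w_integrable assms(2)]) (use assms in auto)
  show ?thesis
    unfolding velocity_def harmonic_field_def grad_eq[OF 1] grad_eq[OF ln_T_GDERIV[OF assms(2)]] perp_eq flow_def
    by (simp add: scaleR_conv_of_real distrib_left mult_ac)
qed

lemma transport:
  assumes "t > 0" "x \<in> U"
  shows "w_dt t x = - inner (\<i> * flow t x) (w_grad t x)"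
proof -
  have "deriv (\<lambda>s. \<omega> x s) t + inner (velocity U T \<alpha> (w t) x) (grad (w t) x) = 0"
    using solution_transport[rule_format, OF assms(2,1)] .
  then show ?thesis
    using DERIV_imp_deriv[OF w_DERIV_time[OF assms(2,1)]] velocity_eq[of t x] grad_eq[OF w_GDERIV[of x t]] assms
    by simp
qed

text \<open>
  The velocity is the rotated gradient of the total stream function, so that the transport term is a
  Poisson bracket, and \<open>integral_bracket_zero\<close> moves the derivative from the vorticity to the test
  function.
\<close>
lemma weak_transport:
  assumes t: "t > 0"
    and \<Phi>: "\<And>x. x \<in> U \<Longrightarrow> GDERIV \<Phi> x :> \<phi> x" "continuous_on U \<phi>"
    and K: "compact K" "K \<subseteq> U" "\<And>x. x \<in> U - K \<Longrightarrow> \<Phi> x = 0"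
  shows "(\<integral>x. \<Phi> x * w_dt t x \<partial>mu) = (\<integral>x. w t x * inner (\<i> * flow t x) (\<phi> x) \<partial>mu)"
proof -
  have t0: "t \<ge> 0" using t by simp
  have \<Phi>_cont: "continuous_on U \<Phi>"
    using \<Phi>(1) unfolding gderiv_def by (intro continuous_at_imp_continuous_on ballI has_derivative_continuous)
  define b where "b x = \<Phi> x *\<^sub>R w_grad t x + w t x *\<^sub>R \<phi> x" for x
  have "(\<integral>x. indicator U x * inner (\<i> * flow t x) (b x) \<partial>lborel) = 0"
  proof (rule integral_bracket_zero[OF open_U potential_GDERIV[OF t0] flow_continuous[OF t0] _ _ K(1,2)])
    show "GDERIV (\<lambda>x. \<Phi> x * w t x) x :> b x" if "x \<in> U" for x
      using GDERIV_mult[OF \<Phi>(1)[OF that] w_GDERIV[OF that t0]] by (simp add: b_def)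
    show "continuous_on U b"
      unfolding b_def by (intro continuous_intros \<Phi>_cont w_grad_continuous[OF t0] w_continuous[OF t0] \<Phi>(2))
  qed (use K in auto)
  then have "(\<integral>x. inner (\<i> * flow t x) (b x) \<partial>mu) = 0"
    unfolding integral_mu[symmetric] set_lebesgue_integral_def by simp
  moreover have "inner (\<i> * flow t x) (b x) = w t x * inner (\<i> * flow t x) (\<phi> x) - \<Phi> x * w_dt t x" if "x \<in> U" for x
    using transport[OF t that] by (simp add: b_def inner_add_right)
  ultimately have "(\<integral>x. w t x * inner (\<i> * flow t x) (\<phi> x) - \<Phi> x * w_dt t x \<partial>mu) = 0"
    by (metis (mono_tags, lifting) Bochner_Integration.integral_cong space_mu)
  moreover have "integrable mu (\<lambda>x. w t x * inner (\<i> * flow t x) (\<phi> x))"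
    using integrable_continuous_times_w[OF t0, of "\<lambda>x. inner (\<i> * flow t x) (\<phi> x)"]
    by (simp add: mult.commute continuous_intros flow_continuous[OF t0] \<Phi>(2))
  moreover have "integrable mu (\<lambda>x. \<Phi> x * w_dt t x)"
    by (rule integrable_compact_support_mu[OF _ K(1,2)])
       (use K(3) in \<open>auto simp: w_dt_def[abs_def] intro!: continuous_intros \<Phi>_cont slice_continuous[OF joint_D_continuous t0]\<close>)
  ultimately show ?thesis by simp
qed

lemma test_function_bound:
  assumes tt: "0 \<le> t" "t \<le> t'"
    and \<Phi>: "\<And>x. x \<in> U \<Longrightarrow> GDERIV \<Phi> x :> \<phi> x" "continuous_on U \<phi>"
    and K: "compact K" "K \<subseteq> U" "\<And>x. x \<in> U - K \<Longrightarrow> \<Phi> x = 0"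
    and B: "\<And>\<tau>. t < \<tau> \<Longrightarrow> \<tau> < t' \<Longrightarrow> \<bar>\<integral>x. w \<tau> x * inner (\<i> * flow \<tau> x) (\<phi> x) \<partial>mu\<bar> \<le> B"
  shows "\<bar>(\<integral>x. \<Phi> x * w t' x \<partial>mu) - (\<integral>x. \<Phi> x * w t x \<partial>mu)\<bar> \<le> B * (t' - t)"
proof (cases "t = t'")
  case False
  then have tt': "t < t'" using tt by simp
  define F where "F s = (\<integral>x. \<Phi> x * w s x \<partial>mu)" for s
  have \<Phi>_cont: "continuous_on U \<Phi>"
    using \<Phi>(1) unfolding gderiv_def by (intro continuous_at_imp_continuous_on ballI has_derivative_continuous)
  have \<Phi>_int: "integrable mu (\<lambda>x. \<bar>\<Phi> x\<bar>)"
    by (rule integrable_compact_support_mu[OF _ K(1,2)]) (use K(3) in \<open>auto intro!: continuous_intros \<Phi>_cont\<close>)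
  have int: "integrable mu (\<lambda>x. \<Phi> x * w s x)" if "s \<ge> 0" for s
    by (rule integrable_continuous_times_w[OF that \<Phi>_cont])
  have contF: "continuous_on {0..} F"
    unfolding continuous_on_sequentially comp_def
  proof (intro allI ballI impI)
    fix X and s :: real assume s: "s \<in> {0..}" and X: "(\<forall>n. X n \<in> {0..}) \<and> X \<longlonglongrightarrow> s"
    then have X0: "X n \<ge> 0" for n by auto
    show "(\<lambda>n. F (X n)) \<longlonglongrightarrow> F s" unfolding F_def
    proof (rule integral_dominated_convergence)
      show "integrable mu (\<lambda>x. \<bar>\<Phi> x\<bar> * sup0)" using \<Phi>_int by simp
      show "AE x in mu. (\<lambda>n. \<Phi> x * w (X n) x) \<longlonglongrightarrow> \<Phi> x * w s x"
      proof (rule AE_I2)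
        fix x assume "x \<in> space mu"
        then have "(\<lambda>n. \<omega> x (X n)) \<longlonglongrightarrow> \<omega> x s"
          using w_time_continuous[of x] s X unfolding continuous_on_sequentially comp_def by auto
        then show "(\<lambda>n. \<Phi> x * w (X n) x) \<longlonglongrightarrow> \<Phi> x * w s x" by (intro tendsto_intros)
      qed
      show "AE x in mu. norm (\<Phi> x * w (X n) x) \<le> \<bar>\<Phi> x\<bar> * sup0" for n
        by (rule AE_I2) (auto simp: abs_mult intro!: mult_left_mono w_bounded X0)
    qed (use int X0 s in auto)
  qed
  have derF: "(F has_real_derivative (\<integral>x. \<Phi> x * w_dt s x \<partial>mu)) (at s)" if s: "s > 0" for s
  proof -
    have "compact ((\<lambda>p. joint_D p (0, 1)) ` (K \<times> {s / 2 .. 2 * s}))"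
      by (intro compact_continuous_image continuous_on_subset[OF joint_D_continuous] compact_Times K(1))
         (use K(2) s in auto)
    then have "bounded ((\<lambda>p. joint_D p (0, 1)) ` (K \<times> {s / 2 .. 2 * s}))" by (rule compact_imp_bounded)
    then obtain C where "\<forall>p\<in>K \<times> {s / 2 .. 2 * s}. \<bar>joint_D p (0, 1)\<bar> \<le> C" by (auto simp: bounded_iff)
    then have C: "\<bar>w_dt r x\<bar> \<le> C" if "x \<in> K" "r \<in> {s / 2 .. 2 * s}" for x r
      using that by (simp add: w_dt_def)
    have b: "r \<in> {s / 2 .. 2 * s}" "r > 0" if "r \<in> ball s (s/2)" for r
      using that s by (auto simp: dist_real_def abs_if split: if_splits)
    show ?thesis unfolding F_def
    proof (rule has_real_derivative_integral[where f' = "\<lambda>x r. \<Phi> x * w_dt r x" and g = "\<lambda>x. \<bar>\<Phi> x\<bar> * C" and \<delta> = "s/2"])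
      show "integrable mu (\<lambda>x. \<bar>\<Phi> x\<bar> * C)" using \<Phi>_int by simp
      show "\<bar>\<Phi> x * w_dt r x\<bar> \<le> \<bar>\<Phi> x\<bar> * C" if "x \<in> space mu" "r \<in> ball s (s/2)" for x r
      proof (cases "x \<in> K")
        case True
        then show ?thesis using C[OF True b(1)[OF that(2)]] by (auto simp: abs_mult intro!: mult_left_mono)
      qed (use K(3) that in auto)
      show "((\<lambda>r. \<Phi> x * w r x) has_real_derivative \<Phi> x * w_dt r x) (at r)" if "x \<in> space mu" "r \<in> ball s (s/2)" for x r
        using w_DERIV_time[of x r] b(2)[OF that(2)] that(1) by (auto intro!: derivative_eq_intros)
    qed (use s b(2) int less_imp_le in auto)
  qed
  obtain \<xi> where \<xi>: "t < \<xi>" "\<xi> < t'" "F t' - F t = (t' - t) * (\<integral>x. \<Phi> x * w_dt \<xi> x \<partial>mu)"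
  proof -
    have "\<exists>l z. t < z \<and> z < t' \<and> (F has_real_derivative l) (at z) \<and> F t' - F t = (t' - t) * l"
    proof (rule MVT[OF tt'])
      show "continuous_on {t..t'} F" by (rule continuous_on_subset[OF contF]) (use tt in auto)
      show "F differentiable (at x)" if "t < x" "x < t'" for x
        using derF[of x] that tt real_differentiable_def by auto
    qed
    then obtain l z where "t < z" "z < t'" "(F has_real_derivative l) (at z)" "F t' - F t = (t' - t) * l" by auto
    moreover have "l = (\<integral>x. \<Phi> x * w_dt z x \<partial>mu)"
      using derF[of z] calculation tt DERIV_unique by fastforce
    ultimately show ?thesis using that by blast
  qed
  have "\<bar>F t' - F t\<bar> = (t' - t) * \<bar>\<integral>x. w \<xi> x * inner (\<i> * flow \<xi> x) (\<phi> x) \<partial>mu\<bar>"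
    using \<xi> tt weak_transport[OF _ \<Phi> K, of \<xi>] by (simp add: abs_mult)
  also have "\<dots> \<le> (t' - t) * B" using B[OF \<xi>(1,2)] tt by (intro mult_left_mono) auto
  finally show ?thesis by (simp add: F_def mult.commute)
qed simp

end

section \<open>Test functions without compact support\<close>

text \<open>
  Composing this function with itself produces transition functions that are continuously differentiable
  and constant outside a bounded interval.
\<close>
lemma DERIV_positive_part_squared: "((\<lambda>u::real. (max 0 u)\<^sup>2) has_real_derivative 2 * max 0 u) (at u)"
proof -
  consider "u > 0" | "u < 0" | "u = 0" by linarith
  then show ?thesis
  proof cases
    case 1
    have "((\<lambda>u::real. u\<^sup>2) has_real_derivative 2 * u) (at u)" by (auto intro!: derivative_eq_intros)
    then have "((\<lambda>u::real. (max 0 u)\<^sup>2) has_real_derivative 2 * u) (at u)"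
      by (rule has_field_derivative_transform_within_open[of _ _ _ "{0<..}"]) (use 1 in auto)
    then show ?thesis using 1 by simp
  next
    case 2
    have "((\<lambda>u::real. 0::real) has_real_derivative 0) (at u)" by simp
    then have "((\<lambda>u::real. (max 0 u)\<^sup>2) has_real_derivative 0) (at u)"
      by (rule has_field_derivative_transform_within_open[of _ _ _ "{..<0}"]) (use 2 in auto)
    then show ?thesis using 2 by simp
  next
    case 3
    have "((\<lambda>h::real. max 0 h) \<longlongrightarrow> max 0 0) (at 0)" by (intro tendsto_intros)
    then have "((\<lambda>h::real. max 0 h) \<longlongrightarrow> 0) (at 0)" by simp
    then have "((\<lambda>h::real. ((max 0 h)\<^sup>2 - (max 0 0)\<^sup>2) / (h - 0)) \<longlongrightarrow> 0) (at 0)"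
      by (rule Lim_transform_eventually)
         (auto simp: eventually_at_filter max_def power2_eq_square)
    then show ?thesis using 3 by (simp add: has_field_derivative_iff)
  qed
qed

text \<open>
  Rises from \<open>0\<close> to \<open>1\<close> on the unit interval with a continuous derivative between \<open>0\<close> and \<open>4\<close>.
\<close>
definition step :: "real \<Rightarrow> real" where
  "step x = (max 0 (1 - (max 0 (1 - x))\<^sup>2))\<^sup>2"

definition step_deriv :: "real \<Rightarrow> real" where
  "step_deriv x = 2 * max 0 (1 - (max 0 (1 - x))\<^sup>2) * (2 * max 0 (1 - x))"

lemma DERIV_step: "(step has_real_derivative step_deriv x) (at x)"
proof -
  have "((\<lambda>x. 1 - x) has_real_derivative -1) (at x)" by (auto intro!: derivative_eq_intros)
  from DERIV_chain2[OF DERIV_positive_part_squared this]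
  have "((\<lambda>x. (max 0 (1 - x))\<^sup>2) has_real_derivative 2 * max 0 (1 - x) * -1) (at x)" .
  from DERIV_diff[OF DERIV_const[of 1] this]
  have "((\<lambda>x. 1 - (max 0 (1 - x))\<^sup>2) has_real_derivative 2 * max 0 (1 - x)) (at x)" by simp
  from DERIV_chain2[OF DERIV_positive_part_squared this]
  show ?thesis unfolding step_def[abs_def] step_deriv_def .
qed

lemma step_ge_1: "x \<ge> 1 \<Longrightarrow> step x = 1" "x \<ge> 1 \<Longrightarrow> step_deriv x = 0"
  by (auto simp: step_def step_deriv_def)

lemma step_le_0: 
  assumes "x \<le> 0" shows "step x = 0" "step_deriv x = 0"
proof -
  have "1\<^sup>2 \<le> (max 0 (1 - x))\<^sup>2" using assms by (intro power_mono) auto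
  then have "max 0 (1 - (max 0 (1 - x))\<^sup>2) = 0" by simp
  then show "step x = 0" "step_deriv x = 0" by (simp_all add: step_def step_deriv_def)
qed

lemma step_bounds: "0 \<le> step x" "step x \<le> 1" "0 \<le> step_deriv x" "step_deriv x \<le> 4"
proof -
  show "0 \<le> step x" by (simp add: step_def)
  have 1: "0 \<le> max 0 (1 - (max 0 (1 - x))\<^sup>2)" "max 0 (1 - (max 0 (1 - x))\<^sup>2) \<le> 1" by auto
  then show "step x \<le> 1" unfolding step_def by (intro power_le_one)
  show "0 \<le> step_deriv x" by (simp add: step_deriv_def)
  show "step_deriv x \<le> 4"
  proof (cases "x \<le> 0")
    case True
    then show ?thesis using step_le_0 by simp
  next
    case False
    then have "max 0 (1 - (max 0 (1 - x))\<^sup>2) * max 0 (1 - x) \<le> 1 * 1" using 1 by (intro mult_mono) auto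
    then show ?thesis by (simp add: step_deriv_def)
  qed
qed

lemma step_continuous: "continuous_on A step" "continuous_on A step_deriv"
  unfolding step_def[abs_def] step_deriv_def[abs_def] by (intro continuous_intros)+

text \<open>
  Equal to \<open>1\<close> for \<open>1 + 2/n \<le> r \<le> n\<close> and to \<open>0\<close> for \<open>r \<le> 1 + 1/n\<close> and for \<open>r \<ge> 2n\<close>.
\<close>
definition cutoff :: "nat \<Rightarrow> real \<Rightarrow> real" where
  "cutoff n r = step (real n * (r - 1) - 1) * step (2 - r / real n)"

definition cutoff_deriv :: "nat \<Rightarrow> real \<Rightarrow> real" where
  "cutoff_deriv n r = step_deriv (real n * (r - 1) - 1) * real n * step (2 - r / real n)
     + step_deriv (2 - r / real n) * (- 1 / real n) * step (real n * (r - 1) - 1)"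

lemma DERIV_cutoff: "n \<ge> 2 \<Longrightarrow> (cutoff n has_real_derivative cutoff_deriv n r) (at r)"
proof -
  assume n: "n \<ge> 2"
  have 1: "((\<lambda>r. real n * (r - 1) - 1) has_real_derivative real n) (at r)"
    by (auto intro!: derivative_eq_intros)
  have 2: "((\<lambda>r. 2 - r / real n) has_real_derivative - 1 / real n) (at r)"
    using n by (auto intro!: derivative_eq_intros)
  from DERIV_mult[OF DERIV_chain2[OF DERIV_step 1] DERIV_chain2[OF DERIV_step 2]]
  show ?thesis unfolding cutoff_def[abs_def] cutoff_deriv_def .
qed

lemma cutoff_bounds: "0 \<le> cutoff n r" "cutoff n r \<le> 1"
  unfolding cutoff_def using step_bounds by (auto intro: mult_le_one)

lemma cutoff_eq_1: "n \<ge> 2 \<Longrightarrow> 1 + 2 / real n \<le> r \<Longrightarrow> r \<le> real n \<Longrightarrow> cutoff n r = 1"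
proof -
  assume n: "n \<ge> 2" and r: "1 + 2 / real n \<le> r" "r \<le> real n"
  have "real n * (2 / real n) \<le> real n * (r - 1)" using r n by (intro mult_left_mono) auto
  then have "real n * (r - 1) - 1 \<ge> 1" using n by simp
  moreover have "2 - r / real n \<ge> 1" using r n by (simp add: divide_le_eq)
  ultimately show ?thesis by (simp add: cutoff_def step_ge_1)
qed

lemma cutoff_eq_0:
  assumes n: "n \<ge> 2" and r: "r \<le> 1 + 1 / real n \<or> 2 * real n \<le> r"
  shows "cutoff n r = 0"
  using r
proof
  assume "r \<le> 1 + 1 / real n"
  then have "real n * (r - 1) \<le> real n * (1 / real n)" using n by (intro mult_left_mono) auto
  then have "real n * (r - 1) - 1 \<le> 0" using n by simp
  then show ?thesis by (simp add: cutoff_def step_le_0)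
next
  assume "2 * real n \<le> r"
  then have "2 - r / real n \<le> 0" using n by (simp add: le_divide_eq)
  then show ?thesis by (simp add: cutoff_def step_le_0)
qed

lemma cutoff_deriv_bound:
  assumes n: "n \<ge> 2"
  shows "\<bar>cutoff_deriv n r\<bar> \<le> (if r \<le> 1 + 2 / real n then 4 * real n else if real n \<le> r \<and> r \<le> 2 * real n then 4 / real n else 0)"
proof -
  have two: "1 + 2 / real n \<le> 2" "2 \<le> real n" using n by (auto simp: divide_le_eq)
  consider "r \<le> 1 + 2 / real n" | "r > 1 + 2 / real n" "real n \<le> r" "r \<le> 2 * real n" 
    | "r > 1 + 2 / real n" "r < real n" | "r > 2 * real n" using two by linarith
  then show ?thesis
  proof cases
    case 1
    then have "r \<le> real n" using two by linarith
    then have "2 - r / real n \<ge> 1" using two by (simp add: divide_le_eq)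
    then have "cutoff_deriv n r = step_deriv (real n * (r - 1) - 1) * real n"
      by (simp add: cutoff_deriv_def step_ge_1)
    also have "\<bar>\<dots>\<bar> \<le> 4 * real n"
      using step_bounds(3,4)[of "real n * (r - 1) - 1"] by (simp add: abs_mult mult_right_mono)
    finally show ?thesis using 1 by simp
  next
    case 2
    have "real n * (2 / real n) \<le> real n * (r - 1)" using 2 n by (intro mult_left_mono) auto
    then have "real n * (r - 1) - 1 \<ge> 1" using n by simp
    then have "cutoff_deriv n r = step_deriv (2 - r / real n) * (- 1 / real n)"
      by (simp add: cutoff_deriv_def step_ge_1)
    then have "\<bar>cutoff_deriv n r\<bar> = step_deriv (2 - r / real n) / real n"
      using step_bounds(3)[of "2 - r / real n"] by (simp add: abs_mult)
    also have "\<dots> \<le> 4 / real n" using step_bounds(4) by (intro divide_right_mono) auto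
    finally show ?thesis using 2 by simp
  next
    case 3
    have "real n * (2 / real n) \<le> real n * (r - 1)" using 3 n by (intro mult_left_mono) auto
    then have "real n * (r - 1) - 1 \<ge> 1" using n by simp
    moreover have "2 - r / real n \<ge> 1" using 3 n by (simp add: divide_le_eq)
    ultimately show ?thesis using 3 by (simp add: cutoff_deriv_def step_ge_1)
  next
    case 4
    have "2 - r / real n \<le> 0" using 4 n by (simp add: le_divide_eq)
    then show ?thesis using 4 two by (simp add: cutoff_deriv_def step_le_0)
  qed
qed

lemma cutoff_continuous: "n \<ge> 2 \<Longrightarrow> continuous_on A (cutoff n)" "n \<ge> 2 \<Longrightarrow> continuous_on A (cutoff_deriv n)"
  unfolding cutoff_def[abs_def] cutoff_deriv_def[abs_def]
  by (intro continuous_intros continuous_on_compose2[OF step_continuous(1)[of UNIV]]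
      continuous_on_compose2[OF step_continuous(2)[of UNIV]]; simp)+

lemma inner_mult_same: "inner (c * a) (c * b) = (norm c)\<^sup>2 * inner a (b :: complex)"
proof -
  have "c * a * cnj (c * b) = (norm c)\<^sup>2 *\<^sub>R (a * cnj b)"
    unfolding scaleR_conv_of_real complex_norm_square by (simp add: mult_ac)
  then show ?thesis by (simp only: inner_complex_Re scaleR_complex.sel)
qed

context exterior_domain
begin

text \<open>
  Up to the factor \<open>lam / (2\<pi> |T|)\<close> this is the rate of change of \<open>|T|\<close> along the flow generated by \<open>w\<close>
  (\<open>radial_flux\<close>).
\<close>
definition circ :: "(complex \<Rightarrow> real) \<Rightarrow> complex \<Rightarrow> real" where
  "circ w x = (\<integral>y. swirl (T x) (T y) * w y \<partial>mu)"

lemma swirl_measurable [measurable]: "(\<lambda>y. swirl X (T y)) \<in> borel_measurable mu"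
  unfolding swirl_def wall_def by measurable

lemma circ_eq:
  assumes w: "admissible M m w" and x: "x \<in> U"
  shows "inner (\<i> * (\<integral>y. w y *\<^sub>R green_grad (T x) (T y) \<partial>mu)) (T x) = circ w x"
proof -
  have [measurable]: "w \<in> borel_measurable mu" using w by (auto simp: admissible_def)
  note int = green_grad_integrable(1)[OF w x]
  have "inner (\<i> * (\<integral>y. w y *\<^sub>R green_grad (T x) (T y) \<partial>mu)) (T x)
     = inner (\<integral>y. \<i> * (w y *\<^sub>R green_grad (T x) (T y)) \<partial>mu) (T x)"
    by (simp only: integral_mult_right_zero)
  also have "\<dots> = (\<integral>y. inner (\<i> * (w y *\<^sub>R green_grad (T x) (T y))) (T x) \<partial>mu)"
    by (rule integral_inner_left[symmetric]) (rule integrable_mult_right, rule int)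
  also have "\<dots> = circ w x" unfolding circ_def
  proof (rule integral_cong_AE)
    show "AE y in mu. inner (\<i> * (w y *\<^sub>R green_grad (T x) (T y))) (T x) = swirl (T x) (T y) * w y"
      using AE_mu_neq[of x] AE_mu_in
    proof eventually_elim
      case (elim y)
      have "inner (\<i> * green_grad (T x) (T y)) (T x) = swirl (T x) (T y)"
        using elim x T_eq_iff by (intro swirl_eq norm_T) auto
      moreover have "inner (\<i> * (w y *\<^sub>R green_grad (T x) (T y))) (T x) = w y * inner (\<i> * green_grad (T x) (T y)) (T x)"
        by (simp flip: inner_scaleR_left)
      ultimately show ?case by simp
    qed
  qed measurable
  finally show ?thesis .
qed

lemma circ_bound:
  assumes w: "admissible M m w" and x: "x \<in> U"
  shows "\<bar>circ w x\<bar> \<le> norm (T x) * (near_const * (M + m))"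
proof -
  have [measurable]: "w \<in> borel_measurable mu" using w by (auto simp: admissible_def)
  have "norm (circ w x) \<le> norm (T x) * (near_const * (M + m))" unfolding circ_def
  proof (rule integrable_near_dominated(2)[OF w x])
    fix y assume y: "y \<in> U" "y \<noteq> x"
    have XY: "norm (T x) > 1" "norm (T y) > 1" "T x \<noteq> T y" using y x norm_T T_eq_iff by auto
    have "\<bar>swirl (T x) (T y)\<bar> \<le> norm (T x) * (1 / norm (T x - T y))" using swirl_le[OF XY] by simp
    also have "\<dots> \<le> norm (T x) * near x y" unfolding near_def
      using inverse_le_sing[of "norm (T x - T y)"] XY by (intro mult_left_mono) auto
    finally have "\<bar>swirl (T x) (T y)\<bar> * \<bar>w y\<bar> \<le> norm (T x) * near x y * \<bar>w y\<bar>" by (intro mult_right_mono) auto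
    then show "norm (swirl (T x) (T y) * w y) \<le> norm (T x) * (near x y * \<bar>w y\<bar>)" by (simp add: abs_mult mult.assoc)
  qed auto
  then show ?thesis by simp
qed

lemma circ_near_boundary:
  assumes w: "admissible M m w" and x: "x \<in> U" "norm (T x) \<le> 2"
  shows "\<bar>circ w x\<bar> \<le> 54 * sqrt (sqrt ((norm (T x))\<^sup>2 - 1)) * (near_const * (M + m))"
proof -
  have [measurable]: "w \<in> borel_measurable mu" using w by (auto simp: admissible_def)
  have "norm (circ w x) \<le> 54 * sqrt (sqrt ((norm (T x))\<^sup>2 - 1)) * (near_const * (M + m))" unfolding circ_def
  proof (rule integrable_near_dominated(2)[OF w x(1)])
    fix y assume y: "y \<in> U" "y \<noteq> x"
    have XY: "norm (T x) > 1" "norm (T y) > 1" "T x \<noteq> T y" using y x norm_T T_eq_iff by auto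
    have "\<bar>swirl (T x) (T y)\<bar> \<le> 54 * sqrt (sqrt ((norm (T x))\<^sup>2 - 1)) * near x y"
      using swirl_near_circle[OF XY x(2)] by (simp add: near_def)
    then have "\<bar>swirl (T x) (T y)\<bar> * \<bar>w y\<bar> \<le> 54 * sqrt (sqrt ((norm (T x))\<^sup>2 - 1)) * near x y * \<bar>w y\<bar>"
      by (intro mult_right_mono) auto
    then show "norm (swirl (T x) (T y) * w y) \<le> 54 * sqrt (sqrt ((norm (T x))\<^sup>2 - 1)) * (near x y * \<bar>w y\<bar>)"
      by (simp add: abs_mult mult.assoc)
  next
    have "1 \<le> (norm (T x))\<^sup>2" using norm_T[OF x(1)] by simp
    then show "0 \<le> 54 * sqrt (sqrt ((norm (T x))\<^sup>2 - 1))" by simp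
  qed auto
  then show ?thesis by simp
qed

end

context euler_solution
begin

text \<open>
  The bound, uniform in space and time, of the integral of \<open>near x\<close> against the vorticity.
\<close>
definition Q :: real where "Q = near_const * (sup0 + mass)"

lemma Q_nonneg: "Q \<ge> 0"
  using near_const(1) sup0_nonneg mass_nonneg by (simp add: Q_def)

text \<open>
  For a radial function of \<open>T\<close> with gradient \<open>cnj (deriv T x) * (p * T x)\<close> the harmonic field drops out,
  because it is orthogonal to \<open>T\<close> in the image plane.
\<close>
lemma radial_flux:
  assumes "t \<ge> 0" "x \<in> U"
  shows "inner (\<i> * flow t x) (cnj (deriv T x) * (of_real p * T x)) = p * lam x / (2 * pi) * circ (w t) x"
proof -
  define I where "I = (\<integral>y. w t y *\<^sub>R green_grad (T x) (T y) \<partial>mu)"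
  define c where "c = \<alpha> / (2 * pi) * (1 / (norm (T x))\<^sup>2)"
  have "\<i> * flow t x = cnj (deriv T x) * ((1 / (2 * pi)) *\<^sub>R (\<i> * I) + c *\<^sub>R (\<i> * T x))"
    by (simp add: flow_def stream_grad_def I_def c_def scaleR_conv_of_real algebra_simps)
  then have "inner (\<i> * flow t x) (cnj (deriv T x) * (of_real p * T x))
     = lam x * inner ((1 / (2 * pi)) *\<^sub>R (\<i> * I) + c *\<^sub>R (\<i> * T x)) (p *\<^sub>R T x)"
    by (simp only: inner_mult_same lam_def complex_mod_cnj scaleR_conv_of_real)
  also have "inner ((1 / (2 * pi)) *\<^sub>R (\<i> * I) + c *\<^sub>R (\<i> * T x)) (p *\<^sub>R T x)
     = p / (2 * pi) * inner (\<i> * I) (T x) + c * p * inner (\<i> * T x) (T x)"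
    by (simp add: inner_add_left algebra_simps)
  also have "inner (\<i> * T x) (T x) = 0" by (simp add: inner_complex_def)
  also have "inner (\<i> * I) (T x) = circ (w t) x"
    unfolding I_def by (rule circ_eq[OF w_admissible[OF assms(1)] assms(2)])
  finally show ?thesis by (simp add: mult_ac)
qed

text \<open>
  In the boundary layer of width \<open>2/n\<close> the derivative of the cutoff is of order \<open>n\<close>, the radial speed
  of order \<open>n^(-1/4)\<close> and the area of order \<open>1/n\<close>. Near infinity the derivative of the cutoff is of order
  \<open>1/n\<close>, the radial speed is bounded and the test function grows logarithmically.
\<close>
lemma cutoff_flux_vanishes:
  assumes A: "A \<ge> 0" and \<Phi>_cont: "continuous_on U \<Phi>" 
    and \<Phi>: "\<And>x. x \<in> U \<Longrightarrow> \<bar>\<Phi> x\<bar> \<le> A * (1 + ln (norm (T x)))"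
  shows "\<exists>e. e \<longlonglongrightarrow> 0 \<and> (\<forall>n\<ge>2. \<forall>t\<ge>0.
     \<bar>\<integral>x. w t x * (\<Phi> x * (cutoff_deriv n (norm (T x)) / norm (T x) * lam x / (2 * pi) * circ (w t) x)) \<partial>mu\<bar> \<le> e n)"
proof -
  obtain CT where CT: "CT \<ge> 1" "\<And>x. x \<in> U \<Longrightarrow> norm (deriv T x) \<le> CT"
    using deriv_T_bounded by auto
  have lam: "0 \<le> lam x" "lam x / (2 * pi) \<le> CT\<^sup>2" if "x \<in> U" for x
  proof -
    show 0: "0 \<le> lam x" by (simp add: lam_def)
    have "lam x \<le> CT\<^sup>2" unfolding lam_def using CT(2)[OF that] by (intro power_mono) auto
    moreover have "lam x * 1 \<le> lam x * (2 * pi)" using 0 pi_ge_two by (intro mult_left_mono) auto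
    ultimately show "lam x / (2 * pi) \<le> CT\<^sup>2" by (simp add: divide_le_eq) (smt (verit) pi_gt_zero mult_right_mono mult.commute pi_ge_two zero_le_power2)
  qed
  obtain Ca where Ca: "Ca \<ge> 0" "\<And>e. 0 < e \<Longrightarrow> e \<le> 1 \<Longrightarrow> emeasure lborel {x\<in>U. norm (T x) \<le> 1 + e} \<le> ennreal (Ca * e)"
    using area_boundary_layer by auto
  define c1 where "c1 n = sup0 * (2 * A) * (4 * real n) * CT\<^sup>2 * (54 * sqrt (sqrt (6 / real n)) * Q)" for n
  define c2 where "c2 n = A * (1 + ln (2 * real n)) * (4 / real n) * CT\<^sup>2 * Q" for n
  define e where "e n = c1 n * (Ca * (2 / real n)) + c2 n * mass" for n
  have "e \<longlonglongrightarrow> 0"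
  proof -
    have lim6: "(\<lambda>n. 6 / real n) \<longlonglongrightarrow> 0" by real_asymp
    have limln: "(\<lambda>n. (1 + ln (2 * real n)) / real n) \<longlonglongrightarrow> 0" by real_asymp
    have "(\<lambda>n. (16 * 54 * sup0 * A * CT\<^sup>2 * Q * Ca) * sqrt (sqrt (6 / real n))
        + (4 * A * CT\<^sup>2 * Q * mass) * ((1 + ln (2 * real n)) / real n)) \<longlonglongrightarrow> 
        (16 * 54 * sup0 * A * CT\<^sup>2 * Q * Ca) * sqrt (sqrt 0) + (4 * A * CT\<^sup>2 * Q * mass) * 0"
      by (intro tendsto_add tendsto_mult tendsto_const tendsto_real_sqrt lim6 limln)
    moreover have "\<forall>\<^sub>F n in sequentially. (16 * 54 * sup0 * A * CT\<^sup>2 * Q * Ca) * sqrt (sqrt (6 / real n))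
        + (4 * A * CT\<^sup>2 * Q * mass) * ((1 + ln (2 * real n)) / real n) = e n"
      using eventually_gt_at_top[of 0] by eventually_elim (simp add: e_def c1_def c2_def)
    ultimately show ?thesis by (simp add: tendsto_cong)
  qed
  moreover have "\<bar>\<integral>x. w t x * (\<Phi> x * (cutoff_deriv n (norm (T x)) / norm (T x) * lam x / (2 * pi) * circ (w t) x)) \<partial>mu\<bar> \<le> e n"
    if n: "n \<ge> 2" and t: "t \<ge> 0" for n t
  proof -
    define L where "L = {x\<in>U. norm (T x) \<le> 1 + 2 / real n}"
    define f where "f x = w t x * (\<Phi> x * (cutoff_deriv n (norm (T x)) / norm (T x) * lam x / (2 * pi) * circ (w t) x))" for x
    define g where "g x = c1 n * indicator L x + c2 n * \<bar>w t x\<bar>" for x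
    note adm = w_admissible[OF t]
    have n2: "0 < 2 / real n" "2 / real n \<le> 1" using n by (auto simp: divide_le_eq)
    have L_sets: "L \<in> sets mu" unfolding L_def mu_def using layer_sets[of "1 + 2 / real n"]
      by (auto simp: sets_restrict_space_iff U_sets)
    have L_emeas: "emeasure mu L \<le> ennreal (Ca * (2 / real n))"
      unfolding mu_def using Ca(2)[OF n2] U_sets
      by (subst emeasure_restrict_space) (auto simp: L_def)
    then have L_fin: "emeasure mu L < \<infinity>" by (auto simp: less_top[symmetric] top_unique)
    have L_meas: "measure mu L \<le> Ca * (2 / real n)"
      using L_emeas Ca(1) n2 by (simp add: measure_def enn2real_leI)
    have int_g: "integrable mu g"
      unfolding g_def using w_integrable[OF t] L_sets L_fin by auto
    have c1_nn: "0 \<le> c1 n" and c2_nn: "0 \<le> c2 n"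
    proof -
      have "ln (2 * real n) \<ge> 0" using n by (intro ln_ge_zero) auto
      then show "0 \<le> c2 n" unfolding c2_def using A Q_nonneg by auto
      show "0 \<le> c1 n" unfolding c1_def using A Q_nonneg sup0_nonneg by auto
    qed
    have pw: "norm (f x) \<le> g x" if x: "x \<in> U" for x
    proof -
      define r where "r = norm (T x)"
      have r: "r > 1" using norm_T[OF x] by (simp add: r_def)
      note l = lam[OF x]
      have fx: "norm (f x) = \<bar>w t x\<bar> * \<bar>\<Phi> x\<bar> * (\<bar>cutoff_deriv n r\<bar> * (lam x / (2 * pi)) * (\<bar>circ (w t) x\<bar> / r))"
        unfolding f_def r_def[symmetric] using r l by (simp add: abs_mult mult_ac)
      consider "r \<le> 1 + 2 / real n" | "r > 1 + 2 / real n" "real n \<le> r \<and> r \<le> 2 * real n"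
        | "cutoff_deriv n r = 0" using cutoff_deriv_bound[OF n, of r] by (fastforce split: if_splits)
      then show ?thesis
      proof cases
        case 1
        have r2: "r \<le> 2" using 1 n2 by linarith
        have circ: "\<bar>circ (w t) x\<bar> / r \<le> 54 * sqrt (sqrt (6 / real n)) * Q"
        proof -
          have parts: "r - 1 \<le> 2 / real n" "r + 1 \<le> 3" "0 \<le> 2 / real n" "0 \<le> r + 1"
            using 1 r r2 n2 by linarith+
          have "r\<^sup>2 - 1 = (r - 1) * (r + 1)" by (simp add: power2_eq_square algebra_simps)
          also have "\<dots> \<le> (2 / real n) * 3" by (rule mult_mono[OF parts])
          finally have "sqrt (sqrt (r\<^sup>2 - 1)) \<le> sqrt (sqrt (6 / real n))" by simp
          moreover have "\<bar>circ (w t) x\<bar> \<le> 54 * sqrt (sqrt (r\<^sup>2 - 1)) * Q"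
            using circ_near_boundary[OF adm x] r2 unfolding r_def Q_def by simp
          ultimately have "\<bar>circ (w t) x\<bar> \<le> 54 * sqrt (sqrt (6 / real n)) * Q"
            using Q_nonneg by (meson mult_left_mono mult_right_mono order_trans zero_le_numeral)
          moreover have "\<bar>circ (w t) x\<bar> / r \<le> \<bar>circ (w t) x\<bar> / 1" using r by (intro divide_left_mono) auto
          ultimately show ?thesis by simp
        qed
        have ln: "ln r \<le> 1" using r r2 ln_le_minus_one[of r] by simp
        have "\<bar>\<Phi> x\<bar> \<le> A * (1 + ln r)" using \<Phi>[OF x] by (simp add: r_def)
        also have "\<dots> \<le> A * 2" using A ln by (intro mult_left_mono) auto
        finally have \<Phi>x: "\<bar>\<Phi> x\<bar> \<le> 2 * A" by simp
        have cd: "\<bar>cutoff_deriv n r\<bar> \<le> 4 * real n" using cutoff_deriv_bound[OF n, of r] 1 by simp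
        have "norm (f x) \<le> sup0 * (2 * A) * (4 * real n * CT\<^sup>2 * (54 * sqrt (sqrt (6 / real n)) * Q))"
          unfolding fx using A l Q_nonneg sup0_nonneg r
          by (intro mult_mono w_bounded t x \<Phi>x cd l circ) auto
        also have "\<dots> = c1 n * indicator L x" using x 1 by (simp add: c1_def L_def r_def)
        also have "\<dots> \<le> g x" using c2_nn by (simp add: g_def)
        finally show ?thesis .
      next
        case 2
        have "\<bar>\<Phi> x\<bar> \<le> A * (1 + ln r)" using \<Phi>[OF x] by (simp add: r_def)
        also have "\<dots> \<le> A * (1 + ln (2 * real n))" using A 2 r by (intro mult_left_mono add_left_mono ln_mono) auto
        finally have \<Phi>x: "\<bar>\<Phi> x\<bar> \<le> A * (1 + ln (2 * real n))" .
        have cd: "\<bar>cutoff_deriv n r\<bar> \<le> 4 / real n" using cutoff_deriv_bound[OF n, of r] 2 by simp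
        have circ: "\<bar>circ (w t) x\<bar> / r \<le> Q"
          using circ_bound[OF adm x] r unfolding Q_def r_def by (auto simp: divide_le_eq mult.commute)
        have ln2: "0 \<le> A * (1 + ln (2 * real n))" using A n by (intro mult_nonneg_nonneg add_nonneg_nonneg ln_ge_zero) auto
        have "norm (f x) \<le> \<bar>w t x\<bar> * (A * (1 + ln (2 * real n))) * (4 / real n * CT\<^sup>2 * Q)"
          unfolding fx using A l Q_nonneg r ln2
          by (intro mult_mono \<Phi>x cd l circ) auto
        also have "\<dots> = c2 n * \<bar>w t x\<bar>" by (simp add: c2_def)
        also have "\<dots> \<le> g x" using c1_nn by (simp add: g_def)
        finally show ?thesis .
      next
        case 3
        then have "norm (f x) = 0" unfolding fx by simp
        also have "\<dots> \<le> g x" using c1_nn c2_nn by (simp add: g_def)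
        finally show ?thesis .
      qed
    qed
    (* a nonexistent integral is 0 by convention, which satisfies the bound as well *)
    show ?thesis
    proof (cases "integrable mu f")
      case True
      have "norm (integral\<^sup>L mu f) \<le> integral\<^sup>L mu g"
        by (rule norm_integral_le_integral[OF True int_g]) (use pw in auto)
      also have "\<dots> = c1 n * measure mu L + c2 n * mass"
        unfolding g_def using w_integrable[OF t] L_sets L_fin Int_absorb2[of L U] by (auto simp: L1_norm[OF t] L_def)
      also have "\<dots> \<le> e n" unfolding e_def using L_meas c1_nn by (intro add_right_mono mult_left_mono) auto
      finally show ?thesis by (simp add: f_def[abs_def])
    next
      case False
      have "0 \<le> e n" unfolding e_def using c1_nn c2_nn Ca(1) mass_nonneg by auto
      then show ?thesis using not_integrable_integral_eq[OF False] by (simp add: f_def[abs_def])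
    qed
  qed
  ultimately show ?thesis by blast
qed

text \<open>
  For a test function of logarithmic growth the cutoffs change the rate of change only by an error that
  vanishes uniformly in time. They disappear from the two integrals at the end points for large \<open>n\<close>,
  since the vorticity has compact support at each of the two times.
\<close>
lemma evolution_bound:
  assumes tt: "0 \<le> t" "t \<le> t'"
    and \<Phi>: "\<And>x. x \<in> U \<Longrightarrow> GDERIV \<Phi> x :> \<phi> x" "continuous_on U \<phi>"
    and A: "\<And>x. x \<in> U \<Longrightarrow> \<bar>\<Phi> x\<bar> \<le> A * (1 + ln (norm (T x)))"
    and B: "\<And>n \<tau>. n \<ge> n0 \<Longrightarrow> t < \<tau> \<Longrightarrow> \<tau> < t' \<Longrightarrow>
       \<bar>\<integral>x. cutoff n (norm (T x)) * (w \<tau> x * inner (\<i> * flow \<tau> x) (\<phi> x)) \<partial>mu\<bar> \<le> B"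
  shows "\<bar>(\<integral>x. \<Phi> x * w t' x \<partial>mu) - (\<integral>x. \<Phi> x * w t x \<partial>mu)\<bar> \<le> B * (t' - t)"
proof -
  have \<Phi>_cont: "continuous_on U \<Phi>"
    using \<Phi>(1) unfolding gderiv_def by (intro continuous_at_imp_continuous_on ballI has_derivative_continuous)
  have A0: "A \<ge> 0"
  proof -
    have 2: "S 2 \<in> U" "norm (T (S 2)) = 2" using S_mem[of 2] T_S[of 2] by auto
    have "0 \<le> A * (1 + ln (norm (T (S 2))))" using A[OF 2(1)] abs_ge_zero[of "\<Phi> (S 2)"] by linarith
    then have "0 \<le> A * (1 + ln 2)" unfolding 2(2) .
    moreover have "1 + ln (2::real) > 0" using ln_gt_zero[of "2::real"] by linarith
    ultimately show ?thesis by (simp add: zero_le_mult_iff)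
  qed
  obtain e where e: "e \<longlonglongrightarrow> 0" "\<And>n t. n \<ge> 2 \<Longrightarrow> t \<ge> 0 \<Longrightarrow>
     \<bar>\<integral>x. w t x * (\<Phi> x * (cutoff_deriv n (norm (T x)) / norm (T x) * lam x / (2 * pi) * circ (w t) x)) \<partial>mu\<bar> \<le> e n"
    using cutoff_flux_vanishes[OF A0 \<Phi>_cont A] by blast
  define chi where "chi n x = cutoff n (norm (T x))" for n x
  define chi_grad where "chi_grad n x = cnj (deriv T x) * (of_real (cutoff_deriv n (norm (T x)) / norm (T x)) * T x)" for n x
  have chi: "GDERIV (chi n) x :> chi_grad n x" if "n \<ge> 2" "x \<in> U" for n x
    unfolding chi_def chi_grad_def by (rule radial_GDERIV[OF that(2) DERIV_cutoff[OF that(1)]])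
  have chi_grad_cont: "continuous_on U (chi_grad n)" if "n \<ge> 2" for n
    unfolding chi_grad_def[abs_def]
    by (intro continuous_intros deriv_T_cont T_cont continuous_on_compose2[OF cutoff_continuous(2)[OF that, of UNIV]])
       (auto dest!: norm_T)
  have chi_cont: "continuous_on U (chi n)" if "n \<ge> 2" for n
    unfolding chi_def[abs_def]
    by (intro continuous_intros T_cont continuous_on_compose2[OF cutoff_continuous(1)[OF that, of UNIV]]) auto
  define F where "F n s = (\<integral>x. chi n x * \<Phi> x * w s x \<partial>mu)" for n s
  have bound: "\<bar>F n t' - F n t\<bar> \<le> (B + e n) * (t' - t)" if n: "n \<ge> max 2 n0" for n
  proof -
    have n2: "n \<ge> 2" and nn0: "n \<ge> n0" using n by auto
    define K where "K = {x\<in>U. 1 + 1 / real n \<le> norm (T x) \<and> norm (T x) \<le> 2 * real n}"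
    have K: "compact K" "K \<subseteq> U" unfolding K_def using n2 by (auto intro!: compact_annulus)
    show ?thesis unfolding F_def
    proof (rule test_function_bound[OF tt _ _ K])
      show "GDERIV (\<lambda>x. chi n x * \<Phi> x) x :> (chi n x *\<^sub>R \<phi> x + \<Phi> x *\<^sub>R chi_grad n x)" if "x \<in> U" for x
        using GDERIV_mult[OF chi[OF n2 that] \<Phi>(1)[OF that]] .
      show "continuous_on U (\<lambda>x. chi n x *\<^sub>R \<phi> x + \<Phi> x *\<^sub>R chi_grad n x)"
        by (intro continuous_intros chi_cont[OF n2] chi_grad_cont[OF n2] \<Phi>_cont \<Phi>(2))
      show "chi n x * \<Phi> x = 0" if "x \<in> U - K" for x
      proof -
        have "norm (T x) \<le> 1 + 1 / real n \<or> 2 * real n \<le> norm (T x)" using that by (auto simp: K_def)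
        then show ?thesis unfolding chi_def using cutoff_eq_0[OF n2] by simp
      qed
      fix \<tau> assume \<tau>: "t < \<tau>" "\<tau> < t'"
      then have \<tau>0: "\<tau> \<ge> 0" using tt by simp
      have flux: "inner (\<i> * flow \<tau> x) (chi_grad n x) = cutoff_deriv n (norm (T x)) / norm (T x) * lam x / (2 * pi) * circ (w \<tau>) x"
        if "x \<in> U" for x
        unfolding chi_grad_def by (rule radial_flux[OF \<tau>0 that])
      have i1: "integrable mu (\<lambda>x. chi n x * inner (\<i> * flow \<tau> x) (\<phi> x) * w \<tau> x)"
        by (rule integrable_continuous_times_w[OF \<tau>0]) (intro continuous_intros chi_cont[OF n2] flow_continuous[OF \<tau>0] \<Phi>(2))
      have i2: "integrable mu (\<lambda>x. \<Phi> x * inner (\<i> * flow \<tau> x) (chi_grad n x) * w \<tau> x)"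
        by (rule integrable_continuous_times_w[OF \<tau>0])
           (intro continuous_intros chi_grad_cont[OF n2] flow_continuous[OF \<tau>0] \<Phi>_cont)
      have "(\<integral>x. w \<tau> x * inner (\<i> * flow \<tau> x) (chi n x *\<^sub>R \<phi> x + \<Phi> x *\<^sub>R chi_grad n x) \<partial>mu)
         = (\<integral>x. chi n x * inner (\<i> * flow \<tau> x) (\<phi> x) * w \<tau> x + \<Phi> x * inner (\<i> * flow \<tau> x) (chi_grad n x) * w \<tau> x \<partial>mu)"
        by (intro Bochner_Integration.integral_cong) (auto simp: inner_add_right algebra_simps)
      also have "\<dots> = (\<integral>x. chi n x * inner (\<i> * flow \<tau> x) (\<phi> x) * w \<tau> x \<partial>mu) 
          + (\<integral>x. \<Phi> x * inner (\<i> * flow \<tau> x) (chi_grad n x) * w \<tau> x \<partial>mu)"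
        by (rule Bochner_Integration.integral_add[OF i1 i2])
      also have "(\<integral>x. chi n x * inner (\<i> * flow \<tau> x) (\<phi> x) * w \<tau> x \<partial>mu)
          = (\<integral>x. cutoff n (norm (T x)) * (w \<tau> x * inner (\<i> * flow \<tau> x) (\<phi> x)) \<partial>mu)"
        by (simp add: chi_def mult_ac)
      also have "(\<integral>x. \<Phi> x * inner (\<i> * flow \<tau> x) (chi_grad n x) * w \<tau> x \<partial>mu)
          = (\<integral>x. w \<tau> x * (\<Phi> x * (cutoff_deriv n (norm (T x)) / norm (T x) * lam x / (2 * pi) * circ (w \<tau>) x)) \<partial>mu)"
        by (intro Bochner_Integration.integral_cong) (auto simp: flux)
      finally show "\<bar>\<integral>x. w \<tau> x * inner (\<i> * flow \<tau> x) (chi n x *\<^sub>R \<phi> x + \<Phi> x *\<^sub>R chi_grad n x) \<partial>mu\<bar> \<le> B + e n"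
        using B[OF nn0 \<tau>] e(2)[OF n2 \<tau>0] by linarith
    qed
  qed
  have F_eq: "\<forall>\<^sub>F n in sequentially. F n s = (\<integral>x. \<Phi> x * w s x \<partial>mu)" if s: "s \<ge> 0" for s
  proof -
    obtain K where K: "compact K" "K \<subseteq> U" "\<And>x. x \<in> U - K \<Longrightarrow> w s x = 0" using w_support[OF s] by blast
    have cont: "continuous_on K (\<lambda>x. norm (T x))" by (intro continuous_intros continuous_on_subset[OF T_cont K(2)])
    have "\<exists>a b. a > 1 \<and> (\<forall>x\<in>K. a \<le> norm (T x) \<and> norm (T x) \<le> b)"
    proof (cases "K = {}")
      case False
      obtain x where x: "x \<in> K" "\<forall>y\<in>K. norm (T x) \<le> norm (T y)"
        using continuous_attains_inf[OF K(1) False cont] by blast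
      obtain z where z: "z \<in> K" "\<forall>y\<in>K. norm (T y) \<le> norm (T z)"
        using continuous_attains_sup[OF K(1) False cont] by blast
      show ?thesis using x z norm_T K(2) by (intro exI[of _ "norm (T x)"] exI[of _ "norm (T z)"]) auto
    qed (auto intro: exI[of _ 2])
    then obtain a b where ab: "a > 1" "\<And>x. x \<in> K \<Longrightarrow> a \<le> norm (T x)" "\<And>x. x \<in> K \<Longrightarrow> norm (T x) \<le> b" by blast
    have "\<forall>\<^sub>F n in sequentially. 1 + 2 / real n \<le> a \<and> b \<le> real n \<and> n \<ge> 2"
    proof (intro eventually_conj eventually_ge_at_top)
      have "(\<lambda>n. 1 + 2 / real n) \<longlonglongrightarrow> 1" by real_asymp
      then show "\<forall>\<^sub>F n in sequentially. 1 + 2 / real n \<le> a"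
        using ab(1) by (auto dest!: order_tendstoD(2)[of _ _ _ a] elim!: eventually_mono)
      show "\<forall>\<^sub>F n in sequentially. b \<le> real n"
        using eventually_ge_at_top[of "nat \<lceil>b\<rceil>"] by eventually_elim linarith
    qed
    then show ?thesis
    proof eventually_elim
      case (elim n)
      have "chi n x * \<Phi> x * w s x = \<Phi> x * w s x" if "x \<in> U" for x
      proof (cases "x \<in> K")
        case True
        then have "chi n x = 1" unfolding chi_def using elim ab(2,3)[OF True] by (intro cutoff_eq_1) linarith+
        then show ?thesis by simp
      qed (use K(3) that in simp)
      then show ?case unfolding F_def by (intro Bochner_Integration.integral_cong) auto
    qed
  qed
  have lim: "(\<lambda>n. \<bar>F n t' - F n t\<bar>) \<longlonglongrightarrow> \<bar>(\<integral>x. \<Phi> x * w t' x \<partial>mu) - (\<integral>x. \<Phi> x * w t x \<partial>mu)\<bar>"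
    by (intro tendsto_intros tendsto_eventually F_eq) (use tt in auto)
  have lim2: "(\<lambda>n. (B + e n) * (t' - t)) \<longlonglongrightarrow> (B + 0) * (t' - t)"
    by (intro tendsto_intros e(1))
  have "\<bar>(\<integral>x. \<Phi> x * w t' x \<partial>mu) - (\<integral>x. \<Phi> x * w t x \<partial>mu)\<bar> \<le> (B + 0) * (t' - t)"
    by (rule tendsto_le[OF _ lim2 lim]) (use bound in \<open>auto simp: eventually_sequentially intro!: exI[of _ "max 2 n0"]\<close>)
  then show ?thesis by simp
qed

lemma mass_conserved:
  assumes t: "t \<ge> 0"
  shows "(\<integral>x. w t x \<partial>mu) = mass"
proof -
  have "\<bar>(\<integral>x. 1 * w t x \<partial>mu) - (\<integral>x. 1 * w 0 x \<partial>mu)\<bar> \<le> 0 * (t - 0)"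
  proof (rule evolution_bound[where A = 1 and \<phi> = "\<lambda>_. 0" and ?n0.0 = 0])
    show "GDERIV (\<lambda>x. 1) x :> (0::complex)" for x :: complex by (rule GDERIV_const)
    show "\<bar>1\<bar> \<le> 1 * (1 + ln (norm (T x)))" if "x \<in> U" for x using norm_T[OF that] by simp
  qed (use t in auto)
  then have "(\<integral>x. w t x \<partial>mu) = (\<integral>x. w 0 x \<partial>mu)" by simp
  also have "\<dots> = mass" unfolding mass_def
    by (intro Bochner_Integration.integral_cong) (auto simp: w_initial)
  finally show ?thesis .
qed

text \<open>
  The integrals of \<open>\<omega>\<close> and of \<open>|\<omega>|\<close> are both conserved and agree initially.
\<close>
lemma w_nonneg_AE:
  assumes t: "t \<ge> 0"
  shows "AE x in mu. w t x \<ge> 0"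
proof -
  have "(\<integral>x. \<bar>w t x\<bar> - w t x \<partial>mu) = 0"
    using w_integrable[OF t] L1_norm[OF t] mass_conserved[OF t] by simp
  moreover have "integrable mu (\<lambda>x. \<bar>w t x\<bar> - w t x)" using w_integrable[OF t] by auto
  ultimately have "AE x in mu. \<bar>w t x\<bar> - w t x = 0"
    by (subst integral_nonneg_eq_0_iff_AE[symmetric]) auto
  then show ?thesis by eventually_elim linarith
qed

end

section \<open>Conservation of energy\<close>

context euler_solution
begin

lemma near_commute: "near x y = near y x"
  by (simp add: near_def norm_minus_commute)

lemma near_pair_measurable [measurable]: "(\<lambda>p. near (fst p) (snd p)) \<in> borel_measurable (mu \<Otimes>\<^sub>M mu)"
  unfolding near_def by measurable

lemma green_pair_measurable [measurable]: 
  "(\<lambda>p. green_log (T (fst p)) (T (snd p))) \<in> borel_measurable (mu \<Otimes>\<^sub>M mu)"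
  unfolding green_log_def by measurable

lemma swirl_pair_measurable [measurable]: 
  "(\<lambda>p. swirl (T (fst p)) (T (snd p))) \<in> borel_measurable (mu \<Otimes>\<^sub>M mu)"
  unfolding swirl_def wall_def by measurable

lemma w_measurable [measurable]: "t \<ge> 0 \<Longrightarrow> w t \<in> borel_measurable mu"
  using w_integrable by auto

text \<open>
  Tonelli's theorem: the inner integral is bounded uniformly in the outer variable.
\<close>
lemma near_times_integrable:
  assumes u: "admissible M m u" and v: "admissible M' m' v"
  shows "integrable (mu \<Otimes>\<^sub>M mu) (\<lambda>p. near (fst p) (snd p) * \<bar>u (fst p)\<bar> * \<bar>v (snd p)\<bar>)"
    and "(\<integral>p. near (fst p) (snd p) * \<bar>u (fst p)\<bar> * \<bar>v (snd p)\<bar> \<partial>(mu \<Otimes>\<^sub>M mu)) \<le> near_const * (M' + m') * (\<integral>x. \<bar>u x\<bar> \<partial>mu)"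
proof -
  have [measurable]: "u \<in> borel_measurable mu" "v \<in> borel_measurable mu"
    using u v by (auto simp: admissible_def)
  have inner: "(\<integral>y. near x y * \<bar>u x\<bar> * \<bar>v y\<bar> \<partial>mu) = \<bar>u x\<bar> * (\<integral>y. near x y * \<bar>v y\<bar> \<partial>mu)" for x
    by (subst integral_mult_right_zero[symmetric]) (simp add: mult_ac)
  have inner_le: "(\<integral>y. near x y * \<bar>u x\<bar> * \<bar>v y\<bar> \<partial>mu) \<le> near_const * (M' + m') * \<bar>u x\<bar>" if "x \<in> U" for x
    unfolding inner using mult_left_mono[OF near_const(3)[OF v that], of "\<bar>u x\<bar>"] by (simp add: mult.commute)
  have inner_ge: "0 \<le> (\<integral>y. near x y * \<bar>u x\<bar> * \<bar>v y\<bar> \<partial>mu)" for x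
    using near_ge_1[of x] by (intro Bochner_Integration.integral_nonneg mult_nonneg_nonneg) (auto intro: order_trans[OF zero_le_one])
  have abs_eq: "norm (near x y * \<bar>u x\<bar> * \<bar>v y\<bar>) = near x y * \<bar>u x\<bar> * \<bar>v y\<bar>" for x y
    using near_ge_1[of x y] by (simp add: abs_mult)
  have bnd: "integrable mu (\<lambda>x. near_const * (M' + m') * \<bar>u x\<bar>)"
    using u by (auto simp: admissible_def)
  have outer: "integrable mu (\<lambda>x. \<integral>y. near x y * \<bar>u x\<bar> * \<bar>v y\<bar> \<partial>mu)"
  proof (rule Bochner_Integration.integrable_bound[OF bnd])
    show "(\<lambda>x. \<integral>y. near x y * \<bar>u x\<bar> * \<bar>v y\<bar> \<partial>mu) \<in> borel_measurable mu"
    proof (rule mu.borel_measurable_lebesgue_integral)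
      show "(\<lambda>(x, y). near x y * \<bar>u x\<bar> * \<bar>v y\<bar>) \<in> borel_measurable (mu \<Otimes>\<^sub>M mu)"
        unfolding split_beta' by measurable
    qed
    show "AE x in mu. norm (\<integral>y. near x y * \<bar>u x\<bar> * \<bar>v y\<bar> \<partial>mu) \<le> norm (near_const * (M' + m') * \<bar>u x\<bar>)"
      by (rule AE_I2) (use inner_le inner_ge in \<open>fastforce intro: order_trans[OF _ abs_ge_self]\<close>)
  qed
  show int: "integrable (mu \<Otimes>\<^sub>M mu) (\<lambda>p. near (fst p) (snd p) * \<bar>u (fst p)\<bar> * \<bar>v (snd p)\<bar>)"
  proof (rule mu2.Fubini_integrable)
    show "integrable mu (\<lambda>x. \<integral>y. norm (near (fst (x, y)) (snd (x, y)) * \<bar>u (fst (x, y))\<bar> * \<bar>v (snd (x, y))\<bar>) \<partial>mu)"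
      using outer by (simp only: fst_conv snd_conv abs_eq)
    show "AE x in mu. integrable mu (\<lambda>y. near (fst (x, y)) (snd (x, y)) * \<bar>u (fst (x, y))\<bar> * \<bar>v (snd (x, y))\<bar>)"
    proof (rule AE_I2)
      fix x assume "x \<in> space mu"
      then have "integrable mu (\<lambda>y. \<bar>u x\<bar> * (near x y * \<bar>v y\<bar>))" using near_const(2)[OF v] by auto
      then show "integrable mu (\<lambda>y. near (fst (x, y)) (snd (x, y)) * \<bar>u (fst (x, y))\<bar> * \<bar>v (snd (x, y))\<bar>)"
        by (simp add: mult_ac)
    qed
  qed measurable
  have "(\<integral>p. near (fst p) (snd p) * \<bar>u (fst p)\<bar> * \<bar>v (snd p)\<bar> \<partial>(mu \<Otimes>\<^sub>M mu))
      = (\<integral>x. \<integral>y. near x y * \<bar>u x\<bar> * \<bar>v y\<bar> \<partial>mu \<partial>mu)"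
    using mu2.integral_fst'[OF int] by simp
  also have "\<dots> \<le> (\<integral>x. near_const * (M' + m') * \<bar>u x\<bar> \<partial>mu)"
    by (rule integral_mono[OF outer bnd]) (use inner_le in auto)
  finally show "(\<integral>p. near (fst p) (snd p) * \<bar>u (fst p)\<bar> * \<bar>v (snd p)\<bar> \<partial>(mu \<Otimes>\<^sub>M mu)) \<le> near_const * (M' + m') * (\<integral>x. \<bar>u x\<bar> \<partial>mu)"
    by simp
qed

lemma AE_pair_neq: "AE p in mu \<Otimes>\<^sub>M mu. fst p \<in> U \<and> snd p \<in> U \<and> fst p \<noteq> snd p"
proof (rule mu2.AE_pair_measure)
  have [measurable]: "(\<lambda>x. x) \<in> borel_measurable mu"
    by (rule measurable_mu_continuous) (intro continuous_intros)
  have f: "(\<lambda>p. fst p - snd p) \<in> borel_measurable (mu \<Otimes>\<^sub>M mu)"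
    by (intro borel_measurable_diff measurable_compose[OF measurable_fst] measurable_compose[OF measurable_snd]) measurable
  have "{p \<in> space (mu \<Otimes>\<^sub>M mu). fst p - snd p \<noteq> 0} \<in> sets (mu \<Otimes>\<^sub>M mu)"
    using f by measurable
  also have "{p \<in> space (mu \<Otimes>\<^sub>M mu). fst p - snd p \<noteq> 0} = {p \<in> space (mu \<Otimes>\<^sub>M mu). fst p \<in> U \<and> snd p \<in> U \<and> fst p \<noteq> snd p}"
    by (auto simp: space_pair_measure)
  finally show "{p \<in> space (mu \<Otimes>\<^sub>M mu). fst p \<in> U \<and> snd p \<in> U \<and> fst p \<noteq> snd p} \<in> sets (mu \<Otimes>\<^sub>M mu)" .
  show "AE x in mu. AE y in mu. fst (x, y) \<in> U \<and> snd (x, y) \<in> U \<and> fst (x, y) \<noteq> snd (x, y)"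
  proof (rule AE_I2)
    fix x assume x: "x \<in> space mu"
    show "AE y in mu. fst (x, y) \<in> U \<and> snd (x, y) \<in> U \<and> fst (x, y) \<noteq> snd (x, y)"
      using AE_mu_neq[of x] AE_mu_in by eventually_elim (use x in auto)
  qed
qed

lemma product_integral:
  assumes "integrable mu f" "integrable mu g"
  shows "integrable (mu \<Otimes>\<^sub>M mu) (\<lambda>p. f (fst p) * (g (snd p) :: real))"
    and "(\<integral>p. f (fst p) * g (snd p) \<partial>(mu \<Otimes>\<^sub>M mu)) = (\<integral>x. f x \<partial>mu) * (\<integral>y. g y \<partial>mu)"
proof -
  have [measurable]: "f \<in> borel_measurable mu" "g \<in> borel_measurable mu" using assms by auto
  show int: "integrable (mu \<Otimes>\<^sub>M mu) (\<lambda>p. f (fst p) * g (snd p))"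
  proof (rule mu2.Fubini_integrable)
    show "integrable mu (\<lambda>x. \<integral>y. norm (f (fst (x, y)) * g (snd (x, y))) \<partial>mu)"
      using assms by (simp add: abs_mult)
    show "AE x in mu. integrable mu (\<lambda>y. f (fst (x, y)) * g (snd (x, y)))" using assms by simp
  qed measurable
  show "(\<integral>p. f (fst p) * g (snd p) \<partial>(mu \<Otimes>\<^sub>M mu)) = (\<integral>x. f x \<partial>mu) * (\<integral>y. g y \<partial>mu)"
    using mu2.integral_fst'[OF int] by simp
qed

lemma ln_abs_w_integrable: "t \<ge> 0 \<Longrightarrow> integrable mu (\<lambda>x. ln (norm (T x)) * \<bar>w t x\<bar>)"
proof -
  assume t: "t \<ge> 0"
  have "integrable mu (\<lambda>x. \<bar>ln (norm (T x)) * w t x\<bar>)" using ln_w_integrable[OF t] by simp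
  then show ?thesis by (rule integrable_transform) (use norm_T in \<open>auto simp: abs_mult less_imp_le\<close>)
qed

text \<open>
  Dominates the integrands of the energy and of the radial moments, and is integrable by the separate
  treatment of its four terms.
\<close>
definition dominant :: "real \<Rightarrow> real \<Rightarrow> complex \<times> complex \<Rightarrow> real" where
  "dominant s t p = (1 + ln (norm (T (fst p))) + ln (norm (T (snd p))) + near (fst p) (snd p)) * \<bar>w s (fst p)\<bar> * \<bar>w t (snd p)\<bar>"

lemma dominant_integrable:
  assumes "s \<ge> 0" "t \<ge> 0"
  shows "integrable (mu \<Otimes>\<^sub>M mu) (dominant s t)"
proof -
  have a: "integrable mu (\<lambda>x. \<bar>w s x\<bar>)" "integrable mu (\<lambda>x. \<bar>w t x\<bar>)"
    using w_integrable assms by auto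
  have "dominant s t = (\<lambda>p. \<bar>w s (fst p)\<bar> * \<bar>w t (snd p)\<bar> + (ln (norm (T (fst p))) * \<bar>w s (fst p)\<bar>) * \<bar>w t (snd p)\<bar>
      + \<bar>w s (fst p)\<bar> * (ln (norm (T (snd p))) * \<bar>w t (snd p)\<bar>) + near (fst p) (snd p) * \<bar>w s (fst p)\<bar> * \<bar>w t (snd p)\<bar>)"
    by (simp add: dominant_def fun_eq_iff algebra_simps)
  then show ?thesis
    using near_times_integrable(1)[OF w_admissible[OF assms(1)] w_admissible[OF assms(2)]]
      product_integral(1)[OF a] product_integral(1)[OF ln_abs_w_integrable[OF assms(1)] a(2)]
      product_integral(1)[OF a(1) ln_abs_w_integrable[OF assms(2)]] by simp
qed

lemma integrable_dominated:
  assumes "s \<ge> 0" "t \<ge> 0" and f: "f \<in> borel_measurable (mu \<Otimes>\<^sub>M mu)"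
    and b: "\<And>x y. x \<in> U \<Longrightarrow> y \<in> U \<Longrightarrow> x \<noteq> y \<Longrightarrow> \<bar>f (x, y)\<bar> \<le> c * dominant s t (x, y)"
  shows "integrable (mu \<Otimes>\<^sub>M mu) (f :: complex \<times> complex \<Rightarrow> real)"
proof (rule Bochner_Integration.integrable_bound[OF _ f])
  show "integrable (mu \<Otimes>\<^sub>M mu) (\<lambda>p. c * dominant s t p)" using dominant_integrable[OF assms(1,2)] by simp
  show "AE p in mu \<Otimes>\<^sub>M mu. norm (f p) \<le> norm (c * dominant s t p)"
    using AE_pair_neq
  proof eventually_elim
    case (elim p)
    then have "\<bar>f p\<bar> \<le> c * dominant s t p" using b[of "fst p" "snd p"] by simp
    then show ?case unfolding real_norm_def by linarith
  qed
qed

text \<open>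
  The quadratic part of the energy as a bilinear expression in the vorticities at two times.
\<close>
definition pairing :: "real \<Rightarrow> real \<Rightarrow> real" where
  "pairing s t = (\<integral>p. green_log (T (fst p)) (T (snd p)) * w s (fst p) * w t (snd p) \<partial>(mu \<Otimes>\<^sub>M mu))"

lemma pairing_integrable:
  assumes "s \<ge> 0" "t \<ge> 0"
  shows "integrable (mu \<Otimes>\<^sub>M mu) (\<lambda>p. green_log (T (fst p)) (T (snd p)) * w s (fst p) * w t (snd p))"
proof (rule integrable_dominated[OF assms, where c = 1])
  note [measurable] = w_measurable[OF assms(1)] w_measurable[OF assms(2)]
  show "(\<lambda>p. green_log (T (fst p)) (T (snd p)) * w s (fst p) * w t (snd p)) \<in> borel_measurable (mu \<Otimes>\<^sub>M mu)"
    by measurable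
  fix x y assume xy: "x \<in> U" "y \<in> U" "x \<noteq> y"
  have XY: "norm (T x) > 1" "norm (T y) > 1" "T x \<noteq> T y" using xy norm_T T_eq_iff by auto
  have "\<bar>green_log (T x) (T y)\<bar> \<le> 1 + ln (norm (T x)) + ln (norm (T y)) + near x y"
    using green_log_nonpos[OF XY] green_log_lower[OF XY] inverse_le_sing[of "norm (T x - T y)"] XY
    by (simp add: near_def)
  then have "\<bar>green_log (T x) (T y)\<bar> * \<bar>w s x\<bar> * \<bar>w t y\<bar> \<le> dominant s t (x, y)"
    unfolding dominant_def by (auto intro!: mult_right_mono)
  then show "\<bar>green_log (T (fst (x, y))) (T (snd (x, y))) * w s (fst (x, y)) * w t (snd (x, y))\<bar> \<le> 1 * dominant s t (x, y)"
    by (simp add: abs_mult)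
qed

lemma pairing_stream:
  assumes "s \<ge> 0" "t \<ge> 0"
  shows "(\<integral>x. stream_function U T (w t) x * w s x \<partial>mu) = 1 / (2 * pi) * pairing s t"
    and "integrable mu (\<lambda>x. stream_function U T (w t) x * w s x)"
proof -
  note int = pairing_integrable[OF assms]
  have eq: "(\<integral>y. green_log (T x) (T y) * w s x * w t y \<partial>mu) = 2 * pi * (stream_function U T (w t) x * w s x)" if "x \<in> U" for x
  proof -
    have "(\<integral>y. green_log (T x) (T y) * w s x * w t y \<partial>mu) = w s x * (\<integral>y. green_log (T x) (T y) * w t y \<partial>mu)"
      by (subst integral_mult_right_zero[symmetric]) (simp add: mult_ac)
    then show ?thesis
      using stream_function_eq[OF w_measurable[OF assms(2)] that] by simp
  qed
  have "pairing s t = (\<integral>x. \<integral>y. green_log (T x) (T y) * w s x * w t y \<partial>mu \<partial>mu)"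
    unfolding pairing_def using mu2.integral_fst'[OF int] by simp
  also have "\<dots> = (\<integral>x. 2 * pi * (stream_function U T (w t) x * w s x) \<partial>mu)"
    by (intro Bochner_Integration.integral_cong) (auto simp: eq)
  finally show "(\<integral>x. stream_function U T (w t) x * w s x \<partial>mu) = 1 / (2 * pi) * pairing s t" by simp
  have "integrable mu (\<lambda>x. \<integral>y. green_log (T x) (T y) * w s x * w t y \<partial>mu)"
    using mu2.integrable_fst'[OF int] by simp
  then have "integrable mu (\<lambda>x. 2 * pi * (stream_function U T (w t) x * w s x))"
    by (rule integrable_transform) (simp add: eq)
  then have "integrable mu (\<lambda>x. (1 / (2 * pi)) * (2 * pi * (stream_function U T (w t) x * w s x)))"
    by (rule integrable_mult_right)
  then show "integrable mu (\<lambda>x. stream_function U T (w t) x * w s x)" by simp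
qed

lemma integral_pair_swap:
  fixes f :: "complex \<times> complex \<Rightarrow> real"
  assumes [measurable]: "f \<in> borel_measurable (mu \<Otimes>\<^sub>M mu)"
  shows "(\<integral>p. f (snd p, fst p) \<partial>(mu \<Otimes>\<^sub>M mu)) = (\<integral>p. f p \<partial>(mu \<Otimes>\<^sub>M mu))"
  using mu2.integral_product_swap[of f] by (simp add: split_beta')

lemma pairing_commute:
  assumes "s \<ge> 0" "t \<ge> 0"
  shows "pairing s t = pairing t s"
proof -
  note [measurable] = w_measurable[OF assms(1)] w_measurable[OF assms(2)]
  have "pairing s t = (\<integral>p. green_log (T (snd p)) (T (fst p)) * w s (snd p) * w t (fst p) \<partial>(mu \<Otimes>\<^sub>M mu))"
    unfolding pairing_def
    using integral_pair_swap[of "\<lambda>p. green_log (T (fst p)) (T (snd p)) * w s (fst p) * w t (snd p)"] by simp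
  also have "\<dots> = pairing t s"
    unfolding pairing_def by (intro Bochner_Integration.integral_cong) (auto simp: green_log_commute mult_ac)
  finally show ?thesis .
qed

definition log_moment :: "real \<Rightarrow> real" where "log_moment t = (\<integral>x. ln (norm (T x)) * w t x \<partial>mu)"

text \<open>
  The Hamiltonian of the flow, multiplied by \<open>4\<pi>\<close>.
\<close>
definition energy :: "real \<Rightarrow> real" where "energy t = pairing t t + 2 * \<alpha> * log_moment t"

definition l1dist :: "real \<Rightarrow> real \<Rightarrow> real" where "l1dist s t = (\<integral>x. \<bar>w s x - w t x\<bar> \<partial>mu)"

lemma l1dist_triangle: "r \<ge> 0 \<Longrightarrow> s \<ge> 0 \<Longrightarrow> t \<ge> 0 \<Longrightarrow> l1dist r t \<le> l1dist r s + l1dist s t"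
proof -
  assume "r \<ge> 0" "s \<ge> 0" "t \<ge> 0"
  note i = this[THEN w_integrable]
  have "l1dist r t \<le> (\<integral>x. \<bar>w r x - w s x\<bar> + \<bar>w s x - w t x\<bar> \<partial>mu)"
    unfolding l1dist_def using i by (intro integral_mono) auto
  also have "\<dots> = l1dist r s + l1dist s t"
    unfolding l1dist_def using i by (intro Bochner_Integration.integral_add) auto
  finally show ?thesis .
qed

lemma l1dist_commute: "l1dist s t = l1dist t s"
  by (simp add: l1dist_def abs_minus_commute)

text \<open>
  Scheffe's argument: pointwise convergence together with convergence of the \<open>L\<^sup>1\<close> norms, which are
  constant here, implies convergence in \<open>L\<^sup>1\<close>.
\<close>
lemma l1_continuous:
  assumes t: "t \<ge> 0" and \<eta>: "\<eta> > 0"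
  shows "\<exists>\<delta>>0. \<forall>s\<ge>0. \<bar>s - t\<bar> < \<delta> \<longrightarrow> l1dist s t < \<eta>"
proof (rule ccontr)
  assume "\<not> ?thesis"
  then have "\<forall>n. \<exists>s\<ge>0. \<bar>s - t\<bar> < 1 / real (Suc n) \<and> \<not> l1dist s t < \<eta>"
    by (metis of_nat_0_less_iff zero_less_Suc zero_less_divide_1_iff)
  then obtain s where s: "\<And>n. s n \<ge> 0" "\<And>n. \<bar>s n - t\<bar> < 1 / real (Suc n)" "\<And>n. \<not> l1dist (s n) t < \<eta>" by metis
  have "(\<lambda>n. \<bar>s n - t\<bar>) \<longlonglongrightarrow> 0"
  proof (rule tendsto_sandwich[of "\<lambda>_. 0" _ _ "\<lambda>n. 1 / real (Suc n)"])
    show "(\<lambda>n. 1 / real (Suc n)) \<longlonglongrightarrow> 0" by real_asymp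
  qed (auto intro!: always_eventually less_imp_le[OF s(2), simplified])
  then have st: "s \<longlonglongrightarrow> t" by (simp add: LIM_zero_iff tendsto_rabs_zero_iff)
  (* 0 <= f n <= 2 |w t|, so dominated convergence applies although the functions w (s n) have no
     common integrable bound *)
  define f where "f n x = \<bar>w (s n) x\<bar> + \<bar>w t x\<bar> - \<bar>w (s n) x - w t x\<bar>" for n x
  have "(\<lambda>n. integral\<^sup>L mu (f n)) \<longlonglongrightarrow> (\<integral>x. 2 * \<bar>w t x\<bar> \<partial>mu)"
  proof (rule integral_dominated_convergence)
    note [measurable] = w_measurable[OF t] w_measurable[OF s(1)]
    show "(\<lambda>x. 2 * \<bar>w t x\<bar>) \<in> borel_measurable mu" "f n \<in> borel_measurable mu" for n
      unfolding f_def by measurable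
    show "integrable mu (\<lambda>x. 2 * \<bar>w t x\<bar>)" using w_integrable[OF t] by simp
    show "AE x in mu. (\<lambda>n. f n x) \<longlonglongrightarrow> 2 * \<bar>w t x\<bar>"
    proof (rule AE_I2)
      fix x assume "x \<in> space mu"
      then have "(\<lambda>n. w (s n) x) \<longlonglongrightarrow> w t x"
        using w_time_continuous[of x] t s(1) st unfolding continuous_on_sequentially comp_def by auto
      then have "(\<lambda>n. f n x) \<longlonglongrightarrow> \<bar>w t x\<bar> + \<bar>w t x\<bar> - \<bar>w t x - w t x\<bar>"
        unfolding f_def by (intro tendsto_intros)
      then show "(\<lambda>n. f n x) \<longlonglongrightarrow> 2 * \<bar>w t x\<bar>" by simp
    qed
    show "AE x in mu. norm (f n x) \<le> 2 * \<bar>w t x\<bar>" for n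
      by (rule AE_I2) (auto simp: f_def abs_if)
  qed
  moreover have "integral\<^sup>L mu (f n) = mass + mass - l1dist (s n) t" for n
    unfolding f_def l1dist_def using w_integrable[OF s(1)] w_integrable[OF t] 
    by (simp add: L1_norm[OF s(1)] L1_norm[OF t])
  ultimately have "(\<lambda>n. mass + mass - l1dist (s n) t) \<longlonglongrightarrow> 2 * mass" by (simp add: L1_norm[OF t])
  from tendsto_diff[OF tendsto_const[of "mass + mass"] this]
  have "(\<lambda>n. l1dist (s n) t) \<longlonglongrightarrow> 0" by simp
  then have "\<forall>\<^sub>F n in sequentially. l1dist (s n) t < \<eta>" using \<eta> by (rule order_tendstoD(2))
  then show False using s(3) by (auto simp: eventually_sequentially)
qed

lemma flow_bound: "\<exists>V\<ge>0. \<forall>t\<ge>0. \<forall>x\<in>U. norm (flow t x) \<le> V"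
proof -
  obtain CT where CT: "CT \<ge> 1" "\<And>x. x \<in> U \<Longrightarrow> norm (deriv T x) \<le> CT"
    using deriv_T_bounded by auto
  have "norm (flow t x) \<le> CT * (5 * Q) + \<bar>\<alpha>\<bar> * (CT * 1)" if t: "t \<ge> 0" and x: "x \<in> U" for t x
  proof -
    have "norm (stream_grad (w t) x) = norm (deriv T x) / (2 * pi) * norm (\<integral>y. w t y *\<^sub>R green_grad (T x) (T y) \<partial>mu)"
      by (simp add: stream_grad_def norm_mult norm_divide)
    also have "\<dots> \<le> CT * (5 * Q)"
    proof (intro mult_mono)
      have "norm (deriv T x) / (2 * pi) \<le> norm (deriv T x) / 1"
        using pi_ge_two by (intro divide_left_mono) auto
      then show "norm (deriv T x) / (2 * pi) \<le> CT" using CT(2)[OF x] by simp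
      show "norm (\<integral>y. w t y *\<^sub>R green_grad (T x) (T y) \<partial>mu) \<le> 5 * Q"
        unfolding Q_def by (rule green_grad_integrable(2)[OF w_admissible[OF t] x])
    qed (use CT in auto)
    finally have 1: "norm (stream_grad (w t) x) \<le> CT * (5 * Q)" .
    have "norm (of_real (\<alpha> / (2 * pi)) * (cnj (deriv T x) * (of_real (1 / (norm (T x))\<^sup>2) * T x)))
       = \<bar>\<alpha>\<bar> / (2 * pi) * (norm (deriv T x) * (1 / norm (T x)))"
      by (simp add: norm_mult norm_divide power2_eq_square)
    also have "\<dots> \<le> \<bar>\<alpha>\<bar> * (CT * 1)"
    proof (intro mult_mono)
      have "\<bar>\<alpha>\<bar> / (2 * pi) \<le> \<bar>\<alpha>\<bar> / 1" using pi_ge_two by (intro divide_left_mono) auto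
      then show "\<bar>\<alpha>\<bar> / (2 * pi) \<le> \<bar>\<alpha>\<bar>" by simp
      show "1 / norm (T x) \<le> 1" using norm_T[OF x] by (auto simp: divide_le_eq)
    qed (use CT(1) CT(2)[OF x] in auto)
    finally show ?thesis unfolding flow_def using 1 norm_triangle_le by (metis add_mono)
  qed
  moreover have "0 \<le> CT * (5 * Q) + \<bar>\<alpha>\<bar> * (CT * 1)" using CT Q_nonneg by auto
  ultimately show ?thesis by blast
qed

lemma flow_difference:
  assumes CT: "\<And>x. x \<in> U \<Longrightarrow> norm (deriv T x) \<le> CT" and st: "s \<ge> 0" "t \<ge> 0" and x: "x \<in> U"
  shows "norm (flow s x - flow t x) \<le> 5 * CT * (\<integral>y. near x y * \<bar>w s y - w t y\<bar> \<partial>mu)"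
    and "integrable mu (\<lambda>y. near x y * \<bar>w s y - w t y\<bar>)"
proof -
  note gs = green_grad_integrable(1)[OF w_admissible[OF st(1)] x]
  note gt = green_grad_integrable(1)[OF w_admissible[OF st(2)] x]
  note [measurable] = w_measurable[OF st(1)] w_measurable[OF st(2)]
  show int: "integrable mu (\<lambda>y. near x y * \<bar>w s y - w t y\<bar>)"
  proof (rule Bochner_Integration.integrable_bound)
    show "integrable mu (\<lambda>y. near x y * \<bar>w s y\<bar> + near x y * \<bar>w t y\<bar>)"
      using near_const(2)[OF w_admissible[OF st(1)] x] near_const(2)[OF w_admissible[OF st(2)] x] by simp
    show "AE y in mu. norm (near x y * \<bar>w s y - w t y\<bar>) \<le> norm (near x y * \<bar>w s y\<bar> + near x y * \<bar>w t y\<bar>)"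
    proof (rule AE_I2)
      fix y
      have n: "near x y \<ge> 0" using near_ge_1[of x y] by simp
      then have "near x y * \<bar>w s y - w t y\<bar> \<le> near x y * (\<bar>w s y\<bar> + \<bar>w t y\<bar>)" by (intro mult_left_mono) auto
      then show "norm (near x y * \<bar>w s y - w t y\<bar>) \<le> norm (near x y * \<bar>w s y\<bar> + near x y * \<bar>w t y\<bar>)"
        using n by (simp add: distrib_left)
    qed
  qed measurable
  have "flow s x - flow t x = cnj (deriv T x) / (2 * pi) * (\<integral>y. w s y *\<^sub>R green_grad (T x) (T y) - w t y *\<^sub>R green_grad (T x) (T y) \<partial>mu)"
    using gs gt by (simp add: flow_def stream_grad_def right_diff_distrib)
  then have "norm (flow s x - flow t x) = norm (deriv T x) / (2 * pi) * norm (\<integral>y. w s y *\<^sub>R green_grad (T x) (T y) - w t y *\<^sub>R green_grad (T x) (T y) \<partial>mu)"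
    by (simp add: norm_mult norm_divide)
  also have "\<dots> \<le> CT * (\<integral>y. 5 * (near x y * \<bar>w s y - w t y\<bar>) \<partial>mu)"
  proof (intro mult_mono)
    have "norm (deriv T x) / (2 * pi) \<le> norm (deriv T x) / 1"
      using pi_ge_two by (intro divide_left_mono) auto
    then show "norm (deriv T x) / (2 * pi) \<le> CT" using CT[OF x] by simp
    show "norm (\<integral>y. w s y *\<^sub>R green_grad (T x) (T y) - w t y *\<^sub>R green_grad (T x) (T y) \<partial>mu) \<le> (\<integral>y. 5 * (near x y * \<bar>w s y - w t y\<bar>) \<partial>mu)"
    proof (rule norm_integral_le_integral)
      show "AE y in mu. norm (w s y *\<^sub>R green_grad (T x) (T y) - w t y *\<^sub>R green_grad (T x) (T y)) \<le> 5 * (near x y * \<bar>w s y - w t y\<bar>)"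
        using AE_mu_neq[of x] AE_mu_in
      proof eventually_elim
        case (elim y)
        have "norm (green_grad (T x) (T y)) \<le> 5 * near x y"
          unfolding near_def using elim x T_eq_iff by (intro green_grad_bound norm_T) auto
        then have "\<bar>w s y - w t y\<bar> * norm (green_grad (T x) (T y)) \<le> \<bar>w s y - w t y\<bar> * (5 * near x y)"
          by (intro mult_left_mono) auto
        then show ?case by (simp add: mult_ac flip: scaleR_diff_left)
      qed
    qed (use gs gt int in auto)
    show "0 \<le> CT" using CT[OF x] norm_ge_zero order_trans by blast
  qed auto
  finally show "norm (flow s x - flow t x) \<le> 5 * CT * (\<integral>y. near x y * \<bar>w s y - w t y\<bar> \<partial>mu)"
    by simp
qed

lemma difference_admissible:
  assumes "s \<ge> 0" "t \<ge> 0"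
  shows "admissible (2 * sup0) (l1dist s t) (\<lambda>x. w s x - w t x)"
  unfolding admissible_def l1dist_def
proof (intro conjI ballI)
  show "\<bar>w s y - w t y\<bar> \<le> 2 * sup0" if "y \<in> U" for y
    using w_bounded[OF assms(1) that] w_bounded[OF assms(2) that] by linarith
  show "integrable mu (\<lambda>x. w s x - w t x)"
    by (rule Bochner_Integration.integrable_diff[OF w_integrable[OF assms(1)] w_integrable[OF assms(2)]])
qed (use sup0_nonneg in auto)

text \<open>
  By Fubini's theorem the singular kernel can be integrated against the vorticity in \<open>x\<close> first, which
  costs only a constant and leaves the \<open>L\<^sup>1\<close> distance of the two vorticities in \<open>y\<close>.
\<close>
lemma flow_difference_integral:
  assumes CT: "CT \<ge> 0" "\<And>x. x \<in> U \<Longrightarrow> norm (deriv T x) \<le> CT"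
    and st: "s \<ge> 0" "t \<ge> 0" "r \<ge> 0"
  shows "integrable mu (\<lambda>x. \<bar>w r x\<bar> * norm (flow s x - flow t x))"
    and "(\<integral>x. \<bar>w r x\<bar> * norm (flow s x - flow t x) \<partial>mu) \<le> 5 * CT * Q * l1dist s t"
proof -
  have "continuous_on U (\<lambda>x. norm (flow s x - flow t x))"
    by (intro continuous_intros flow_continuous st)
  from integrable_abs[OF integrable_continuous_times_w[OF st(3) this]]
  show int: "integrable mu (\<lambda>x. \<bar>w r x\<bar> * norm (flow s x - flow t x))"
    by (simp add: abs_mult mult.commute)
  define k where "k p = near (fst p) (snd p) * \<bar>w s (fst p) - w t (fst p)\<bar> * \<bar>w r (snd p)\<bar>" for p
  note nt = near_times_integrable[OF difference_admissible[OF st(1,2)] w_admissible[OF st(3)]]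
  have ik: "integrable (mu \<Otimes>\<^sub>M mu) k" unfolding k_def by (rule nt(1))
  have km: "k \<in> borel_measurable (mu \<Otimes>\<^sub>M mu)" using ik by auto
  have iks: "integrable (mu \<Otimes>\<^sub>M mu) (\<lambda>p. k (snd p, fst p))"
    using mu2.integrable_product_swap[OF ik] by (simp add: split_beta')
  have eq: "(\<integral>y. k (y, x) \<partial>mu) = \<bar>w r x\<bar> * (\<integral>y. near x y * \<bar>w s y - w t y\<bar> \<partial>mu)" for x
    unfolding k_def by (subst integral_mult_right_zero[symmetric]) (simp add: near_commute mult_ac)
  have io: "integrable mu (\<lambda>x. \<bar>w r x\<bar> * (\<integral>y. near x y * \<bar>w s y - w t y\<bar> \<partial>mu))"
    using mu2.integrable_fst'[OF iks] by (simp add: eq)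
  have "(\<integral>x. \<bar>w r x\<bar> * norm (flow s x - flow t x) \<partial>mu) \<le> (\<integral>x. 5 * CT * (\<bar>w r x\<bar> * (\<integral>y. near x y * \<bar>w s y - w t y\<bar> \<partial>mu)) \<partial>mu)"
  proof (rule integral_mono[OF int])
    show "\<bar>w r x\<bar> * norm (flow s x - flow t x) \<le> 5 * CT * (\<bar>w r x\<bar> * (\<integral>y. near x y * \<bar>w s y - w t y\<bar> \<partial>mu))" if "x \<in> space mu" for x
      using mult_left_mono[OF flow_difference(1)[OF CT(2) st(1,2), of x], of "\<bar>w r x\<bar>"] that by (simp add: mult_ac)
  qed (use io in simp)
  also have "\<dots> = 5 * CT * (\<integral>x. \<bar>w r x\<bar> * (\<integral>y. near x y * \<bar>w s y - w t y\<bar> \<partial>mu) \<partial>mu)" by simp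
  also have "(\<integral>x. \<bar>w r x\<bar> * (\<integral>y. near x y * \<bar>w s y - w t y\<bar> \<partial>mu) \<partial>mu) = (\<integral>p. k (snd p, fst p) \<partial>(mu \<Otimes>\<^sub>M mu))"
    using mu2.integral_fst'[OF iks] by (simp add: eq)
  also have "\<dots> = integral\<^sup>L (mu \<Otimes>\<^sub>M mu) k" by (rule integral_pair_swap[OF km])
  finally have "(\<integral>x. \<bar>w r x\<bar> * norm (flow s x - flow t x) \<partial>mu) \<le> 5 * CT * integral\<^sup>L (mu \<Otimes>\<^sub>M mu) k" .
  also have "\<dots> \<le> 5 * CT * (Q * l1dist s t)"
    using nt(2) CT(1) unfolding k_def Q_def l1dist_def by (intro mult_left_mono) auto
  finally show "(\<integral>x. \<bar>w r x\<bar> * norm (flow s x - flow t x) \<partial>mu) \<le> 5 * CT * Q * l1dist s t" by simp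
qed

lemma potential_growth:
  assumes t: "t \<ge> 0"
  shows "\<exists>A. \<forall>x\<in>U. \<bar>potential t x\<bar> \<le> A * (1 + ln (norm (T x)))"
proof -
  define c where "c = (\<integral>y. ln (norm (T y)) * \<bar>w t y\<bar> \<partial>mu) + Q"
  have c0: "c \<ge> 0" unfolding c_def using Q_nonneg norm_T
    by (intro add_nonneg_nonneg Bochner_Integration.integral_nonneg_AE AE_I2) (auto simp: less_imp_le)
  have "\<bar>potential t x\<bar> \<le> (mass + c + \<bar>\<alpha>\<bar>) * (1 + ln (norm (T x)))" if x: "x \<in> U" for x
  proof -
    have l: "ln (norm (T x)) \<ge> 0" using norm_T[OF x] by simp
    define g where "g = (\<integral>y. green_log (T x) (T y) * w t y \<partial>mu)"
    have small: "\<bar>1 / (2 * pi) * z\<bar> \<le> \<bar>z\<bar>" for z :: real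
    proof -
      have "\<bar>z\<bar> / (2 * pi) \<le> \<bar>z\<bar> / 1" using pi_ge_two by (intro divide_left_mono) auto
      then show ?thesis by (simp add: abs_mult)
    qed
    have "\<bar>g\<bar> \<le> ln (norm (T x)) * mass + c"
      using green_log_integrable(2)[OF w_admissible[OF t] x ln_w_integrable[OF t]] unfolding c_def Q_def g_def by simp
    moreover have "potential t x = 1 / (2 * pi) * g + 1 / (2 * pi) * (\<alpha> * ln (norm (T x)))"
      unfolding potential_def g_def stream_function_eq[OF w_measurable[OF t] x] by simp
    moreover note small[of g] small[of "\<alpha> * ln (norm (T x))"]
    moreover have "\<bar>\<alpha> * ln (norm (T x))\<bar> = \<bar>\<alpha>\<bar> * ln (norm (T x))" using l by (simp add: abs_mult)
    ultimately have "\<bar>potential t x\<bar> \<le> ln (norm (T x)) * mass + c + \<bar>\<alpha>\<bar> * ln (norm (T x))"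
      by linarith
    also have "\<dots> \<le> (mass + c + \<bar>\<alpha>\<bar>) * (1 + ln (norm (T x)))"
    proof -
      have "0 \<le> mass + \<bar>\<alpha>\<bar> + c * ln (norm (T x))" using mass_nonneg c0 l by auto
      then show ?thesis by (simp add: algebra_simps)
    qed
    finally show ?thesis .
  qed
  then show ?thesis by blast
qed

text \<open>
  The symmetry of the Green's function makes the quadratic part a difference of squares.
\<close>
lemma energy_difference:
  assumes st: "s \<ge> 0" "t \<ge> 0"
  shows "energy t - energy s = 4 * pi * ((\<integral>x. (potential s x + potential t x) / 2 * w t x \<partial>mu) - (\<integral>x. (potential s x + potential t x) / 2 * w s x \<partial>mu))"
proof -
  have *: "(\<integral>x. (potential s x + potential t x) / 2 * w r x \<partial>mu) 
    = (pairing r s / (2 * pi) + pairing r t / (2 * pi)) / 2 + \<alpha> / (2 * pi) * log_moment r" if r: "r \<ge> 0" for r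
  proof -
    have "(\<integral>x. (potential s x + potential t x) / 2 * w r x \<partial>mu)
      = (\<integral>x. (stream_function U T (w s) x * w r x + stream_function U T (w t) x * w r x) / 2 + \<alpha> / (2 * pi) * (ln (norm (T x)) * w r x) \<partial>mu)"
      by (intro Bochner_Integration.integral_cong) (auto simp: potential_def field_simps)
    also have "\<dots> = ((\<integral>x. stream_function U T (w s) x * w r x \<partial>mu) + (\<integral>x. stream_function U T (w t) x * w r x \<partial>mu)) / 2 + \<alpha> / (2 * pi) * log_moment r"
      unfolding log_moment_def using pairing_stream(2)[OF r st(1)] pairing_stream(2)[OF r st(2)] ln_w_integrable[OF r] by simp
    finally show ?thesis unfolding pairing_stream(1)[OF r st(1)] pairing_stream(1)[OF r st(2)] by simp
  qed
  show ?thesis unfolding *[OF st(1)] *[OF st(2)] energy_def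
    using pairing_commute[OF st] by (simp add: field_simps)
qed

text \<open>
  The averaged stream function of the two times is a fixed test function. Its gradient differs from the
  one at an intermediate time by a multiple of \<open>\<eta>\<close> in the mean, and the flow at that time does not
  change its own stream function.
\<close>
lemma energy_increment:
  "\<exists>c\<ge>0. \<forall>s t \<eta>. 0 \<le> s \<longrightarrow> s \<le> t \<longrightarrow> (\<forall>\<tau>. s < \<tau> \<longrightarrow> \<tau> < t \<longrightarrow> l1dist s \<tau> \<le> \<eta> \<and> l1dist t \<tau> \<le> \<eta>)
    \<longrightarrow> \<bar>energy t - energy s\<bar> \<le> c * \<eta> * (t - s)"
proof -
  obtain CT where CT: "CT \<ge> 1" "\<And>x. x \<in> U \<Longrightarrow> norm (deriv T x) \<le> CT"
    using deriv_T_bounded by auto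
  obtain V where V: "V \<ge> 0" "\<And>t x. t \<ge> 0 \<Longrightarrow> x \<in> U \<Longrightarrow> norm (flow t x) \<le> V" using flow_bound by auto
  define c where "c = V * (5 * CT * Q)"
  have c0: "c \<ge> 0" using V CT Q_nonneg by (simp add: c_def)
  have "\<bar>energy t - energy s\<bar> \<le> 4 * pi * c * \<eta> * (t - s)"
    if st: "0 \<le> s" "s \<le> t" and \<eta>: "\<And>\<tau>. s < \<tau> \<Longrightarrow> \<tau> < t \<Longrightarrow> l1dist s \<tau> \<le> \<eta> \<and> l1dist t \<tau> \<le> \<eta>" for s t \<eta>
  proof -
    have t0: "t \<ge> 0" using st by simp
    define \<Phi> where "\<Phi> x = (potential s x + potential t x) / 2" for x
    define \<phi> where "\<phi> x = (1/2) *\<^sub>R (flow s x + flow t x)" for x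
    have G: "GDERIV \<Phi> x :> \<phi> x" if "x \<in> U" for x
    proof -
      have "GDERIV (\<lambda>x. (1/2) * (potential s x + potential t x)) x :> (1/2) *\<^sub>R (flow s x + flow t x)"
        using GDERIV_mult[OF GDERIV_const[of "1/2"] GDERIV_add[OF potential_GDERIV[OF st(1) that] potential_GDERIV[OF t0 that]]]
        by simp
      then show ?thesis by (simp add: \<Phi>_def[abs_def] \<phi>_def)
    qed
    obtain A1 where A1: "\<And>x. x \<in> U \<Longrightarrow> \<bar>potential s x\<bar> \<le> A1 * (1 + ln (norm (T x)))" using potential_growth[OF st(1)] by auto
    obtain A2 where A2: "\<And>x. x \<in> U \<Longrightarrow> \<bar>potential t x\<bar> \<le> A2 * (1 + ln (norm (T x)))" using potential_growth[OF t0] by auto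
    have "\<bar>(\<integral>x. \<Phi> x * w t x \<partial>mu) - (\<integral>x. \<Phi> x * w s x \<partial>mu)\<bar> \<le> (c * \<eta>) * (t - s)"
    proof (rule evolution_bound[OF st G, where A = "(A1 + A2) / 2" and ?n0.0 = 0])
      show "continuous_on U \<phi>" unfolding \<phi>_def[abs_def] by (intro continuous_intros flow_continuous st t0)
      show "\<bar>\<Phi> x\<bar> \<le> (A1 + A2) / 2 * (1 + ln (norm (T x)))" if "x \<in> U" for x
        using A1[OF that] A2[OF that] unfolding \<Phi>_def by (simp add: algebra_simps)
      fix n \<tau> assume \<tau>: "s < \<tau>" "\<tau> < t"
      have \<tau>0: "\<tau> \<ge> 0" using st \<tau> by simp
      note d1 = flow_difference_integral[OF _ CT(2) st(1) \<tau>0 \<tau>0] and d2 = flow_difference_integral[OF _ CT(2) t0 \<tau>0 \<tau>0]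
      define b where "b x = V / 2 * (\<bar>w \<tau> x\<bar> * norm (flow s x - flow \<tau> x) + \<bar>w \<tau> x\<bar> * norm (flow t x - flow \<tau> x))" for x
      have ib: "integrable mu b" unfolding b_def using d1(1) d2(1) CT by simp
      have ptw: "norm (cutoff n (norm (T x)) * (w \<tau> x * inner (\<i> * flow \<tau> x) (\<phi> x))) \<le> b x" if x: "x \<in> U" for x
      proof -
        (* only the deviation of the averaged gradient from the current one contributes *)
        have "inner (\<i> * flow \<tau> x) (flow \<tau> x) = 0" by (simp add: inner_complex_def)
        then have "inner (\<i> * flow \<tau> x) (\<phi> x) = inner (\<i> * flow \<tau> x) (\<phi> x - flow \<tau> x)" by (simp add: inner_diff_right)
        also have "\<bar>\<dots>\<bar> \<le> norm (\<i> * flow \<tau> x) * norm (\<phi> x - flow \<tau> x)" by (rule Cauchy_Schwarz_ineq2)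
        also have "\<dots> \<le> V * norm (\<phi> x - flow \<tau> x)" using V(2)[OF \<tau>0 x] by (simp add: norm_mult mult_right_mono)
        also have "\<phi> x - flow \<tau> x = (1/2) *\<^sub>R ((flow s x - flow \<tau> x) + (flow t x - flow \<tau> x))"
          by (simp add: \<phi>_def scaleR_conv_of_real algebra_simps)
        also have "norm \<dots> \<le> 1/2 * (norm (flow s x - flow \<tau> x) + norm (flow t x - flow \<tau> x))"
          unfolding norm_scaleR using norm_triangle_ineq[of "flow s x - flow \<tau> x" "flow t x - flow \<tau> x"] by simp
        finally have i: "\<bar>inner (\<i> * flow \<tau> x) (\<phi> x)\<bar> \<le> V * (1/2 * (norm (flow s x - flow \<tau> x) + norm (flow t x - flow \<tau> x)))"
          using V(1) by (simp add: mult_left_mono)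
        have "norm (cutoff n (norm (T x)) * (w \<tau> x * inner (\<i> * flow \<tau> x) (\<phi> x))) \<le> 1 * (\<bar>w \<tau> x\<bar> * \<bar>inner (\<i> * flow \<tau> x) (\<phi> x)\<bar>)"
          using cutoff_bounds[of n "norm (T x)"] unfolding real_norm_def abs_mult by (intro mult_right_mono) auto
        also have "\<dots> \<le> 1 * (\<bar>w \<tau> x\<bar> * (V * (1/2 * (norm (flow s x - flow \<tau> x) + norm (flow t x - flow \<tau> x)))))"
          using i by (intro mult_left_mono) auto
        also have "\<dots> = b x" by (simp add: b_def algebra_simps)
        finally show ?thesis .
      qed
      have bi: "integral\<^sup>L mu b \<le> c * \<eta>"
      proof -
        have "integral\<^sup>L mu b = V / 2 * ((\<integral>x. \<bar>w \<tau> x\<bar> * norm (flow s x - flow \<tau> x) \<partial>mu) + (\<integral>x. \<bar>w \<tau> x\<bar> * norm (flow t x - flow \<tau> x) \<partial>mu))"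
          unfolding b_def using d1(1) d2(1) CT by simp
        also have "\<dots> \<le> V / 2 * (5 * CT * Q * l1dist s \<tau> + 5 * CT * Q * l1dist t \<tau>)"
          using d1(2) d2(2) CT V by (intro mult_left_mono add_mono) auto
        also have "\<dots> \<le> V / 2 * (5 * CT * Q * \<eta> + 5 * CT * Q * \<eta>)"
          using \<eta>[OF \<tau>] CT V Q_nonneg by (intro mult_left_mono add_mono) auto
        finally show ?thesis by (simp add: c_def algebra_simps)
      qed
      (* a nonexistent integral is 0 by convention, which satisfies the bound as well *)
      show "\<bar>\<integral>x. cutoff n (norm (T x)) * (w \<tau> x * inner (\<i> * flow \<tau> x) (\<phi> x)) \<partial>mu\<bar> \<le> c * \<eta>"
      proof (cases "integrable mu (\<lambda>x. cutoff n (norm (T x)) * (w \<tau> x * inner (\<i> * flow \<tau> x) (\<phi> x)))")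
        case True
        have "norm (\<integral>x. cutoff n (norm (T x)) * (w \<tau> x * inner (\<i> * flow \<tau> x) (\<phi> x)) \<partial>mu) \<le> integral\<^sup>L mu b"
          by (rule norm_integral_le_integral[OF True ib]) (use ptw in auto)
        then show ?thesis using bi by simp
      next
        case False
        have "0 \<le> l1dist s \<tau>" by (simp add: l1dist_def)
        then have "0 \<le> \<eta>" using \<eta>[OF \<tau>] by linarith
        then show ?thesis using c0 not_integrable_integral_eq[OF False] by simp
      qed
    qed
    then have "4 * pi * \<bar>(\<integral>x. \<Phi> x * w t x \<partial>mu) - (\<integral>x. \<Phi> x * w s x \<partial>mu)\<bar> \<le> 4 * pi * ((c * \<eta>) * (t - s))"
      by (intro mult_left_mono) auto
    moreover have "\<bar>energy t - energy s\<bar> = 4 * pi * \<bar>(\<integral>x. \<Phi> x * w t x \<partial>mu) - (\<integral>x. \<Phi> x * w s x \<partial>mu)\<bar>"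
      unfolding energy_difference[OF st(1) t0] \<Phi>_def abs_mult by simp
    ultimately show ?thesis by (simp add: mult_ac)
  qed
  then show ?thesis using c0 by (intro exI[of _ "4 * pi * c"]) auto
qed

text \<open>
  By \<open>energy_increment\<close> and continuity in \<open>L\<^sup>1\<close>, the derivative vanishes at every time.
\<close>
lemma energy_conserved:
  assumes "t \<ge> 0"
  shows "energy t = energy 0"
proof -
  obtain c where c: "c \<ge> 0" "\<And>s t \<eta>. 0 \<le> s \<Longrightarrow> s \<le> t \<Longrightarrow> (\<And>\<tau>. s < \<tau> \<Longrightarrow> \<tau> < t \<Longrightarrow> l1dist s \<tau> \<le> \<eta> \<and> l1dist t \<tau> \<le> \<eta>)
    \<Longrightarrow> \<bar>energy t - energy s\<bar> \<le> c * \<eta> * (t - s)"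
    using energy_increment by metis
  have "(energy has_real_derivative 0) (at t within {0..})" if t: "t \<in> {0..}" for t
    unfolding has_field_derivative_iff Lim_within
  proof (intro allI impI)
    fix e :: real assume e: "e > 0"
    define \<eta> where "\<eta> = e / (4 * (c + 1))"
    have \<eta>: "\<eta> > 0" "c * (2 * \<eta>) < e"
    proof -
      show "\<eta> > 0" using e c by (simp add: \<eta>_def)
      have "c * (2 * \<eta>) = (c / (c + 1)) * (e / 2)" using c by (simp add: \<eta>_def field_simps)
      also have "\<dots> \<le> 1 * (e / 2)" using c e by (intro mult_right_mono) auto
      finally show "c * (2 * \<eta>) < e" using e by simp
    qed
    obtain \<delta> where \<delta>: "\<delta> > 0" "\<And>s. s \<ge> 0 \<Longrightarrow> \<bar>s - t\<bar> < \<delta> \<Longrightarrow> l1dist s t < \<eta>"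
      using l1_continuous[of t \<eta>] t \<eta> by auto
    have pair: "l1dist a b \<le> 2 * \<eta>" if "a \<ge> 0" "b \<ge> 0" "\<bar>a - t\<bar> < \<delta>" "\<bar>b - t\<bar> < \<delta>" for a b
      using l1dist_triangle[of a t b] l1dist_commute[of t b] \<delta>(2)[of a] \<delta>(2)[of b] that t by auto
    have "\<bar>(energy s - energy t) / (s - t)\<bar> < e" if s: "s \<ge> 0" "s \<noteq> t" "\<bar>s - t\<bar> < \<delta>" for s
    proof -
      have "\<bar>energy s - energy t\<bar> \<le> c * (2 * \<eta>) * \<bar>s - t\<bar>"
      proof (cases "s \<le> t")
        case True
        have "\<bar>energy t - energy s\<bar> \<le> c * (2 * \<eta>) * (t - s)"
          by (rule c(2)) (use True s t \<delta>(1) in \<open>auto intro!: pair\<close>)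
        then show ?thesis using True by (simp add: abs_minus_commute)
      next
        case False
        have "\<bar>energy s - energy t\<bar> \<le> c * (2 * \<eta>) * (s - t)"
          by (rule c(2)) (use False s t \<delta>(1) in \<open>auto intro!: pair\<close>)
        then show ?thesis using False by simp
      qed
      then have "\<bar>(energy s - energy t) / (s - t)\<bar> \<le> c * (2 * \<eta>)" using s by (simp add: abs_divide divide_le_eq)
      then show ?thesis using \<eta>(2) by linarith
    qed
    then show "\<exists>d>0. \<forall>s\<in>{0..}. 0 < dist s t \<and> dist s t < d \<longrightarrow> dist ((energy s - energy t) / (s - t)) 0 < e"
      using \<delta>(1) by (intro exI[of _ \<delta>]) (auto simp: dist_real_def)
  qed
  then have "\<exists>k. \<forall>x\<in>{0..}. energy x = k" by (rule has_field_derivative_zero_constant[rotated]) auto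
  then show ?thesis using assms by (metis atLeast_iff order_refl)
qed

definition min_log_pairing :: "real \<Rightarrow> real" where
  "min_log_pairing t = (\<integral>p. min (ln (norm (T (fst p)))) (ln (norm (T (snd p)))) * \<bar>w t (fst p)\<bar> * \<bar>w t (snd p)\<bar> \<partial>(mu \<Otimes>\<^sub>M mu))"

lemma min_log_integrable:
  assumes t: "t \<ge> 0"
  shows "integrable (mu \<Otimes>\<^sub>M mu) (\<lambda>p. min (ln (norm (T (fst p)))) (ln (norm (T (snd p)))) * \<bar>w t (fst p)\<bar> * \<bar>w t (snd p)\<bar>)"
proof (rule integrable_dominated[OF t t, where c = 1])
  note [measurable] = w_measurable[OF t]
  show "(\<lambda>p. min (ln (norm (T (fst p)))) (ln (norm (T (snd p)))) * \<bar>w t (fst p)\<bar> * \<bar>w t (snd p)\<bar>) \<in> borel_measurable (mu \<Otimes>\<^sub>M mu)"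
    by measurable
  fix x y assume xy: "x \<in> U" "y \<in> U" "x \<noteq> y"
  have l: "ln (norm (T x)) \<ge> 0" "ln (norm (T y)) \<ge> 0" using xy norm_T by (auto simp: less_imp_le)
  then have "\<bar>min (ln (norm (T x))) (ln (norm (T y)))\<bar> \<le> 1 + ln (norm (T x)) + ln (norm (T y)) + near x y"
    using near_ge_1[of x y] by (auto simp: min_def)
  then have "\<bar>min (ln (norm (T x))) (ln (norm (T y)))\<bar> * \<bar>w t x\<bar> * \<bar>w t y\<bar> \<le> dominant t t (x, y)"
    unfolding dominant_def by (auto intro!: mult_right_mono)
  then show "\<bar>min (ln (norm (T (fst (x, y))))) (ln (norm (T (snd (x, y))))) * \<bar>w t (fst (x, y))\<bar> * \<bar>w t (snd (x, y))\<bar>\<bar> \<le> 1 * dominant t t (x, y)"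
    by (simp add: abs_mult)
qed

lemma AE_pair_nonneg:
  assumes t: "t \<ge> 0"
  shows "AE p in mu \<Otimes>\<^sub>M mu. w t (fst p) \<ge> 0 \<and> w t (snd p) \<ge> 0"
proof (rule mu2.AE_pair_measure)
  note [measurable] = w_measurable[OF t]
  show "{p \<in> space (mu \<Otimes>\<^sub>M mu). w t (fst p) \<ge> 0 \<and> w t (snd p) \<ge> 0} \<in> sets (mu \<Otimes>\<^sub>M mu)" by measurable
  show "AE x in mu. AE y in mu. w t (fst (x, y)) \<ge> 0 \<and> w t (snd (x, y)) \<ge> 0"
    using w_nonneg_AE[OF t]
  proof eventually_elim
    case (elim x)
    show ?case using w_nonneg_AE[OF t] by eventually_elim (use elim in auto)
  qed
qed

text \<open>
  For \<open>\<alpha> \<le> 0\<close> the quadratic part of the energy is bounded since the harmonic part has a sign. For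
  \<open>\<alpha> > mass\<close> the quadratic part is at least \<open>-2 mass\<close> times the logarithmic moment up to a constant, so
  the energy bounds the logarithmic moment, which in turn dominates the pairing.
\<close>
lemma min_log_pairing_bounded:
  assumes \<alpha>: "\<alpha> \<le> 0 \<or> \<alpha> > mass"
  shows "\<exists>C. \<forall>t\<ge>0. min_log_pairing t \<le> C"
proof -
  have log_nonneg: "log_moment t \<ge> 0" if t: "t \<ge> 0" for t
    unfolding log_moment_def
  proof (rule integral_nonneg_AE)
    show "AE x in mu. 0 \<le> ln (norm (T x)) * w t x"
      using w_nonneg_AE[OF t] AE_mu_in by eventually_elim (use norm_T in \<open>auto simp: less_imp_le\<close>)
  qed
  show ?thesis
  proof (cases "\<alpha> \<le> 0")
    case True
    have "min_log_pairing t \<le> ln 3 * mass * mass - energy 0" if t: "t \<ge> 0" for t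
    proof -
      have a: "integrable mu (\<lambda>x. \<bar>w t x\<bar>)" using w_integrable[OF t] by simp
      have "min_log_pairing t \<le> (\<integral>p. ln 3 * (\<bar>w t (fst p)\<bar> * \<bar>w t (snd p)\<bar>) - green_log (T (fst p)) (T (snd p)) * w t (fst p) * w t (snd p) \<partial>(mu \<Otimes>\<^sub>M mu))"
        unfolding min_log_pairing_def
      proof (rule integral_mono_AE[OF min_log_integrable[OF t]])
        show "integrable (mu \<Otimes>\<^sub>M mu) (\<lambda>p. ln 3 * (\<bar>w t (fst p)\<bar> * \<bar>w t (snd p)\<bar>) - green_log (T (fst p)) (T (snd p)) * w t (fst p) * w t (snd p))"
          using product_integral(1)[OF a a] pairing_integrable[OF t t] by simp
        show "AE p in mu \<Otimes>\<^sub>M mu. min (ln (norm (T (fst p)))) (ln (norm (T (snd p)))) * \<bar>w t (fst p)\<bar> * \<bar>w t (snd p)\<bar>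
           \<le> ln 3 * (\<bar>w t (fst p)\<bar> * \<bar>w t (snd p)\<bar>) - green_log (T (fst p)) (T (snd p)) * w t (fst p) * w t (snd p)"
          using AE_pair_neq AE_pair_nonneg[OF t]
        proof eventually_elim
          case (elim p)
          have "min (ln (norm (T (fst p)))) (ln (norm (T (snd p)))) \<le> ln 3 - green_log (T (fst p)) (T (snd p))"
            using elim norm_T T_eq_iff by (intro green_log_upper) auto
          then have "min (ln (norm (T (fst p)))) (ln (norm (T (snd p)))) * (w t (fst p) * w t (snd p)) \<le> (ln 3 - green_log (T (fst p)) (T (snd p))) * (w t (fst p) * w t (snd p))"
            using elim by (intro mult_right_mono) auto
          then show ?case using elim by (simp add: algebra_simps)
        qed
      qed
      also have "\<dots> = ln 3 * (mass * mass) - pairing t t"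
        unfolding pairing_def using product_integral[OF a a] pairing_integrable[OF t t] by (simp add: L1_norm[OF t])
      finally have "min_log_pairing t \<le> ln 3 * (mass * mass) - pairing t t" .
      moreover have "pairing t t = energy 0 - 2 * \<alpha> * log_moment t"
        using energy_conserved[OF t] by (simp add: energy_def)
      moreover have "2 * \<alpha> * log_moment t \<le> 0"
        using True log_nonneg[OF t] by (simp add: mult_nonpos_nonneg)
      ultimately show ?thesis by (simp only: mult.assoc)
    qed
    then show ?thesis by blast
  next
    case False
    then have \<alpha>m: "\<alpha> > mass" using \<alpha> by simp
    have "min_log_pairing t \<le> mass * ((energy 0 + Q * mass) / (2 * (\<alpha> - mass)))" if t: "t \<ge> 0" for t
    proof -
      have a: "integrable mu (\<lambda>x. \<bar>w t x\<bar>)" using w_integrable[OF t] by simp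
      note l = ln_abs_w_integrable[OF t]
      have log_eq: "(\<integral>x. ln (norm (T x)) * \<bar>w t x\<bar> \<partial>mu) = log_moment t"
        unfolding log_moment_def by (rule integral_cong_AE) (use w_nonneg_AE[OF t] w_measurable[OF t] in \<open>auto elim!: eventually_mono\<close>)
      note nt = near_times_integrable[OF w_admissible[OF t] w_admissible[OF t]]
      have "- pairing t t \<le> (\<integral>p. (ln (norm (T (fst p))) * \<bar>w t (fst p)\<bar>) * \<bar>w t (snd p)\<bar> + \<bar>w t (fst p)\<bar> * (ln (norm (T (snd p))) * \<bar>w t (snd p)\<bar>)
           + near (fst p) (snd p) * \<bar>w t (fst p)\<bar> * \<bar>w t (snd p)\<bar> \<partial>(mu \<Otimes>\<^sub>M mu))"
        unfolding pairing_def integral_minus[symmetric]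
      proof (rule integral_mono_AE)
        show "AE p in mu \<Otimes>\<^sub>M mu. - (green_log (T (fst p)) (T (snd p)) * w t (fst p) * w t (snd p)) \<le>
           (ln (norm (T (fst p))) * \<bar>w t (fst p)\<bar>) * \<bar>w t (snd p)\<bar> + \<bar>w t (fst p)\<bar> * (ln (norm (T (snd p))) * \<bar>w t (snd p)\<bar>)
           + near (fst p) (snd p) * \<bar>w t (fst p)\<bar> * \<bar>w t (snd p)\<bar>"
          using AE_pair_neq AE_pair_nonneg[OF t]
        proof eventually_elim
          case (elim p)
          have XY: "norm (T (fst p)) > 1" "norm (T (snd p)) > 1" "T (fst p) \<noteq> T (snd p)" using elim norm_T T_eq_iff by auto
          have "- green_log (T (fst p)) (T (snd p)) \<le> ln (norm (T (fst p))) + ln (norm (T (snd p))) + near (fst p) (snd p)"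
            using green_log_lower[OF XY] inverse_le_sing[of "norm (T (fst p) - T (snd p))"] XY by (simp add: near_def)
          then have "- green_log (T (fst p)) (T (snd p)) * (w t (fst p) * w t (snd p)) \<le> (ln (norm (T (fst p))) + ln (norm (T (snd p))) + near (fst p) (snd p)) * (w t (fst p) * w t (snd p))"
            using elim by (intro mult_right_mono) auto
          then show ?case using elim by (simp add: algebra_simps)
        qed
      qed (use pairing_integrable[OF t t] product_integral(1)[OF l a] product_integral(1)[OF a l] nt(1) in auto)
      also have "\<dots> = log_moment t * mass + mass * log_moment t + (\<integral>p. near (fst p) (snd p) * \<bar>w t (fst p)\<bar> * \<bar>w t (snd p)\<bar> \<partial>(mu \<Otimes>\<^sub>M mu))"
        using product_integral[OF l a] product_integral[OF a l] nt(1) by (simp add: log_eq L1_norm[OF t])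
      also have "\<dots> \<le> log_moment t * mass + mass * log_moment t + Q * mass"
        using nt(2) by (simp add: L1_norm[OF t] Q_def)
      finally have "- pairing t t \<le> 2 * mass * log_moment t + Q * mass" by simp
      moreover have "- pairing t t = - energy 0 + 2 * \<alpha> * log_moment t"
        using energy_conserved[OF t] by (simp add: energy_def)
      ultimately have "log_moment t * (2 * (\<alpha> - mass)) \<le> energy 0 + Q * mass" by (simp add: algebra_simps)
      then have lm: "log_moment t \<le> (energy 0 + Q * mass) / (2 * (\<alpha> - mass))"
        using \<alpha>m by (simp add: le_divide_eq)
      have "min_log_pairing t \<le> (\<integral>p. (ln (norm (T (fst p))) * \<bar>w t (fst p)\<bar>) * \<bar>w t (snd p)\<bar> \<partial>(mu \<Otimes>\<^sub>M mu))"
        unfolding min_log_pairing_def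
        by (rule integral_mono[OF min_log_integrable[OF t] product_integral(1)[OF l a]]) (auto intro!: mult_right_mono)
      also have "\<dots> = mass * log_moment t" using product_integral(2)[OF l a] by (simp add: log_eq L1_norm[OF t])
      also have "\<dots> \<le> mass * ((energy 0 + Q * mass) / (2 * (\<alpha> - mass)))" using lm mass_nonneg by (intro mult_left_mono)
      finally show ?thesis .
    qed
    then show ?thesis by blast
  qed
qed

end

section \<open>Radial moments\<close>

text \<open>
  A truncation of \<open>ln r - 1\<close> that vanishes near the boundary and near infinity and remains Lipschitz with
  constant \<open>1\<close> as a function of \<open>ln r\<close>, uniformly in \<open>L\<close>.
\<close>
definition tent :: "real \<Rightarrow> real \<Rightarrow> real" where
  "tent L r = max 0 (min (ln r - 1) (2 * L - ln r))"

text \<open>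
  The function \<open>p(r) = f'(r)/r\<close> for a weight \<open>f\<close> comparable to \<open>r\<^sup>2 ln\<^sup>k r\<close>, truncated.
\<close>
definition profile :: "nat \<Rightarrow> real \<Rightarrow> real \<Rightarrow> real" where
  "profile k L r = 2 * tent L r ^ k"

lemma tent_bounds:
  assumes "r \<ge> 1"
  shows "0 \<le> tent L r" "tent L r \<le> ln r"
  using assms by (auto simp: tent_def)

lemma tent_diff: "\<bar>tent L r - tent L s\<bar> \<le> \<bar>ln r - ln s\<bar>"
  unfolding tent_def by (auto simp: max_def min_def abs_if)

lemma ln_le_2_sqrt: "r > 0 \<Longrightarrow> ln r \<le> 2 * sqrt r - 2"
proof -
  assume r: "r > 0"
  have "ln r = ln (sqrt r * sqrt r)" using r by simp
  also have "\<dots> = 2 * ln (sqrt r)" using r by (subst ln_mult) auto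
  also have "\<dots> \<le> 2 * (sqrt r - 1)" using r by (intro mult_left_mono ln_le_minus_one) auto
  finally show ?thesis by simp
qed

lemma profile_bounds:
  assumes k: "k = 1 \<or> k = 2" and r: "r \<ge> 1"
  shows "0 \<le> profile k L r" "profile k L r \<le> 8 * r"
proof -
  note t = tent_bounds[OF r, of L]
  show "0 \<le> profile k L r" using t by (simp add: profile_def)
  show "profile k L r \<le> 8 * r" using k
  proof
    assume k: "k = 1"
    have "tent L r \<le> r" using t(2) ln_bound[of r] r by linarith
    then show ?thesis using k r by (simp add: profile_def)
  next
    assume k: "k = 2"
    have "tent L r \<le> 2 * sqrt r" using t(2) ln_le_2_sqrt[of r] r by linarith
    then have "(tent L r)^2 \<le> (2 * sqrt r)^2" using t(1) by (intro power_mono) auto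
    then show ?thesis using k r by (simp add: profile_def power_mult_distrib)
  qed
qed

lemma profile_continuous: "continuous_on {1..} (profile k L)"
  unfolding profile_def[abs_def] tent_def[abs_def] by (intro continuous_intros) auto

lemma profile_eq_0: "r > 0 \<Longrightarrow> r \<le> exp 1 \<or> exp (2 * L) \<le> r \<Longrightarrow> k \<noteq> 0 \<Longrightarrow> profile k L r = 0"
proof -
  assume r: "r > 0" "r \<le> exp 1 \<or> exp (2 * L) \<le> r" "k \<noteq> 0"
  have "ln r \<le> 1 \<or> 2 * L \<le> ln r"
    using r ln_le_cancel_iff[of r "exp 1"] ln_le_cancel_iff[of "exp (2 * L)" r] by auto
  then have "tent L r = 0" by (auto simp: tent_def)
  then show ?thesis using r by (simp add: profile_def)
qed

text \<open>
  The estimates of \<open>ln (r/s)\<close> and of its square by multiples of \<open>r/s - 1\<close>. For \<open>k = 2\<close> the difference of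
  squares contributes the factor \<open>2 ln s + ln (r/s)\<close>.
\<close>
lemma profile_lipschitz:
  assumes k: "k = 1 \<or> k = 2" and s: "1 < s" "s \<le> r"
  shows "s * \<bar>profile k L r - profile k L s\<bar> \<le> 8 * (1 + real (k - 1) * ln s) * (r - s)"
proof -
  define q where "q = ln r - ln s"
  have q_eq: "q = ln (r / s)" using s by (simp add: q_def ln_div)
  have q0: "q \<ge> 0" using s by (simp add: q_def)
  have sq: "s * q \<le> r - s"
  proof -
    have "q \<le> r / s - 1" unfolding q_eq using s by (intro ln_le_minus_one) auto
    then have "s * q \<le> s * (r / s - 1)" using s by (intro mult_left_mono) auto
    then show ?thesis using s by (simp add: right_diff_distrib)
  qed
  have sq2: "s * q^2 \<le> 4 * (r - s)"
  proof -
    define u where "u = sqrt (r / s)"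
    have u: "u \<ge> 1" "u * u = r / s" using s by (auto simp: u_def)
    have "q \<le> 2 * (u - 1)" unfolding q_eq u_def using ln_le_2_sqrt[of "r / s"] s by simp
    then have "q^2 \<le> (2 * (u - 1))^2" using q0 by (intro power_mono) auto
    also have "\<dots> \<le> 4 * (r / s - 1)"
      unfolding u(2)[symmetric] using u(1) by (simp add: power2_eq_square algebra_simps)
    finally have "s * q^2 \<le> s * (4 * (r / s - 1))" using s by (intro mult_left_mono) auto
    then show ?thesis using s by (simp add: right_diff_distrib)
  qed
  have td: "\<bar>tent L r - tent L s\<bar> \<le> q" using tent_diff[of L r s] q0 by (simp add: q_def)
  have ts: "0 \<le> tent L s" "tent L s \<le> ln s" and tr: "0 \<le> tent L r" using tent_bounds[of s L] tent_bounds[of r L] s by auto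
  show ?thesis using k
  proof
    assume k: "k = 1"
    have "profile k L r - profile k L s = 2 * (tent L r - tent L s)" using k by (simp add: profile_def)
    then have "s * \<bar>profile k L r - profile k L s\<bar> = 2 * (s * \<bar>tent L r - tent L s\<bar>)" by (simp only: abs_mult)
    also have "\<dots> \<le> 2 * (s * q)" using td s by (intro mult_left_mono) auto
    also have "\<dots> \<le> 8 * (r - s)" using sq s by simp
    finally show ?thesis using k by simp
  next
    assume k: "k = 2"
    have "tent L r + tent L s \<le> 2 * ln s + q" using td ts by linarith
    then have "\<bar>tent L r - tent L s\<bar> * (tent L r + tent L s) \<le> q * (2 * ln s + q)"
      using td q0 tr ts by (intro mult_mono) auto
    moreover have "\<bar>profile k L r - profile k L s\<bar> = 2 * (\<bar>tent L r - tent L s\<bar> * (tent L r + tent L s))"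
    proof -
      have "profile k L r - profile k L s = 2 * ((tent L r - tent L s) * (tent L r + tent L s))"
        using k by (simp add: profile_def power2_eq_square algebra_simps)
      then show ?thesis using tr ts by (simp add: abs_mult)
    qed
    ultimately have "s * \<bar>profile k L r - profile k L s\<bar> \<le> s * (2 * (q * (2 * ln s + q)))"
      using s by (intro mult_left_mono) auto
    also have "\<dots> = 4 * ln s * (s * q) + 2 * (s * q^2)" by (simp add: power2_eq_square algebra_simps)
    also have "\<dots> \<le> 4 * ln s * (r - s) + 2 * (4 * (r - s))"
      using sq sq2 s by (intro add_mono mult_left_mono) auto
    also have "\<dots> \<le> 8 * (1 + ln s) * (r - s)"
    proof -
      have "0 \<le> ln s * (r - s)" using s by simp
      then show ?thesis by (simp add: algebra_simps)
    qed
    finally show ?thesis using k by simp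
  qed
qed

definition weight :: "nat \<Rightarrow> real \<Rightarrow> real \<Rightarrow> real" where
  "weight k L r = integral {1..r} (\<lambda>\<rho>. \<rho> * profile k L \<rho>)"

lemma weight_integrand_continuous: "continuous_on {1..r} (\<lambda>\<rho>. \<rho> * profile k L \<rho>)"
  by (intro continuous_intros continuous_on_subset[OF profile_continuous]) auto

lemma DERIV_weight:
  assumes "r > 1"
  shows "(weight k L has_real_derivative r * profile k L r) (at r)"
proof -
  have "(weight k L has_real_derivative r * profile k L r) (at r within {1..r + 1})"
    unfolding weight_def[abs_def]
    by (rule integral_has_real_derivative[OF weight_integrand_continuous]) (use assms in auto)
  then show ?thesis using at_within_interior[of r "{1..r+1}"] assms by simp
qed

lemma weight_nonneg: "k = 1 \<or> k = 2 \<Longrightarrow> 0 \<le> weight k L r"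
  unfolding weight_def
  by (intro integral_nonneg integrable_continuous_real weight_integrand_continuous)
     (auto intro!: mult_nonneg_nonneg profile_bounds)

lemma weight_upper:
  assumes k: "k = 1 \<or> k = 2" and r: "r \<ge> 1"
  shows "weight k L r \<le> 8 * r ^ 3"
proof -
  have "weight k L r \<le> integral {1..r} (\<lambda>\<rho>. r * (8 * r))" unfolding weight_def
  proof (rule integral_le)
    show "x * profile k L x \<le> r * (8 * r)" if "x \<in> {1..r}" for x
      using profile_bounds[OF k, of x L] that r by (intro mult_mono) auto
  qed (auto intro!: integrable_continuous_real weight_integrand_continuous)
  also have "\<dots> = (r - 1) * (r * (8 * r))" using r by simp
  also have "\<dots> \<le> r * (r * (8 * r))" using r by (intro mult_right_mono) auto
  finally show ?thesis by (simp add: power3_eq_cube)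
qed

lemma weight_growth:
  assumes k: "k = 1 \<or> k = 2"
  shows "\<exists>A. \<forall>r>1. \<bar>weight k L r\<bar> \<le> A * (1 + ln r)"
proof -
  define R where "R = max 1 (exp (2 * L))"
  have wR: "weight k L r \<le> 8 * R ^ 3" if r: "r > 1" for r
  proof (cases "r \<le> R")
    case True
    have "weight k L r \<le> 8 * r ^ 3" using weight_upper[OF k] r by simp
    also have "\<dots> \<le> 8 * R ^ 3" using True r by (intro mult_left_mono power_mono) auto
    finally show ?thesis .
  next
    case False
    have "weight k L r = weight k L R + integral {R..r} (\<lambda>\<rho>. \<rho> * profile k L \<rho>)"
      unfolding weight_def
      by (rule Henstock_Kurzweil_Integration.integral_combine[symmetric])
         (use False in \<open>auto simp: R_def intro!: integrable_continuous_real weight_integrand_continuous\<close>)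
    also have "integral {R..r} (\<lambda>\<rho>. \<rho> * profile k L \<rho>) = integral {R..r} (\<lambda>\<rho>. 0)"
    proof (rule integral_cong)
      fix x assume "x \<in> {R..r}"
      then have "x > 0" "exp (2 * L) \<le> x" by (auto simp: R_def)
      then show "x * profile k L x = 0" using profile_eq_0[of x L k] k by auto
    qed
    finally show ?thesis using weight_upper[OF k, of R] by (simp add: R_def)
  qed
  have "\<bar>weight k L r\<bar> \<le> (8 * R ^ 3) * (1 + ln r)" if r: "r > 1" for r
  proof -
    have "8 * R ^ 3 * 1 \<le> (8 * R ^ 3) * (1 + ln r)" using r by (intro mult_left_mono) (auto simp: R_def)
    then show ?thesis using wR[OF r] weight_nonneg[OF k, of L r] by linarith
  qed
  then show ?thesis by blast
qed

text \<open>
  For \<open>ln r > 4\<close> the shift by \<open>1\<close> and the halving of \<open>r\<close> cost at most half of the logarithm, so the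
  integral over the interval from \<open>r/2\<close> to \<open>r\<close> suffices.
\<close>
lemma weight_lower:
  assumes k: "k = 1 \<or> k = 2" and r: "1 < r" "ln r \<le> L"
  shows "r\<^sup>2 * ln r ^ k \<le> 8 * weight k L r + 16 * exp 8"
proof (cases "ln r \<le> 4")
  case True
  have l0: "ln r \<ge> 0" using r by simp
  have "r = exp (ln r)" using r by simp
  also have "\<dots> \<le> exp 4" using True by simp
  finally have "r\<^sup>2 \<le> (exp 4)\<^sup>2" using r by (intro power_mono) auto
  also have "\<dots> = exp 8" by (simp flip: exp_double)
  finally have r2: "r\<^sup>2 \<le> exp 8" .
  have "ln r ^ k \<le> 4 ^ k" using True l0 by (intro power_mono) auto
  also have "\<dots> \<le> (16::real)" using k by auto
  finally have "r\<^sup>2 * ln r ^ k \<le> exp 8 * 16" using r2 l0 by (intro mult_mono) auto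
  then show ?thesis using weight_nonneg[OF k, of L r] by simp
next
  case False
  have "r = exp (ln r)" using r by simp
  also have "\<dots> \<ge> exp 4" using False by simp
  finally have r4: "r \<ge> exp 4" .
  have "exp (4::real) \<ge> 1 + 4" by (rule exp_ge_add_one_self)
  then have r5: "r \<ge> 5" using r4 by linarith
  have ln2: "ln (2::real) \<le> 1" using ln_le_minus_one[of "2::real"] by simp
  define c where "c = r * ln r ^ k / 4"
  have pw: "c \<le> \<rho> * profile k L \<rho>" if \<rho>: "\<rho> \<in> {r/2..r}" for \<rho>
  proof -
    have "ln r = ln (r / 2) + ln 2" using r by (simp add: ln_div)
    moreover have "ln (r / 2) \<le> ln \<rho>" using \<rho> r by (intro ln_mono) auto
    ultimately have "ln \<rho> \<ge> ln r - 1" using ln2 by linarith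
    moreover have "ln \<rho> \<le> ln r" using \<rho> r5 by (intro ln_mono) auto
    ultimately have "tent L \<rho> \<ge> ln r / 2" unfolding tent_def using False r(2) by (simp add: max_def min_def)
    then have "(ln r / 2) ^ k \<le> tent L \<rho> ^ k" using False by (intro power_mono) auto
    moreover have "ln r ^ k / 4 \<le> (ln r / 2) ^ k"
      using k False by (auto simp: power_divide power2_eq_square)
    ultimately have "ln r ^ k / 2 \<le> profile k L \<rho>" by (simp add: profile_def)
    then have "(r / 2) * (ln r ^ k / 2) \<le> \<rho> * profile k L \<rho>" using \<rho> r5 False by (intro mult_mono) auto
    then show ?thesis by (simp add: c_def)
  qed
  have "c * (r / 2) = integral {r/2..r} (\<lambda>\<rho>. c)" using r by simp
  also have "\<dots> \<le> integral {r/2..r} (\<lambda>\<rho>. \<rho> * profile k L \<rho>)"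
  proof (rule integral_le)
    show "(\<lambda>\<rho>. \<rho> * profile k L \<rho>) integrable_on {r/2..r}"
      using r5 by (intro integrable_continuous_real continuous_on_subset[OF weight_integrand_continuous[of r]]) auto
  qed (use pw in auto)
  also have "\<dots> \<le> weight k L r"
    unfolding weight_def
  proof (rule integral_subset_le)
    show "(\<lambda>\<rho>. \<rho> * profile k L \<rho>) integrable_on {r/2..r}"
      using r5 by (intro integrable_continuous_real continuous_on_subset[OF weight_integrand_continuous[of r]]) auto
    show "(\<lambda>\<rho>. \<rho> * profile k L \<rho>) integrable_on {1..r}"
      by (intro integrable_continuous_real weight_integrand_continuous)
    show "\<forall>x\<in>{1..r}. 0 \<le> x * profile k L x" by (auto intro!: mult_nonneg_nonneg profile_bounds[OF k])
  qed (use r5 in auto)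
  finally have "r\<^sup>2 * ln r ^ k \<le> 8 * weight k L r" by (simp add: c_def power2_eq_square mult_ac)
  then show ?thesis using exp_gt_zero[of "8::real"] by linarith
qed

context euler_solution
begin

lemma profile_T_continuous: "continuous_on U (\<lambda>x. profile k L (norm (T x)))"
proof (rule continuous_on_compose2[OF profile_continuous])
  show "continuous_on U (\<lambda>x. norm (T x))" by (intro continuous_intros T_cont)
  show "(\<lambda>x. norm (T x)) ` U \<subseteq> {1..}" by (auto dest!: norm_T)
qed

text \<open>
  With \<open>s = |Y| \<le> r = |X|\<close> the difference splits into \<open>lam(x) (p(r) - p(s))\<close> and
  \<open>(lam(x) - lam(y)) p(s)\<close>. The kernel is at most \<open>s/d\<close>. The factor \<open>r - s \<le> d\<close> from \<open>profile_lipschitz\<close>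
  cancels the singularity of the first term, and \<open>lam(x) - lam(y) = O(1/s\<^sup>2)\<close> makes the second one
  \<open>O(1/d)\<close>.
\<close>
lemma radial_kernel_bound:
  assumes k: "k = 1 \<or> k = 2"
  shows "\<exists>C\<ge>0. \<forall>L. \<forall>x\<in>U. \<forall>y\<in>U. x \<noteq> y \<longrightarrow>
    \<bar>(lam x * profile k L (norm (T x)) - lam y * profile k L (norm (T y))) * swirl (T x) (T y)\<bar>
      \<le> C * (1 + real (k - 1) * min (ln (norm (T x))) (ln (norm (T y))) + near x y)"
proof -
  obtain CT where CT: "CT \<ge> 1" "\<And>x. x \<in> U \<Longrightarrow> norm (deriv T x) \<le> CT"
    using deriv_T_bounded by auto
  obtain CL where CL: "CL \<ge> 0" "\<And>x y. x \<in> U \<Longrightarrow> y \<in> U \<Longrightarrow> norm (T y) \<le> norm (T x) \<Longrightarrow> \<bar>lam x - lam y\<bar> \<le> CL / (norm (T y))\<^sup>2"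
    using lam_oscillation by metis
  define C where "C = 8 * CT\<^sup>2 + 8 * CL"
  have C0: "C \<ge> 0" using CL by (simp add: C_def)
  have main: "\<bar>(lam x * profile k L (norm (T x)) - lam y * profile k L (norm (T y))) * swirl (T x) (T y)\<bar>
      \<le> C * (1 + real (k - 1) * ln (norm (T y)) + near x y)"
    if xy: "x \<in> U" "y \<in> U" "x \<noteq> y" "norm (T y) \<le> norm (T x)" for L x y
  proof -
    define r s d where "r = norm (T x)" "s = norm (T y)" "d = norm (T x - T y)"
    define m where "m = 1 + real (k - 1) * ln s"
    define p where "p = profile k L"
    have XY: "norm (T x) > 1" "norm (T y) > 1" "T x \<noteq> T y" using xy norm_T T_eq_iff by auto
    have rs: "1 < s" "s \<le> r" "d > 0" using XY xy by (auto simp: r_s_d_def)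
    have m0: "m \<ge> 0" using rs by (simp add: m_def)
    have rd: "r - s \<le> d" unfolding r_s_d_def by (rule norm_triangle_ineq2)
    have sw: "\<bar>swirl (T x) (T y)\<bar> \<le> s / d" using swirl_le'[OF XY] by (simp add: r_s_d_def)
    have dn: "1 / d \<le> near x y" unfolding near_def r_s_d_def using XY by (intro inverse_le_sing) simp
    have lam_le: "lam x \<le> CT\<^sup>2" unfolding lam_def using CT(2)[OF xy(1)] by (intro power_mono) auto
    have lam0: "0 \<le> lam x" by (simp add: lam_def)
    have "lam x * p r - lam y * p s = lam x * (p r - p s) + (lam x - lam y) * p s" by (simp add: algebra_simps)
    then have "\<bar>lam x * p r - lam y * p s\<bar> \<le> lam x * \<bar>p r - p s\<bar> + \<bar>lam x - lam y\<bar> * p s"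
      using abs_triangle_ineq[of "lam x * (p r - p s)" "(lam x - lam y) * p s"] lam0 profile_bounds(1)[OF k, of s L] rs
      by (simp add: abs_mult p_def)
    then have "\<bar>(lam x * p r - lam y * p s) * swirl (T x) (T y)\<bar> \<le> (lam x * \<bar>p r - p s\<bar> + \<bar>lam x - lam y\<bar> * p s) * (s / d)"
      unfolding abs_mult using sw by (intro mult_mono) auto
    also have "\<dots> = lam x * (s * \<bar>p r - p s\<bar>) / d + \<bar>lam x - lam y\<bar> * p s * s / d" by (simp add: algebra_simps add_divide_distrib)
    also have "\<dots> \<le> CT\<^sup>2 * (8 * m) + 8 * CL * (1 / d)"
    proof (intro add_mono)
      have "s * \<bar>p r - p s\<bar> \<le> 8 * m * (r - s)" unfolding p_def m_def by (rule profile_lipschitz[OF k rs(1,2)])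
      also have "\<dots> \<le> 8 * m * d" using rd m0 by (intro mult_left_mono) auto
      finally have "s * \<bar>p r - p s\<bar> \<le> 8 * m * d" .
      then have "lam x * (s * \<bar>p r - p s\<bar>) \<le> CT\<^sup>2 * (8 * m * d)"
        by (rule mult_mono[OF lam_le]) (use rs in auto)
      then show "lam x * (s * \<bar>p r - p s\<bar>) / d \<le> CT\<^sup>2 * (8 * m)" using rs by (simp add: divide_le_eq mult.assoc)
      have "\<bar>lam x - lam y\<bar> * p s \<le> (CL / s\<^sup>2) * (8 * s)"
        using CL(2)[OF xy(1,2,4)] CL(1) profile_bounds[OF k, of s L] rs unfolding p_def r_s_d_def by (intro mult_mono) auto
      then have "\<bar>lam x - lam y\<bar> * p s * s \<le> (CL / s\<^sup>2) * (8 * s) * s" using rs by (intro mult_right_mono) auto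
      also have "\<dots> = 8 * CL" using rs by (simp add: power2_eq_square)
      finally show "\<bar>lam x - lam y\<bar> * p s * s / d \<le> 8 * CL * (1 / d)" using rs by (simp add: divide_right_mono)
    qed
    also have "\<dots> \<le> C * (m + near x y)"
    proof -
      have "8 * CL * (1 / d) \<le> 8 * CL * near x y" using dn CL(1) by (intro mult_left_mono) auto
      moreover have "0 \<le> 8 * CL * m + 8 * CT\<^sup>2 * near x y" using CL(1) m0 near_ge_1[of x y] by simp
      ultimately show ?thesis by (simp add: C_def algebra_simps)
    qed
    finally show ?thesis by (simp add: m_def p_def r_s_d_def)
  qed
  have "\<bar>(lam x * profile k L (norm (T x)) - lam y * profile k L (norm (T y))) * swirl (T x) (T y)\<bar>
      \<le> C * (1 + real (k - 1) * min (ln (norm (T x))) (ln (norm (T y))) + near x y)"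
    if xy: "x \<in> U" "y \<in> U" "x \<noteq> y" for L x y
  proof (cases "norm (T y) \<le> norm (T x)")
    case True
    then have "ln (norm (T y)) \<le> ln (norm (T x))" using norm_T[OF xy(2)] by (intro ln_mono) auto
    then show ?thesis using main[OF xy True, of L] by (simp add: min_def)
  next
    case False
    then have "ln (norm (T x)) \<le> ln (norm (T y))" using norm_T[OF xy(1)] by (intro ln_mono) auto
    moreover have "(lam x * profile k L (norm (T x)) - lam y * profile k L (norm (T y))) * swirl (T x) (T y)
       = (lam y * profile k L (norm (T y)) - lam x * profile k L (norm (T x))) * swirl (T y) (T x)"
      by (simp add: swirl_antisym[of "T x" "T y"] algebra_simps)
    ultimately show ?thesis using main[of y x L] xy False by (simp add: min_def near_commute)
  qed
  then show ?thesis using C0 by blast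
qed

text \<open>
  The rate of change is a double integral against an antisymmetric kernel; adding the integral with the
  two variables exchanged replaces the coefficient by a difference.
\<close>
lemma radial_rate_bound:
  assumes k: "k = 1 \<or> k = 2"
  shows "\<exists>C\<ge>0. \<forall>L. \<forall>t\<ge>0. \<bar>\<integral>x. w t x * (profile k L (norm (T x)) * lam x / (2 * pi) * circ (w t) x) \<partial>mu\<bar>
     \<le> C * (1 + real (k - 1) * min_log_pairing t)"
proof -
  obtain C where C: "C \<ge> 0" "\<And>L x y. x \<in> U \<Longrightarrow> y \<in> U \<Longrightarrow> x \<noteq> y \<Longrightarrow>
    \<bar>(lam x * profile k L (norm (T x)) - lam y * profile k L (norm (T y))) * swirl (T x) (T y)\<bar>
      \<le> C * (1 + real (k - 1) * min (ln (norm (T x))) (ln (norm (T y))) + near x y)"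
    using radial_kernel_bound[OF k] by metis
  obtain CT where CT: "CT \<ge> 1" "\<And>x. x \<in> U \<Longrightarrow> norm (deriv T x) \<le> CT"
    using deriv_T_bounded by auto
  define D where "D = C * (mass * mass + Q * mass + 1)"
  have "\<bar>\<integral>x. w t x * (profile k L (norm (T x)) * lam x / (2 * pi) * circ (w t) x) \<partial>mu\<bar> \<le> D * (1 + real (k - 1) * min_log_pairing t)"
    if t: "t \<ge> 0" for L t
  proof -
    note [measurable] = w_measurable[OF t]
    define p where "p x = lam x * profile k L (norm (T x))" for x
    have a: "integrable mu (\<lambda>x. \<bar>w t x\<bar>)" using w_integrable[OF t] by simp
    note nt = near_times_integrable[OF w_admissible[OF t] w_admissible[OF t]]
    have lam_cont: "continuous_on U lam" unfolding lam_def[abs_def] by (intro continuous_intros deriv_T_cont)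
    have "continuous_on U p" unfolding p_def[abs_def] by (intro continuous_intros lam_cont profile_T_continuous)
    then have pm [measurable]: "p \<in> borel_measurable mu" by (rule measurable_mu_continuous)
    define f where "f q = p (fst q) * swirl (T (fst q)) (T (snd q)) * w t (fst q) * w t (snd q)" for q
    have fm [measurable]: "f \<in> borel_measurable (mu \<Otimes>\<^sub>M mu)" unfolding f_def by measurable
    (* the truncation of the profile makes the unsymmetrized double integral absolutely convergent *)
    obtain R where R: "R \<ge> 0" "\<And>x. x \<in> U \<Longrightarrow> \<bar>p x\<bar> * norm (T x) \<le> R"
    proof -
      define R where "R = CT\<^sup>2 * (8 * exp (2 * L)) * exp (2 * L)"
      have "\<bar>p x\<bar> * norm (T x) \<le> R" if x: "x \<in> U" for x
      proof (cases "norm (T x) \<le> exp (2 * L)")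
        case True
        have l: "0 \<le> lam x" "lam x \<le> CT\<^sup>2" unfolding lam_def using CT(2)[OF x] by (auto intro: power_mono)
        have pr: "0 \<le> profile k L (norm (T x))" "profile k L (norm (T x)) \<le> 8 * norm (T x)"
          using profile_bounds[OF k, of "norm (T x)" L] norm_T[OF x] by auto
        have "\<bar>p x\<bar> = lam x * profile k L (norm (T x))" using l pr by (simp add: p_def)
        also have "\<dots> \<le> CT\<^sup>2 * (8 * exp (2 * L))" using l pr True by (intro mult_mono) auto
        finally show ?thesis unfolding R_def using True by (intro mult_mono) auto
      next
        case False
        then have "profile k L (norm (T x)) = 0" using norm_T[OF x] k by (intro profile_eq_0) auto
        then show ?thesis by (simp add: p_def R_def)
      qed
      moreover have "R \<ge> 0" by (simp add: R_def)
      ultimately show ?thesis using that by blast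
    qed
    have fi: "integrable (mu \<Otimes>\<^sub>M mu) f"
    proof (rule integrable_dominated[OF t t fm, where c = R])
      fix x y assume xy: "x \<in> U" "y \<in> U" "x \<noteq> y"
      have XY: "norm (T x) > 1" "norm (T y) > 1" "T x \<noteq> T y" using xy norm_T T_eq_iff by auto
      have dn: "1 / norm (T x - T y) \<le> near x y" unfolding near_def using XY by (intro inverse_le_sing) simp
      have "\<bar>p x\<bar> * \<bar>swirl (T x) (T y)\<bar> \<le> \<bar>p x\<bar> * (norm (T x) * (1 / norm (T x - T y)))"
        using swirl_le[OF XY] by (intro mult_left_mono) auto
      also have "\<dots> = (\<bar>p x\<bar> * norm (T x)) * (1 / norm (T x - T y))" by simp
      also have "\<dots> \<le> R * (1 + ln (norm (T x)) + ln (norm (T y)) + near x y)"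
        using R(1) R(2)[OF xy(1)] dn XY by (intro mult_mono) (auto simp: less_imp_le add_increasing)
      finally have "\<bar>p x\<bar> * \<bar>swirl (T x) (T y)\<bar> * \<bar>w t x\<bar> * \<bar>w t y\<bar> \<le> R * (1 + ln (norm (T x)) + ln (norm (T y)) + near x y) * \<bar>w t x\<bar> * \<bar>w t y\<bar>"
        by (intro mult_right_mono) auto
      then show "\<bar>f (x, y)\<bar> \<le> R * dominant t t (x, y)" by (simp add: f_def dominant_def abs_mult mult.assoc)
    qed
    define J where "J = integral\<^sup>L (mu \<Otimes>\<^sub>M mu) f"
    have "J = (\<integral>x. \<integral>y. f (x, y) \<partial>mu \<partial>mu)" unfolding J_def using mu2.integral_fst'[OF fi] by simp
    also have "\<dots> = (\<integral>x. 2 * pi * (w t x * (profile k L (norm (T x)) * lam x / (2 * pi) * circ (w t) x)) \<partial>mu)"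
    proof (intro Bochner_Integration.integral_cong refl)
      fix x
      have "(\<integral>y. f (x, y) \<partial>mu) = p x * w t x * circ (w t) x"
        unfolding circ_def f_def by (subst integral_mult_right_zero[symmetric]) (simp add: mult_ac)
      then show "(\<integral>y. f (x, y) \<partial>mu) = 2 * pi * (w t x * (profile k L (norm (T x)) * lam x / (2 * pi) * circ (w t) x))"
        by (simp add: p_def)
    qed
    finally have J_eq: "(\<integral>x. w t x * (profile k L (norm (T x)) * lam x / (2 * pi) * circ (w t) x) \<partial>mu) = J / (2 * pi)" by simp
    have fsi: "integrable (mu \<Otimes>\<^sub>M mu) (\<lambda>q. f (snd q, fst q))"
      using mu2.integrable_product_swap[OF fi] by (simp add: split_beta')
    define g where "g q = C * (\<bar>w t (fst q)\<bar> * \<bar>w t (snd q)\<bar>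
       + real (k - 1) * (min (ln (norm (T (fst q)))) (ln (norm (T (snd q)))) * \<bar>w t (fst q)\<bar> * \<bar>w t (snd q)\<bar>)
       + near (fst q) (snd q) * \<bar>w t (fst q)\<bar> * \<bar>w t (snd q)\<bar>)" for q
    have gi: "integrable (mu \<Otimes>\<^sub>M mu) g"
      unfolding g_def using product_integral(1)[OF a a] min_log_integrable[OF t] nt(1) by simp
    (* f and its transpose contain the same kernel up to sign, so their sum has the difference of the
       two coefficients as a factor *)
    have J2: "2 * J = (\<integral>q. f q + f (snd q, fst q) \<partial>(mu \<Otimes>\<^sub>M mu))"
      unfolding J_def using fi fsi integral_pair_swap[OF fm] by simp
    have "\<bar>2 * J\<bar> \<le> integral\<^sup>L (mu \<Otimes>\<^sub>M mu) g"
    proof -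
      have "norm (\<integral>q. f q + f (snd q, fst q) \<partial>(mu \<Otimes>\<^sub>M mu)) \<le> integral\<^sup>L (mu \<Otimes>\<^sub>M mu) g"
      proof (rule norm_integral_le_integral[OF _ gi])
        show "AE q in mu \<Otimes>\<^sub>M mu. norm (f q + f (snd q, fst q)) \<le> g q"
          using AE_pair_neq
        proof eventually_elim
          case (elim q)
          define x y where "x = fst q" "y = snd q"
          have q: "q = (x, y)" by (simp add: x_y_def)
          have xy: "x \<in> U" "y \<in> U" "x \<noteq> y" using elim by (auto simp: x_y_def)
          have "f q + f (snd q, fst q) = ((p x - p y) * swirl (T x) (T y)) * (w t x * w t y)"
            by (simp add: f_def q swirl_antisym[of "T y" "T x"] algebra_simps)
          then have "norm (f q + f (snd q, fst q)) = \<bar>(p x - p y) * swirl (T x) (T y)\<bar> * (\<bar>w t x\<bar> * \<bar>w t y\<bar>)"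
            by (simp add: abs_mult)
          also have "\<dots> \<le> (C * (1 + real (k - 1) * min (ln (norm (T x))) (ln (norm (T y))) + near x y)) * (\<bar>w t x\<bar> * \<bar>w t y\<bar>)"
            unfolding p_def using C(2)[OF xy, of L] by (intro mult_right_mono) auto
          also have "\<dots> = g q" by (simp add: g_def q algebra_simps)
          finally show ?case .
        qed
      qed (use fi fsi in auto)
      then show ?thesis unfolding J2 by simp
    qed
    also have "integral\<^sup>L (mu \<Otimes>\<^sub>M mu) g = C * (mass * mass + real (k - 1) * min_log_pairing t
       + (\<integral>q. near (fst q) (snd q) * \<bar>w t (fst q)\<bar> * \<bar>w t (snd q)\<bar> \<partial>(mu \<Otimes>\<^sub>M mu)))"
      unfolding g_def min_log_pairing_def using product_integral[OF a a] min_log_integrable[OF t] nt(1) by (simp add: L1_norm[OF t])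
    also have "\<dots> \<le> C * (mass * mass + real (k - 1) * min_log_pairing t + Q * mass)"
      using nt(2) C(1) by (intro mult_left_mono add_left_mono) (auto simp: L1_norm[OF t] Q_def)
    finally have 2: "\<bar>2 * J\<bar> \<le> C * (mass * mass + real (k - 1) * min_log_pairing t + Q * mass)" .
    have ml0: "min_log_pairing t \<ge> 0"
      unfolding min_log_pairing_def
    proof (rule integral_nonneg_AE)
      show "AE p in mu \<Otimes>\<^sub>M mu. 0 \<le> min (ln (norm (T (fst p)))) (ln (norm (T (snd p)))) * \<bar>w t (fst p)\<bar> * \<bar>w t (snd p)\<bar>"
        using AE_pair_neq by eventually_elim (use norm_T in \<open>auto simp: less_imp_le intro!: mult_nonneg_nonneg\<close>)
    qed
    have "\<bar>J / (2 * pi)\<bar> \<le> \<bar>2 * J\<bar>"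
    proof -
      have "\<bar>J\<bar> / (2 * pi) \<le> \<bar>J\<bar> / 1" using pi_ge_two by (intro divide_left_mono) auto
      then show ?thesis by (simp add: abs_divide)
    qed
    also note 2
    also have "C * (mass * mass + real (k - 1) * min_log_pairing t + Q * mass) \<le> D * (1 + real (k - 1) * min_log_pairing t)"
    proof -
      define z where "z = real (k - 1) * min_log_pairing t"
      have z: "z \<ge> 0" using ml0 by (simp add: z_def)
      have "0 \<le> C * (1 + (mass * mass + Q * mass) * z)" using C(1) z mass_nonneg Q_nonneg by auto
      then have "C * (mass * mass + z + Q * mass) \<le> D * (1 + z)" by (simp add: D_def algebra_simps)
      then show ?thesis by (simp add: z_def)
    qed
    finally show ?thesis unfolding J_eq .
  qed
  moreover have "D \<ge> 0" using C(1) mass_nonneg Q_nonneg by (simp add: D_def)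
  ultimately show ?thesis by blast
qed

text \<open>
  The truncated weights evolve at a rate that is bounded uniformly in the truncation. At a fixed time the
  support is compact, so a sufficiently large truncation parameter recovers the full moment.
\<close>
lemma moment_bound:
  assumes k: "k = 1 \<or> k = 2" and bdd: "\<exists>I. \<forall>t\<ge>0. real (k - 1) * min_log_pairing t \<le> I"
  shows "\<exists>M>0. \<forall>t\<ge>0. (\<integral>x. (norm (T x))\<^sup>2 * ln (norm (T x)) ^ k * w t x \<partial>mu) \<le> M * (1 + t)"
proof -
  obtain C where C: "C \<ge> 0" "\<forall>L. \<forall>t\<ge>0. \<bar>\<integral>x. w t x * (profile k L (norm (T x)) * lam x / (2 * pi) * circ (w t) x) \<partial>mu\<bar>
     \<le> C * (1 + real (k - 1) * min_log_pairing t)" using radial_rate_bound[OF k] by (elim exE conjE)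
  obtain I where I: "\<And>t. t \<ge> 0 \<Longrightarrow> real (k - 1) * min_log_pairing t \<le> I" using bdd by auto
  define B where "B = C * (1 + I)"
  have rate: "\<bar>\<integral>x. w t x * (profile k L (norm (T x)) * lam x / (2 * pi) * circ (w t) x) \<partial>mu\<bar> \<le> B" if "t \<ge> 0" for L t
    using C(2)[rule_format, OF that, of L] mult_left_mono[OF add_left_mono[OF I[OF that], of 1] C(1)] unfolding B_def by linarith
  define W where "W L t = (\<integral>x. weight k L (norm (T x)) * w t x \<partial>mu)" for L t
  have weight_deriv: "GDERIV (\<lambda>x. weight k L (norm (T x))) x :> cnj (deriv T x) * (of_real (profile k L (norm (T x))) * T x)"
    if x: "x \<in> U" for L x
  proof -
    have "norm (T x) * profile k L (norm (T x)) / norm (T x) = profile k L (norm (T x))"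
      using norm_T[OF x] by auto
    then show ?thesis using radial_GDERIV[OF x DERIV_weight[OF norm_T[OF x]], of k L] by (simp only:)
  qed
  have weight_cont: "continuous_on U (\<lambda>x. weight k L (norm (T x)))" for L
    using weight_deriv unfolding gderiv_def by (intro continuous_at_imp_continuous_on ballI has_derivative_continuous)
  have evol: "\<bar>W L t - W L 0\<bar> \<le> B * t" if t: "t \<ge> 0" for L t
  proof -
    obtain A where A: "\<And>r. r > 1 \<Longrightarrow> \<bar>weight k L r\<bar> \<le> A * (1 + ln r)" using weight_growth[OF k] by blast
    (* from this index on the cutoff equals 1 wherever the profile is nonzero *)
    define n0 where "n0 = nat \<lceil>max 2 (exp (2 * L))\<rceil>"
    have "\<bar>W L t - W L 0\<bar> \<le> B * (t - 0)"
      unfolding W_def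
    proof (rule evolution_bound[where A = A and ?n0.0 = n0])
      show "continuous_on U (\<lambda>x. cnj (deriv T x) * (of_real (profile k L (norm (T x))) * T x))"
        by (intro continuous_intros deriv_T_cont T_cont profile_T_continuous)
      show "\<bar>weight k L (norm (T x))\<bar> \<le> A * (1 + ln (norm (T x)))" if "x \<in> U" for x
        by (rule A[OF norm_T[OF that]])
      fix n \<tau> assume n: "n \<ge> n0" and \<tau>: "0 < \<tau>" "\<tau> < t"
      have n2: "n \<ge> 2" "exp (2 * L) \<le> real n" using n unfolding n0_def by linarith+
      have "(\<integral>x. cutoff n (norm (T x)) * (w \<tau> x * inner (\<i> * flow \<tau> x) (cnj (deriv T x) * (of_real (profile k L (norm (T x))) * T x))) \<partial>mu)
          = (\<integral>x. w \<tau> x * (profile k L (norm (T x)) * lam x / (2 * pi) * circ (w \<tau>) x) \<partial>mu)"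
      proof (intro Bochner_Integration.integral_cong refl)
        fix x assume "x \<in> space mu"
        then have x: "x \<in> U" by simp
        have "cutoff n (norm (T x)) * profile k L (norm (T x)) = profile k L (norm (T x))"
        proof (cases "profile k L (norm (T x)) = 0")
          case False
          have r1: "norm (T x) > 1" by (rule norm_T[OF x])
          have "\<not> (norm (T x) \<le> exp 1 \<or> exp (2 * L) \<le> norm (T x))"
          proof
            assume out: "norm (T x) \<le> exp 1 \<or> exp (2 * L) \<le> norm (T x)"
            have "profile k L (norm (T x)) = 0" by (rule profile_eq_0[OF _ out]) (use r1 k in linarith)+
            then show False using False by simp
          qed
          moreover have "exp (1::real) \<ge> 1 + 1" by (rule exp_ge_add_one_self)
          moreover have "2 / real n \<le> 1" using n2(1) by (simp add: divide_le_eq)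
          ultimately have "cutoff n (norm (T x)) = 1" using n2 by (intro cutoff_eq_1) linarith+
          then show ?thesis by simp
        qed simp
        moreover have "cutoff n (norm (T x)) * (w \<tau> x * (profile k L (norm (T x)) * lam x / (2 * pi) * circ (w \<tau>) x))
          = w \<tau> x * ((cutoff n (norm (T x)) * profile k L (norm (T x))) * lam x / (2 * pi) * circ (w \<tau>) x)"
          by simp
        ultimately show "cutoff n (norm (T x)) * (w \<tau> x * inner (\<i> * flow \<tau> x) (cnj (deriv T x) * (of_real (profile k L (norm (T x))) * T x)))
          = w \<tau> x * (profile k L (norm (T x)) * lam x / (2 * pi) * circ (w \<tau>) x)"
          unfolding radial_flux[OF less_imp_le[OF \<tau>(1)] x] by (simp only:)
      qed
      then show "\<bar>\<integral>x. cutoff n (norm (T x)) * (w \<tau> x * inner (\<i> * flow \<tau> x) (cnj (deriv T x) * (of_real (profile k L (norm (T x))) * T x))) \<partial>mu\<bar> \<le> B"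
        using rate[of \<tau> L] \<tau> by simp
    qed (use t weight_deriv in auto)
    then show ?thesis by simp
  qed
  have cube_int: "integrable mu (\<lambda>x. norm (T x) ^ 3 * w 0 x)"
    by (rule integrable_continuous_times_w) (auto intro!: continuous_intros T_cont)
  define N where "N = 8 * (\<integral>x. norm (T x) ^ 3 * w 0 x \<partial>mu)"
  have W0: "W L 0 \<le> N" for L
  proof -
    have "W L 0 \<le> (\<integral>x. 8 * (norm (T x) ^ 3 * w 0 x) \<partial>mu)" unfolding W_def
    proof (rule integral_mono)
      show "integrable mu (\<lambda>x. weight k L (norm (T x)) * w 0 x)"
        by (rule integrable_continuous_times_w[OF _ weight_cont]) simp
      fix x assume "x \<in> space mu"
      then have x: "x \<in> U" by simp
      have "w 0 x \<ge> 0" using initial_nonneg[of x] w_initial[OF x] x by (simp add: U_def)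
      then have "weight k L (norm (T x)) * w 0 x \<le> (8 * norm (T x) ^ 3) * w 0 x"
        using norm_T[OF x] by (intro mult_right_mono weight_upper[OF k]) auto
      then show "weight k L (norm (T x)) * w 0 x \<le> 8 * (norm (T x) ^ 3 * w 0 x)" by simp
    qed (use cube_int in simp)
    then show ?thesis by (simp add: N_def)
  qed
  have bound: "(\<integral>x. (norm (T x))\<^sup>2 * ln (norm (T x)) ^ k * w t x \<partial>mu) \<le> 8 * (N + B * t) + 16 * exp 8 * mass"
    if t: "t \<ge> 0" for t
  proof -
    obtain K where K: "compact K" "K \<subseteq> U" "\<And>x. x \<in> U - K \<Longrightarrow> w t x = 0" using w_support[OF t] by blast
    have "compact ((\<lambda>x. ln (norm (T x))) ` K)"
      by (intro compact_continuous_image K(1) continuous_on_subset[OF ln_T_continuous K(2)])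
    then have "bounded ((\<lambda>x. ln (norm (T x))) ` K)" by (rule compact_imp_bounded)
    then obtain L where "\<forall>x\<in>K. \<bar>ln (norm (T x))\<bar> \<le> L" by (auto simp: bounded_iff)
    then have L: "ln (norm (T x)) \<le> L" if "x \<in> K" for x using that by fastforce
    have iw: "integrable mu (\<lambda>x. weight k L (norm (T x)) * w t x)"
      by (rule integrable_continuous_times_w[OF t weight_cont])
    have "(\<integral>x. (norm (T x))\<^sup>2 * ln (norm (T x)) ^ k * w t x \<partial>mu)
       \<le> (\<integral>x. 8 * (weight k L (norm (T x)) * w t x) + 16 * exp 8 * w t x \<partial>mu)"
    proof (rule integral_mono_AE)
      show "integrable mu (\<lambda>x. (norm (T x))\<^sup>2 * ln (norm (T x)) ^ k * w t x)"
        by (rule integrable_continuous_times_w[OF t]) (intro continuous_intros T_cont ln_T_continuous)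
      show "integrable mu (\<lambda>x. 8 * (weight k L (norm (T x)) * w t x) + 16 * exp 8 * w t x)"
        using iw w_integrable[OF t] by simp
      show "AE x in mu. (norm (T x))\<^sup>2 * ln (norm (T x)) ^ k * w t x \<le> 8 * (weight k L (norm (T x)) * w t x) + 16 * exp 8 * w t x"
        using w_nonneg_AE[OF t] AE_mu_in
      proof eventually_elim
        case (elim x)
        show ?case
        proof (cases "x \<in> K")
          case True
          have "(norm (T x))\<^sup>2 * ln (norm (T x)) ^ k \<le> 8 * weight k L (norm (T x)) + 16 * exp 8"
            by (rule weight_lower[OF k norm_T[OF elim(2)] L[OF True]])
          from mult_right_mono[OF this elim(1)] show ?thesis by (simp add: distrib_right)
        qed (use K(3) elim in simp)
      qed
    qed
    also have "\<dots> = 8 * W L t + 16 * exp 8 * mass"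
      unfolding W_def using iw w_integrable[OF t] mass_conserved[OF t] by simp
    also have "\<dots> \<le> 8 * (N + B * t) + 16 * exp 8 * mass"
    proof -
      have "W L t \<le> N + B * t" using evol[OF t, of L] W0[of L] by linarith
      then show ?thesis by simp
    qed
    finally show ?thesis .
  qed
  define M where "M = 8 * \<bar>N\<bar> + 8 * \<bar>B\<bar> + 16 * exp 8 * mass + 1"
  have M0: "M > 0" using mass_nonneg by (simp add: M_def add_nonneg_pos)
  have "8 * (N + B * t) + 16 * exp 8 * mass \<le> M * (1 + t)" if t: "t \<ge> 0" for t
  proof -
    have "B * t \<le> \<bar>B\<bar> * t" using t by (intro mult_right_mono) auto
    moreover have "0 \<le> 8 * \<bar>B\<bar> + 1 + (8 * \<bar>N\<bar> + 16 * exp 8 * mass + 1) * t" using t mass_nonneg by simp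
    ultimately show ?thesis unfolding M_def by (simp add: algebra_simps)
  qed
  then show ?thesis using M0 order_trans[OF bound] by (intro exI[of _ M]) auto
qed

end

lemma closed_smooth_Jordan_curve: "smooth_Jordan_curve \<Gamma> \<Longrightarrow> closed \<Gamma>"
  unfolding smooth_Jordan_curve_def by (auto simp: simple_path_def closed_path_image)

theorem theorem10:
  fixes \<Gamma> :: "complex set" and T :: "complex \<Rightarrow> complex" and \<alpha> m :: real
    and \<omega>\<^sub>0 :: "complex \<Rightarrow> real" and \<omega> :: "complex \<Rightarrow> real \<Rightarrow> real"
  assumes "smooth_Jordan_curve \<Gamma>"
    and "exterior_conformal_map \<Gamma> T"
    and "smooth_on (outside \<Gamma>) \<omega>\<^sub>0"
    and "compactly_supported_in (outside \<Gamma>) \<omega>\<^sub>0"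
    and "\<forall>x\<in>outside \<Gamma>. \<omega>\<^sub>0 x \<ge> 0"
    and "m = (LINT x:outside \<Gamma>|lborel. \<omega>\<^sub>0 x)"
    and "vorticity_solution (outside \<Gamma>) T \<alpha> \<omega>\<^sub>0 \<omega>"
  shows "(\<exists>M>0. \<forall>t\<ge>0.
            (LINT x:outside \<Gamma>|lborel. (norm (T x))\<^sup>2 * ln (norm (T x)) * \<omega> x t) \<le> M * (1 + t)) \<and>
         (\<alpha> \<le> 0 \<or> \<alpha> > m \<longrightarrow>
           (\<exists>M>0. \<forall>t\<ge>0.
              (LINT x:outside \<Gamma>|lborel. (norm (T x))\<^sup>2 * (ln (norm (T x)))\<^sup>2 * \<omega> x t) \<le> M * (1 + t)))"
proof -
  interpret euler_solution \<Gamma> T \<alpha> \<omega>\<^sub>0 \<omega>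
    by unfold_locales (use assms closed_smooth_Jordan_curve in auto)
  have m: "m = mass" unfolding assms(6) mass_def U_def[symmetric] by (rule integral_mu)
  show ?thesis
    unfolding U_def[symmetric] integral_mu
  proof (intro conjI impI)
    show "\<exists>M>0. \<forall>t\<ge>0. (\<integral>x. (norm (T x))\<^sup>2 * ln (norm (T x)) * \<omega> x t \<partial>mu) \<le> M * (1 + t)"
      using moment_bound[of 1] by auto
  next
    assume "\<alpha> \<le> 0 \<or> m < \<alpha>"
    then have "\<exists>C. \<forall>t\<ge>0. min_log_pairing t \<le> C" unfolding m by (rule min_log_pairing_bounded)
    then show "\<exists>M>0. \<forall>t\<ge>0. (\<integral>x. (norm (T x))\<^sup>2 * (ln (norm (T x)))\<^sup>2 * \<omega> x t \<partial>mu) \<le> M * (1 + t)"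
      using moment_bound[of 2] by auto
  qed
qed

end
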